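(* The condition number of the mass matrix $\mathbf{M}$ related to the aggregated finite element space $\mathcal{V}_h^{\mathrm{ag}}$, $\mathbf{M}_{\sigma\sigma'}=\int_\Omega\tilde\phi^\sigma\tilde\phi^{\sigma'}\,d\Omega$ for $\sigma,\sigma'\in\Sigma^{\mathrm{W,F}}$, is bounded by $k(\mathbf{M})\le C$, for a positive constant $C>0$ independent of the cut location (that is, of the intersection between $\partial\Omega$ and the mesh).
   Context: **Geometry and mesh.** $\Omega\subset\mathbb{R}^d$, $d\in\{2,3\}$, is an open bounded polygonal domain, contained in an artificial domain $\Omega^{\mathrm{art}}$ of simple shape. $\mathcal{T}_h$ is a partition of $\Omega^{\mathrm{art}}$ into cells obtained by recursively applying the isotropic $1{:}2^d$ refinement rule to an initial coarse mesh (forest-of-trees mesh), generally non-conforming, and 2:1 balanced: any two cells meeting at a vertex, edge or face differ by at most one refinement level. $h_T$ is the characteristic size of $T$. $\mathcal{F}_T$ is the set of vertices, edges and (if $d=3$) faces (VEFs) of $T$. For two cells with $\overline T\cap\overline{T'}\ne\emptyset$ there are $f\in\mathcal{F}_T$, $f'\in\mathcal{F}_{T'}$ with either $\overline f=\overline{f'}=\overline T\cap\overline{T'}$ (conforming case), or $\overline f=\overline T\cap\overline{T'}$ and $f\subsetneq f'$ (or vice versa); in the latter case any VEF $g\in\mathcal{F}_T$ with $g\subset\overline f$ is called hanging and $f'$ is its owner VEF. Fix $\eta_0\in(0,1]$ and $\eta_T=|T\cap\Omega|/|T|$. A cell is well-posed if $\eta_T\ge\eta_0$, ill-posed if $0<\eta_T<\eta_0$,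 exterior if $\eta_T=0$; the sets of well- and ill-posed cells are $\mathcal{T}_h^{\mathrm W},\mathcal{T}_h^{\mathrm I}$, and $\mathcal{T}_h^{\mathrm{act}}=\mathcal{T}_h^{\mathrm W}\cup\mathcal{T}_h^{\mathrm I}$. It is assumed that $T\cap\Omega$ is connected for every $T\in\mathcal{T}_h$. **Aggregation.** The root cell map $R$ sends each active cell to a well-posed cell. Well-posed cells are their own roots. Then, iteratively, each not yet aggregated ill-posed cell $T$ that shares a (conforming or hanging) facet $F$ with $\overline F=\overline T\cap\overline{T'}$, $F\cap\Omega\ne\emptyset$, with already aggregated cells $T'$, is given the root $R(T')$ of the candidate $T'$ minimising $\max_{\gamma,\delta}\|x^\gamma-x^\delta\|_\infty/\max_{\gamma,\gamma'}\|x^\gamma-x^{\gamma'}\|_\infty$, where $\gamma,\gamma'$ range over the vertices of $R(T')$ and $\delta$ over the vertices of $T$ (ties: higher global index of the root), until all ill-posed cells are aggregated. **Spaces.** $\mathcal{V}(T)$ is the scalar Lagrangian finite element space of a fixed order $q$ on $T$. $\mathcal{V}_h^{\mathrm{ncf}}$ is the global Lagrangian space on $\mathcal{T}_h^{\mathrm{act}}$ obtained by gluing local degrees of freedom (DOFs) at the same position across conforming VEFs; $\Sigma$ is its set of global DOFs, $x^\sigma$ the node of $\sigma$, $v_h^\sigma$ the nodal values, and $\phi^\sigma$ the shape functions. $\Sigma=\Sigma^{\mathrm F}\cup\Sigma^{\mathrm H}$ (disjoint), where the hanging DOFs $\Sigma^{\mathrm H}$ are those lying only on hanging VEFs and $\Sigma^{\mathrm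 F}$ are the free ones. For $\sigma\in\Sigma^{\mathrm H}$, $\mathcal{M}^{\mathrm H}_\sigma$ is the set of DOFs $\sigma'$ in the closure of the owner VEF (of a coarser cell) constraining $\sigma$, with coefficient $C^{\mathrm H}_{\sigma\sigma'}=\phi^{\sigma'}(x^\sigma)\neq0$ (trace from the coarser cell). $\mathcal{V}_h^{\mathrm{std}}=\{v_h\in\mathcal{V}_h^{\mathrm{ncf}}: v_h^\sigma=\sum_{\sigma'\in\mathcal{M}^{\mathrm H}_\sigma}C^{\mathrm H}_{\sigma\sigma'}v_h^{\sigma'}\ \forall\sigma\in\Sigma^{\mathrm H}\}$. $\Sigma^{\mathrm{W,H}}\subset\Sigma^{\mathrm H}$ are the hanging DOFs that are local DOFs of at least one well-posed cell. $\Sigma^{\mathrm{W,F}}\subset\Sigma^{\mathrm F}$ (well-posed free DOFs) are the free DOFs $\sigma$ such that (i) $\sigma$ is a local DOF of some well-posed cell, or (ii) not (i), but $\sigma\in\mathcal{M}^{\mathrm H}_{\sigma'}$ for some $\sigma'\in\Sigma^{\mathrm{W,H}}$. $\Sigma^{\mathrm{I,F}}=\Sigma^{\mathrm F}\setminus\Sigma^{\mathrm{W,F}}$. Each $\sigma\in\Sigma^{\mathrm{I,F}}$ is assigned to one of its surrounding ill-posed cells, and $K(\sigma)\in\mathcal{T}_h^{\mathrm W}$ is the root of that cell. The aggregated space $\mathcal{V}_h^{\mathrm{ag}}$ is the set of $v_h\in\mathcal{V}_h^{\mathrm{std}}$ such that, for all $\sigma\in\Sigma^{\mathrm{I,F}}$,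 $v_h^\sigma=\sum_{\tilde\sigma}\phi^{\tilde\sigma}(x^\sigma)v_h^{\tilde\sigma}$, the sum being over DOFs $\tilde\sigma$ of $K(\sigma)$ and $\phi^{\tilde\sigma}$ being evaluated by polynomial extension from $K(\sigma)$. Functions in $\mathcal{V}_h^{\mathrm{ag}}$ are determined by their (arbitrary) values at $\Sigma^{\mathrm{W,F}}$; for $\sigma\in\Sigma^{\mathrm{W,F}}$, $\tilde\phi^\sigma\in\mathcal{V}_h^{\mathrm{ag}}$ is the shape function after solving constraints, i.e. the one with value $1$ at $\sigma$ and $0$ at all other well-posed free DOFs. $k(\cdot)$ denotes the (spectral) condition number. The constant may depend on $\eta_0$. *)

theory Defs
  imports "HOL-Analysis.Analysis"
begin

section \<open>Cells and forest-of-trees meshes\<close>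

text \<open>A cell is the image of the unit cube under the affine map x |-> origin + jac x; the level
  counts the refinements separating it from the coarse mesh. With affine maps the local finite
  element functions are polynomials in the physical coordinates, so they extend off the cell.\<close>

datatype ('d::finite) cell =
  Cell (level: nat) (origin: "real ^ 'd") (jac: "real ^ 'd ^ 'd")

definition cell_map :: "'d::finite cell \<Rightarrow> real ^ 'd \<Rightarrow> real ^ 'd" where
  "cell_map T \<xi> = origin T + jac T *v \<xi>"

definition ref_coord :: "'d::finite cell \<Rightarrow> real ^ 'd \<Rightarrow> real ^ 'd" where
  "ref_coord T x = matrix_inv (jac T) *v (x - origin T)"

definition open_cell :: "'d::finite cell \<Rightarrow> (real ^ 'd) set" where
  "open_cell T = cell_map T ` box 0 1"

definition closed_cell :: "'d::finite cell \<Rightarrow> (real ^ 'd) set" where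
  "closed_cell T = cell_map T ` cbox 0 1"

definition vertices :: "'d::finite cell \<Rightarrow> (real ^ 'd) set" where
  "vertices T = {x. x extreme_point_of closed_cell T}"

text \<open>Vertices, edges and faces are represented by their closures.\<close>

definition vefs :: "'d::finite cell \<Rightarrow> (real ^ 'd) set set" where
  "vefs T = {f. f face_of closed_cell T \<and> f \<noteq> {} \<and> f \<noteq> closed_cell T}"

definition children :: "'d::finite cell \<Rightarrow> 'd cell set" where
  "children T =
     {Cell (Suc (level T)) (cell_map T ((1/2) *\<^sub>R b)) ((1/2) *\<^sub>R jac T) | b. \<forall>i. b $ i \<in> {0, 1}}"

definition coarse_mesh :: "(real ^ 'd) set \<Rightarrow> 'd::finite cell set \<Rightarrow> bool" where
  "coarse_mesh art \<C> \<longleftrightarrow>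
     finite \<C> \<and>
     (\<forall>T\<in>\<C>. level T = 0 \<and> invertible (jac T)) \<and>
     (\<forall>T\<in>\<C>. \<forall>T'\<in>\<C>. T \<noteq> T' \<longrightarrow> closed_cell T \<inter> closed_cell T' \<in> {{}} \<union> (vefs T \<inter> vefs T')) \<and>
     open art \<and> closure art = (\<Union>T\<in>\<C>. closed_cell T)"

inductive refinement_of :: "'d::finite cell set \<Rightarrow> 'd cell set \<Rightarrow> bool" for \<C> where
  coarse: "refinement_of \<C> \<C>"
| refine: "refinement_of \<C> \<T> \<Longrightarrow> T \<in> \<T> \<Longrightarrow> refinement_of \<C> (\<T> - {T} \<union> children T)"

definition balanced :: "'d::finite cell set \<Rightarrow> bool" where
  "balanced \<T> \<longleftrightarrow>
     (\<forall>T\<in>\<T>. \<forall>T'\<in>\<T>. closed_cell T \<inter> closed_cell T' \<noteq> {} \<longrightarrow> level T \<le> level T' + 1)"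

definition forest_mesh :: "(real ^ 'd) set \<Rightarrow> 'd::finite cell set \<Rightarrow> bool" where
  "forest_mesh art \<T> \<longleftrightarrow> (\<exists>\<C>. coarse_mesh art \<C> \<and> refinement_of \<C> \<T> \<and> balanced \<T>)"

section \<open>Physical domain and cut cells\<close>

definition polygonal_domain :: "(real ^ 'd::finite) set \<Rightarrow> bool" where
  "polygonal_domain \<Omega> \<longleftrightarrow>
     open \<Omega> \<and> bounded \<Omega> \<and> connected \<Omega> \<and> \<Omega> \<noteq> {} \<and>
     (\<exists>P. finite P \<and> (\<forall>p\<in>P. polytope p \<and> aff_dim p = int CARD('d) - 1) \<and> frontier \<Omega> = \<Union>P)"

definition vol_frac :: "(real ^ 'd) set \<Rightarrow> 'd::finite cell \<Rightarrow> real" where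
  "vol_frac \<Omega> T = measure lborel (open_cell T \<inter> \<Omega>) / measure lborel (open_cell T)"

definition well_posed :: "real \<Rightarrow> (real ^ 'd) set \<Rightarrow> 'd::finite cell set \<Rightarrow> 'd cell set" where
  "well_posed \<eta>\<^sub>0 \<Omega> \<T> = {T\<in>\<T>. vol_frac \<Omega> T \<ge> \<eta>\<^sub>0}"

definition ill_posed :: "real \<Rightarrow> (real ^ 'd) set \<Rightarrow> 'd::finite cell set \<Rightarrow> 'd cell set" where
  "ill_posed \<eta>\<^sub>0 \<Omega> \<T> = {T\<in>\<T>. 0 < vol_frac \<Omega> T \<and> vol_frac \<Omega> T < \<eta>\<^sub>0}"

definition active :: "real \<Rightarrow> (real ^ 'd) set \<Rightarrow> 'd::finite cell set \<Rightarrow> 'd cell set" where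
  "active \<eta>\<^sub>0 \<Omega> \<T> = well_posed \<eta>\<^sub>0 \<Omega> \<T> \<union> ill_posed \<eta>\<^sub>0 \<Omega> \<T>"

section \<open>Aggregation\<close>

definition facet_neighbours :: "(real ^ 'd) set \<Rightarrow> 'd::finite cell \<Rightarrow> 'd cell \<Rightarrow> bool" where
  "facet_neighbours \<Omega> T T' \<longleftrightarrow>
     (let F = closed_cell T \<inter> closed_cell T' in
        (F facet_of closed_cell T \<or> F facet_of closed_cell T') \<and> F \<inter> \<Omega> \<noteq> {})"

definition rel_distance :: "'d::finite cell \<Rightarrow> 'd cell \<Rightarrow> real" where
  "rel_distance K T =
     Max {infnorm (x - y) | x y. x \<in> vertices K \<and> y \<in> vertices T} /
     Max {infnorm (x - y) | x y. x \<in> vertices K \<and> y \<in> vertices K}"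

definition best_root :: "('d::finite cell \<Rightarrow> nat) \<Rightarrow> 'd cell \<Rightarrow> 'd cell set \<Rightarrow> 'd cell" where
  "best_root idx T S =
     (THE K. K \<in> S \<and>
        (\<forall>K'\<in>S. rel_distance K T < rel_distance K' T \<or>
                (rel_distance K T = rel_distance K' T \<and> idx K' \<le> idx K)))"

text \<open>The partial root map after n sweeps. A sweep treats all cells simultaneously: candidates
  are the cells aggregated in the previous sweeps.\<close>

primrec aggregate ::
  "('d::finite cell \<Rightarrow> nat) \<Rightarrow> (real ^ 'd) set \<Rightarrow> 'd cell set \<Rightarrow> 'd cell set \<Rightarrow> nat \<Rightarrow> 'd cell \<rightharpoonup> 'd cell"
where
  "aggregate idx \<Omega> \<W> \<I> 0 = (\<lambda>T. if T \<in> \<W> then Some T else None)"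
| "aggregate idx \<Omega> \<W> \<I> (Suc n) =
     (let R = aggregate idx \<Omega> \<W> \<I> n;
          cand = (\<lambda>T. {K. \<exists>T'. R T' = Some K \<and> facet_neighbours \<Omega> T T'})
      in (\<lambda>T. if R T = None \<and> T \<in> \<I> \<and> cand T \<noteq> {} then Some (best_root idx T (cand T)) else R T))"

definition root_cell_map ::
  "('d::finite cell \<Rightarrow> nat) \<Rightarrow> (real ^ 'd) set \<Rightarrow> 'd cell set \<Rightarrow> 'd cell set \<Rightarrow> ('d cell \<Rightarrow> 'd cell) \<Rightarrow> bool"
where
  "root_cell_map idx \<Omega> \<W> \<I> R \<longleftrightarrow> (\<exists>n. \<forall>T\<in>\<W> \<union> \<I>. aggregate idx \<Omega> \<W> \<I> n T = Some (R T))"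

section \<open>Lagrangian degrees of freedom\<close>

definition nodes :: "nat \<Rightarrow> 'd::finite cell \<Rightarrow> (real ^ 'd) set" where
  "nodes q T = {cell_map T (\<chi> i. real (k i) / real q) | k. \<forall>i. k i \<le> q}"

text \<open>The Lagrange polynomial of the space of tensor-product polynomials of degree q on T that
  belongs to the node y, as a polynomial on the whole space.\<close>

definition shape :: "nat \<Rightarrow> 'd::finite cell \<Rightarrow> real ^ 'd \<Rightarrow> real ^ 'd \<Rightarrow> real" where
  "shape q T y x =
     (\<Prod>i\<in>UNIV. \<Prod>t\<in>{real j / real q | j. j \<le> q} - {ref_coord T y $ i}.
        (ref_coord T x $ i - t) / (ref_coord T y $ i - t))"

text \<open>A global degree of freedom is a pair (g, x) of a node x and the smallest closed VEF g
  (or the whole cell, for interior nodes) that contains it. Local degrees of freedom of two cells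
  are thus glued iff they have the same position and sit on a VEF common to both cells. The
  position alone would not do: at a hanging vertex, an unglued node of the coarse cell may have
  the same position.\<close>

type_synonym 'd dof = "(real ^ 'd) set \<times> (real ^ 'd)"

definition local_dofs :: "nat \<Rightarrow> 'd::finite cell \<Rightarrow> 'd dof set" where
  "local_dofs q T = (\<lambda>x. (\<Inter>{g. g face_of closed_cell T \<and> x \<in> g}, x)) ` nodes q T"

definition dofs :: "nat \<Rightarrow> 'd::finite cell set \<Rightarrow> 'd dof set" where
  "dofs q \<A> = (\<Union>T\<in>\<A>. local_dofs q T)"

text \<open>g is a hanging VEF of T, and f' is an owner VEF of it, belonging to the cell T'. Cells meeting
  in a common VEF f conform, even though f may be a proper subset of further VEFs of T'.\<close>

definition owner :: "'d::finite cell set \<Rightarrow> 'd cell \<Rightarrow> (real ^ 'd) set \<Rightarrow> 'd cell \<Rightarrow> (real ^ 'd) set \<Rightarrow> bool" where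
  "owner \<A> T g T' f' \<longleftrightarrow>
     T' \<in> \<A> \<and> g \<in> vefs T \<and> f' \<in> vefs T' \<and>
     (let f = closed_cell T \<inter> closed_cell T' in f \<in> vefs T \<and> f \<notin> vefs T' \<and> f \<subset> f' \<and> g \<subseteq> f)"

definition hanging_dofs :: "nat \<Rightarrow> 'd::finite cell set \<Rightarrow> 'd dof set" where
  "hanging_dofs q \<A> =
     {\<sigma>\<in>dofs q \<A>. \<forall>T\<in>\<A>. \<sigma> \<in> local_dofs q T \<longrightarrow> (\<exists>T' f'. owner \<A> T (fst \<sigma>) T' f')}"

definition free_dofs :: "nat \<Rightarrow> 'd::finite cell set \<Rightarrow> 'd dof set" where
  "free_dofs q \<A> = dofs q \<A> - hanging_dofs q \<A>"

text \<open>A hanging degree of freedom can have several owners. They all yield the same constraint: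
  coarser cells around it conform, and only nodes on the smallest VEF of T' containing the position
  have a nonzero coefficient.\<close>

definition dof_owner :: "nat \<Rightarrow> 'd::finite cell set \<Rightarrow> 'd dof \<Rightarrow> 'd cell \<times> (real ^ 'd) set" where
  "dof_owner q \<A> \<sigma> =
     (SOME (T', f'). \<exists>T\<in>\<A>. \<sigma> \<in> local_dofs q T \<and> owner \<A> T (fst \<sigma>) T' f')"

definition hanging_coeff :: "nat \<Rightarrow> 'd::finite cell set \<Rightarrow> 'd dof \<Rightarrow> 'd dof \<Rightarrow> real" where
  "hanging_coeff q \<A> \<sigma> \<sigma>' = shape q (fst (dof_owner q \<A> \<sigma>)) (snd \<sigma>') (snd \<sigma>)"

definition masters :: "nat \<Rightarrow> 'd::finite cell set \<Rightarrow> 'd dof \<Rightarrow> 'd dof set" where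
  "masters q \<A> \<sigma> =
     {\<sigma>'\<in>local_dofs q (fst (dof_owner q \<A> \<sigma>)).
        snd \<sigma>' \<in> snd (dof_owner q \<A> \<sigma>) \<and> hanging_coeff q \<A> \<sigma> \<sigma>' \<noteq> 0}"

definition well_hanging_dofs :: "nat \<Rightarrow> 'd::finite cell set \<Rightarrow> 'd cell set \<Rightarrow> 'd dof set" where
  "well_hanging_dofs q \<A> \<W> = {\<sigma>\<in>hanging_dofs q \<A>. \<exists>T\<in>\<W>. \<sigma> \<in> local_dofs q T}"

definition well_free_dofs :: "nat \<Rightarrow> 'd::finite cell set \<Rightarrow> 'd cell set \<Rightarrow> 'd dof set" where
  "well_free_dofs q \<A> \<W> =
     {\<sigma>\<in>free_dofs q \<A>. (\<exists>T\<in>\<W>. \<sigma> \<in> local_dofs q T) \<or>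
                       (\<exists>\<sigma>'\<in>well_hanging_dofs q \<A> \<W>. \<sigma> \<in> masters q \<A> \<sigma>')}"

definition ill_free_dofs :: "nat \<Rightarrow> 'd::finite cell set \<Rightarrow> 'd cell set \<Rightarrow> 'd dof set" where
  "ill_free_dofs q \<A> \<W> = free_dofs q \<A> - well_free_dofs q \<A> \<W>"

section \<open>Finite element spaces\<close>

text \<open>Discrete functions are identified with their nodal values, extended by zero to pairs that
  are not degrees of freedom.\<close>

definition V_ncf :: "nat \<Rightarrow> 'd::finite cell set \<Rightarrow> ('d dof \<Rightarrow> real) set" where
  "V_ncf q \<A> = {v. \<forall>\<sigma>. \<sigma> \<notin> dofs q \<A> \<longrightarrow> v \<sigma> = 0}"

text \<open>The function with nodal values v. Functions in the non-conforming space are single-valued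
  only up to the null set of cell boundaries; there, and outside the active cells, the value is 0.\<close>

definition fe_fun :: "nat \<Rightarrow> 'd::finite cell set \<Rightarrow> ('d dof \<Rightarrow> real) \<Rightarrow> real ^ 'd \<Rightarrow> real" where
  "fe_fun q \<A> v x =
     (\<Sum>T\<in>\<A>. if x \<in> open_cell T then \<Sum>\<sigma>\<in>local_dofs q T. v \<sigma> * shape q T (snd \<sigma>) x else 0)"

definition V_std :: "nat \<Rightarrow> 'd::finite cell set \<Rightarrow> ('d dof \<Rightarrow> real) set" where
  "V_std q \<A> =
     {v\<in>V_ncf q \<A>. \<forall>\<sigma>\<in>hanging_dofs q \<A>. v \<sigma> = (\<Sum>\<sigma>'\<in>masters q \<A> \<sigma>. hanging_coeff q \<A> \<sigma> \<sigma>' * v \<sigma>')}"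

definition V_ag ::
  "nat \<Rightarrow> 'd::finite cell set \<Rightarrow> 'd cell set \<Rightarrow> ('d dof \<Rightarrow> 'd cell) \<Rightarrow> ('d dof \<Rightarrow> real) set" where
  "V_ag q \<A> \<W> K =
     {v\<in>V_std q \<A>. \<forall>\<sigma>\<in>ill_free_dofs q \<A> \<W>.
        v \<sigma> = (\<Sum>\<sigma>'\<in>local_dofs q (K \<sigma>). shape q (K \<sigma>) (snd \<sigma>') (snd \<sigma>) * v \<sigma>')}"

definition ag_shape ::
  "nat \<Rightarrow> 'd::finite cell set \<Rightarrow> 'd cell set \<Rightarrow> ('d dof \<Rightarrow> 'd cell) \<Rightarrow> 'd dof \<Rightarrow> real ^ 'd \<Rightarrow> real" where
  "ag_shape q \<A> \<W> K \<sigma> =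
     fe_fun q \<A> (THE v. v \<in> V_ag q \<A> \<W> K \<and>
                        (\<forall>\<sigma>'\<in>well_free_dofs q \<A> \<W>. v \<sigma>' = (if \<sigma>' = \<sigma> then 1 else 0)))"

definition mass_matrix ::
  "nat \<Rightarrow> (real ^ 'd) set \<Rightarrow> 'd::finite cell set \<Rightarrow> 'd cell set \<Rightarrow> ('d dof \<Rightarrow> 'd cell) \<Rightarrow>
     'd dof \<Rightarrow> 'd dof \<Rightarrow> real" where
  "mass_matrix q \<Omega> \<A> \<W> K \<sigma> \<sigma>' =
     set_lebesgue_integral lborel \<Omega> (\<lambda>x. ag_shape q \<A> \<W> K \<sigma> x * ag_shape q \<A> \<W> K \<sigma>' x)"

section \<open>Spectral condition number of a matrix indexed by a finite set\<close>

definition spectral_norm :: "'i set \<Rightarrow> ('i \<Rightarrow> 'i \<Rightarrow> real) \<Rightarrow> real" where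
  "spectral_norm S A = (SUP x\<in>{x. L2_set x S \<le> 1}. L2_set (\<lambda>i. \<Sum>j\<in>S. A i j * x j) S)"

definition inverse_on :: "'i set \<Rightarrow> ('i \<Rightarrow> 'i \<Rightarrow> real) \<Rightarrow> ('i \<Rightarrow> 'i \<Rightarrow> real) \<Rightarrow> bool" where
  "inverse_on S A B \<longleftrightarrow>
     (\<forall>i\<in>S. \<forall>j\<in>S. (\<Sum>k\<in>S. A i k * B k j) = (if i = j then 1 else 0) \<and>
                   (\<Sum>k\<in>S. B i k * A k j) = (if i = j then 1 else 0))"

definition cond_number :: "'i set \<Rightarrow> ('i \<Rightarrow> 'i \<Rightarrow> real) \<Rightarrow> ereal" where
  "cond_number S A =
     (if \<exists>B. inverse_on S A B
      then ereal (spectral_norm S A * spectral_norm S (SOME B. inverse_on S A B)) else \<infinity>)"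

end

theory Submission
  imports Defs "HOL-Computational_Algebra.Polynomial"
begin

text \<open>
  The mass matrix M has the quadratic form x^T M x, the integral of v^2 over \<Omega>, where v is the
  function of the aggregated space with well-posed free values x. Its condition number is bounded
  as soon as the entries of M are bounded from above and the quadratic form from below by a multiple
  of the squared Euclidean norm of x, with constants that do not see \<Omega>, the root map and the
  assignment of degrees of freedom to cells (cond_number_le).

  Upper bound. All nodal values of v arise from x by at most three interpolation steps: from free
  masters to hanging degrees of freedom of well-posed cells, from root cells to ill-posed free
  degrees of freedom, and from free masters to the remaining hanging ones. Each step multiplies the
  maximum by at most the Lebesgue constant of the mesh (V_ag_bound). The number of steps is finite
  because masters are never hanging themselves; this is where the 2:1 balance enters
  (masters_free). The same steps show that functions of the aggregated space exist for arbitrary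
  well-posed free values and are determined by them.

  Lower bound. Restrict the integral to well-posed cells T. At least a fixed fraction of T lies in
  \<Omega>. A nonzero polynomial vanishes only on a null set and the unit sphere of coefficients is
  compact, so the L2 norm over any such part of T bounds the nodal values on T
  (quadratic_lower_bound, cell_lower_bound). It remains to recover x from the values on well-posed
  cells. This is obvious for degrees of freedom of well-posed cells, but a master of a hanging degree
  of freedom of T may lie outside of T. However, T contains a full grid of nodes of a half-size copy
  of the face of the coarse cell that carries this master, and the functions under consideration are
  continuous across this face. So the master value is that of the polynomial of T, extended from T
  (master_value).

  Geometry. Both parts use that cells of the same level agree on their common VEFs, including nodes
  and traces, although the coarse mesh is unstructured. To this end, cells are called conforming if
  the reference coordinates of their common points are related by a permutation and a simple link in
  each coordinate. Coarse cells conform, because a linear map between cubes that preserves the maximum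
  norm is a signed permutation (signed_rows), and the relation passes to children one coordinate at
  a time (conforming_children).
\<close>

section \<open>Affine cells and their faces\<close>

lemma matrix_inv_mult:
  assumes "invertible A"
  shows "A ** matrix_inv A = mat 1" "matrix_inv A ** A = mat 1"
  using someI_ex[OF assms[unfolded invertible_def]] unfolding matrix_inv_def by auto

lemma cell_map_ref_coord:
  assumes "invertible (jac T)"
  shows "cell_map T (ref_coord T x) = x"
  using assms by (simp add: cell_map_def ref_coord_def matrix_vector_mul_assoc matrix_inv_mult)

lemma ref_coord_cell_map:
  assumes "invertible (jac T)"
  shows "ref_coord T (cell_map T \<xi>) = \<xi>"
  using assms by (simp add: cell_map_def ref_coord_def matrix_vector_mul_assoc matrix_inv_mult)

lemma cell_map_eq_iff:
  assumes "invertible (jac T)"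
  shows "cell_map T \<xi> = cell_map T \<xi>' \<longleftrightarrow> \<xi> = \<xi>'"
  by (metis assms ref_coord_cell_map)

lemma mem_closed_cell_iff:
  assumes "invertible (jac T)"
  shows "x \<in> closed_cell T \<longleftrightarrow> ref_coord T x \<in> cbox 0 1"
  unfolding closed_cell_def by (metis assms cell_map_ref_coord image_iff ref_coord_cell_map)

lemma mem_open_cell_iff:
  assumes "invertible (jac T)"
  shows "x \<in> open_cell T \<longleftrightarrow> ref_coord T x \<in> box 0 1"
  unfolding open_cell_def by (metis assms cell_map_ref_coord image_iff ref_coord_cell_map)

lemma mem_cube_iff: "\<xi> \<in> cbox 0 (1::real^'d::finite) \<longleftrightarrow> (\<forall>i. 0 \<le> \<xi> $ i \<and> \<xi> $ i \<le> 1)"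
  by (simp add: mem_box_cart)

lemma mem_open_cube_iff: "\<xi> \<in> box 0 (1::real^'d::finite) \<longleftrightarrow> (\<forall>i. 0 < \<xi> $ i \<and> \<xi> $ i < 1)"
  by (simp add: mem_box_cart)

lemma continuous_on_cell_map: "continuous_on S (cell_map T)"
  unfolding cell_map_def by (intro continuous_intros matrix_vector_mult_linear_continuous_on)

lemma continuous_on_ref_coord: "continuous_on S (ref_coord T)"
  unfolding ref_coord_def
  by (intro continuous_on_compose2[OF matrix_vector_mult_linear_continuous_on[of UNIV]] continuous_intros) auto

lemma cell_map_image: "cell_map T ` S = (+) (origin T) ` ((*v) (jac T) ` S)"
  by (auto simp: cell_map_def image_image)

lemma cell_map_face_of:
  assumes "invertible (jac T)"
  shows "cell_map T ` F face_of cell_map T ` S \<longleftrightarrow> F face_of S"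
proof -
  have "inj ((*v) (jac T))"
    by (metis assms inj_matrix_vector_mult)
  then show ?thesis
    by (simp add: cell_map_image face_of_linear_image)
qed

lemma open_open_cell:
  assumes "invertible (jac T)"
  shows "open (open_cell T)"
proof -
  have "open_cell T = ref_coord T -` box 0 1"
    using assms by (auto simp: mem_open_cell_iff)
  then show ?thesis
    using continuous_on_ref_coord[of UNIV T] by (simp add: open_vimage open_box)
qed

lemma compact_closed_cell: "compact (closed_cell T)"
  unfolding closed_cell_def by (intro compact_continuous_image continuous_on_cell_map compact_cbox)

lemma convex_closed_cell: "convex (closed_cell T)"
  unfolding closed_cell_def cell_map_image
  by (intro convex_translation convex_linear_image) auto

lemma open_cell_subset: "open_cell T \<subseteq> closed_cell T"
  unfolding open_cell_def closed_cell_def using box_subset_cbox by blast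

text \<open>A point of the open cell, used to tell cells with disjoint interiors apart.\<close>

definition center :: "'d::finite cell \<Rightarrow> real^'d" where
  "center T = cell_map T (\<chi> i. 1/2)"

lemma center_in_open_cell: "center T \<in> open_cell T"
  unfolding center_def open_cell_def by (rule imageI) (simp add: mem_open_cube_iff)

lemma closed_cell_subset_closure: "closed_cell T \<subseteq> closure (open_cell T)"
proof -
  have "cbox 0 (1::real^'d) = closure (box 0 1)"
  proof -
    have "(\<chi> i. 1/2) \<in> box 0 (1::real^'d)" by (simp add: mem_open_cube_iff)
    then show ?thesis by (metis closure_box empty_iff)
  qed
  moreover have "cell_map T ` closure (box 0 1) \<subseteq> closure (open_cell T)"
    unfolding open_cell_def
    by (rule image_closure_subset[OF continuous_on_cell_map closed_closure closure_subset])
  ultimately show ?thesis unfolding closed_cell_def by metis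
qed

definition smallest_face :: "'d::finite cell \<Rightarrow> real^'d \<Rightarrow> (real^'d) set" where
  "smallest_face T x = \<Inter>{g. g face_of closed_cell T \<and> x \<in> g}"

text \<open>The smallest face of the unit cube containing p: a coordinate of p strictly between 0 and 1 is free, the others are frozen.\<close>

definition subcube :: "real^'d::finite \<Rightarrow> (real^'d) set" where
  "subcube p = {\<xi> \<in> cbox 0 1. \<forall>i. p $ i \<in> {0, 1} \<longrightarrow> \<xi> $ i = p $ i}"

lemma subcube_face_of: "subcube p face_of cbox 0 1"
  unfolding face_of_def
proof (intro conjI ballI impI)
  show "subcube p \<subseteq> cbox 0 1" by (auto simp: subcube_def)
  show "convex (subcube p)"
    unfolding convex_def
  proof (intro ballI allI impI)
    fix x y and u v :: real
    assume xy: "x \<in> subcube p" "y \<in> subcube p" and uv: "0 \<le> u" "0 \<le> v" "u + v = 1"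
    have "u *\<^sub>R x + v *\<^sub>R y \<in> cbox 0 1"
      using xy uv convex_box(1)[of 0 "1::real^'a"] by (auto simp: subcube_def convex_def)
    moreover have "u * x $ i + v * y $ i = p $ i" if "p $ i \<in> {0, 1}" for i
    proof -
      have "x $ i = p $ i" "y $ i = p $ i" using xy that by (auto simp: subcube_def)
      then have "u * x $ i + v * y $ i = (u + v) * p $ i" by (simp add: algebra_simps)
      then show ?thesis using uv by simp
    qed
    ultimately show "u *\<^sub>R x + v *\<^sub>R y \<in> subcube p"
      unfolding subcube_def by simp
  qed
next
  fix a b x assume ab: "a \<in> cbox 0 1" "b \<in> cbox 0 (1::real^'a)" and x: "x \<in> subcube p" "x \<in> open_segment a b"
  obtain u where u: "0 < u" "u < 1" "x = (1 - u) *\<^sub>R a + u *\<^sub>R b"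
    using x(2) by (auto simp: in_segment)
  have 1: "a $ i = p $ i \<and> b $ i = p $ i" if "p $ i \<in> {0, 1}" for i
  proof -
    have e: "(1 - u) * a $ i + u * b $ i = p $ i"
      using x(1) that u(3) by (auto simp: subcube_def)
    have r: "0 \<le> a $ i" "a $ i \<le> 1" "0 \<le> b $ i" "b $ i \<le> 1" using ab by (auto simp: mem_cube_iff)
    from that consider "p $ i = 0" | "p $ i = 1" by auto
    then show ?thesis
    proof cases
      case 1
      have "0 \<le> (1 - u) * a $ i" "0 \<le> u * b $ i" using r u by auto
      then have "(1 - u) * a $ i = 0" "u * b $ i = 0" using e 1 by linarith+
      then show ?thesis using u 1 by auto
    next
      case 2
      have "0 \<le> (1 - u) * (1 - a $ i)" "0 \<le> u * (1 - b $ i)" using r u by auto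
      moreover have "(1 - u) * (1 - a $ i) + u * (1 - b $ i) = 0" using e 2 by (simp add: algebra_simps)
      ultimately have "(1 - u) * (1 - a $ i) = 0" "u * (1 - b $ i) = 0" by linarith+
      then show ?thesis using u 2 by auto
    qed
  qed
  show "a \<in> subcube p" "b \<in> subcube p"
    using 1 ab by (auto simp: subcube_def)
qed

text \<open>Every point of the subcube of p lies on a segment of the cube that has p in its interior:
  starting from the point, run through p and a little further. A face containing p therefore
  contains that point.\<close>

lemma subcube_subset_face:
  assumes G: "G face_of cbox 0 1" and p: "p \<in> G"
  shows "subcube p \<subseteq> G"
proof
  fix \<xi> assume \<xi>: "\<xi> \<in> subcube p"
  have pc: "p \<in> cbox 0 1" using assms face_of_imp_subset by blast
  have pr: "0 \<le> p $ i \<and> p $ i \<le> 1" for i using pc by (simp add: mem_cube_iff)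
  show "\<xi> \<in> G"
  proof (cases "\<xi> = p")
    case False
    define m where "m i = (if p $ i \<in> {0, 1} then 1 else min (p $ i) (1 - p $ i))" for i
    define e where "e = Min (range m)"
    have mpos: "0 < m i" for i using pr[of i] unfolding m_def by (auto simp: min_def not_less less_le)
    have e: "0 < e" unfolding e_def using mpos by (subst Min_gr_iff) auto
    have em: "e \<le> m i" for i unfolding e_def by (rule Min_le) auto
    define \<eta> where "\<eta> = p + e *\<^sub>R (p - \<xi>)"
    have "0 \<le> \<eta> $ i \<and> \<eta> $ i \<le> 1" for i
    proof (cases "p $ i \<in> {0, 1}")
      case True
      then show ?thesis using \<xi> by (auto simp: \<eta>_def subcube_def)
    next
      case False
      then have "e \<le> p $ i" "e \<le> 1 - p $ i" using em[of i] by (auto simp: m_def)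
      moreover have "\<bar>p $ i - \<xi> $ i\<bar> \<le> 1"
        using pr[of i] \<xi> by (auto simp: subcube_def mem_cube_iff abs_le_iff dest!: spec[of _ i])
      then have "\<bar>e * (p $ i - \<xi> $ i)\<bar> \<le> e" using e by (simp add: abs_mult)
      ultimately show ?thesis by (auto simp: \<eta>_def abs_le_iff)
    qed
    then have \<eta>: "\<eta> \<in> cbox 0 1" by (simp add: mem_cube_iff)
    have "p \<in> open_segment \<xi> \<eta>"
      unfolding in_segment
    proof (intro conjI exI[of _ "1 / (1 + e)"])
      show "\<xi> \<noteq> \<eta>"
      proof
        assume "\<xi> = \<eta>"
        then have "(1 + e) *\<^sub>R (p - \<xi>) = 0" by (simp add: \<eta>_def algebra_simps)
        then show False using False e by simp
      qed
      have "(1 + e) *\<^sub>R p = e *\<^sub>R \<xi> + \<eta>" by (simp add: \<eta>_def algebra_simps)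
      then have "p = (1 / (1 + e)) *\<^sub>R (e *\<^sub>R \<xi> + \<eta>)" using e
        by (metis add_nonneg_eq_0_iff inverse_eq_divide less_eq_real_def less_irrefl scaleR_one scaleR_scaleR left_inverse zero_le_one)
      also have "\<dots> = (e / (1 + e)) *\<^sub>R \<xi> + (1 / (1 + e)) *\<^sub>R \<eta>" by (simp add: scaleR_add_right)
      also have "e / (1 + e) = 1 - 1 / (1 + e)" using e by (simp add: field_simps)
      finally show "p = (1 - 1 / (1 + e)) *\<^sub>R \<xi> + (1 / (1 + e)) *\<^sub>R \<eta>" .
    qed (use e in auto)
    then show ?thesis using face_ofD[OF G _ _ \<eta> p, of \<xi>] \<xi> by (auto simp: subcube_def)
  qed (use p in simp)
qed

lemma smallest_face_eq:
  assumes "invertible (jac T)" and "p \<in> cbox 0 1"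
  shows "smallest_face T (cell_map T p) = cell_map T ` subcube p"
proof
  have "p \<in> subcube p" using assms by (simp add: subcube_def)
  then have "cell_map T ` subcube p \<in> {g. g face_of closed_cell T \<and> cell_map T p \<in> g}"
    using assms by (auto simp: closed_cell_def cell_map_face_of subcube_face_of)
  then show "smallest_face T (cell_map T p) \<subseteq> cell_map T ` subcube p"
    unfolding smallest_face_def by blast
next
  have "cell_map T ` subcube p \<subseteq> g" if g: "g face_of closed_cell T" "cell_map T p \<in> g" for g
  proof -
    obtain G where G: "g = cell_map T ` G" "G \<subseteq> cbox 0 1"
      using face_of_imp_subset[OF g(1)] by (auto simp: closed_cell_def subset_image_iff)
    have "G face_of cbox 0 1" using g G assms(1) by (simp add: closed_cell_def cell_map_face_of)
    moreover have "p \<in> G" using g G assms(1) by (auto simp: cell_map_eq_iff)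
    ultimately show ?thesis using subcube_subset_face G by blast
  qed
  then show "cell_map T ` subcube p \<subseteq> smallest_face T (cell_map T p)"
    unfolding smallest_face_def by blast
qed

lemma smallest_face_face_of:
  assumes "x \<in> closed_cell T"
  shows "smallest_face T x face_of closed_cell T"
  unfolding smallest_face_def
  by (rule face_of_Inter) (use assms convex_closed_cell face_of_refl in blast)+

lemma mem_smallest_face: "x \<in> smallest_face T x"
  by (auto simp: smallest_face_def)

lemma smallest_face_subset: "g face_of closed_cell T \<Longrightarrow> x \<in> g \<Longrightarrow> smallest_face T x \<subseteq> g"
  by (auto simp: smallest_face_def)

section \<open>Conforming pairs of cells\<close>

text \<open>The possible relations between the i-th reference coordinate of a point in one cell and the
  matching coordinate of the same point in a neighbour: no common point, equal or reflected
  coordinate along a common edge, or a pair of fixed end points transversally to the common face.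
  The family is closed under halving both coordinates (see below), which makes it an invariant
  of refinement; all cases arise from the second and the third one by repeated halving.\<close>

definition link :: "(real \<Rightarrow> real \<Rightarrow> bool) set" where
  "link = {\<lambda>s t. False, \<lambda>s t. t = s, \<lambda>s t. t = 1 - s} \<union>
     {\<lambda>s t. s = b \<and> t = c | b c. b \<in> {0, 1} \<and> c \<in> {0, 1}}"

lemma link_cases:
  assumes "R \<in> link"
  obtains (empty) "R = (\<lambda>s t. False)" | (same) "R = (\<lambda>s t. t = s)" | (flip) "R = (\<lambda>s t. t = 1 - s)"
    | (const) b c where "b \<in> {0, 1}" "c \<in> {0, 1}" "R = (\<lambda>s t. s = b \<and> t = c)"
  using assms unfolding link_def by auto

lemma link_intros:
  "(\<lambda>s t. False) \<in> link" "(\<lambda>s t. t = s) \<in> link" "(\<lambda>s t. t = 1 - s) \<in> link"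
  "b \<in> {0, 1} \<Longrightarrow> c \<in> {0, 1} \<Longrightarrow> (\<lambda>s t. s = b \<and> t = c) \<in> link"
  unfolding link_def by blast+

text \<open>The common points of two conforming cells are described by one link per coordinate, after a
  permutation of the coordinates. This is stronger than meeting in a common VEF: it also fixes how
  the two parametrisations of that VEF are related, so that subdivisions and nodes agree.\<close>

definition conforming :: "'d::finite cell \<Rightarrow> 'd cell \<Rightarrow> bool" where
  "conforming T T' \<longleftrightarrow> (\<exists>\<pi> R. bij \<pi> \<and> (\<forall>i. R i \<in> link) \<and>
     (\<forall>\<xi>\<in>cbox 0 1. \<forall>\<xi>'\<in>cbox 0 1.
        cell_map T \<xi> = cell_map T' \<xi>' \<longleftrightarrow> (\<forall>i. R i (\<xi> $ i) (\<xi>' $ \<pi> i))))"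

text \<open>The reference coordinates of a point in a cell are (s + c) / 2 if s are those in the child at
  corner c. Halves of an edge that agree or are reflected stay so, and two different halves share
  at most the midpoint of the edge, which gives a fixed pair of end points.\<close>

lemma link_halve:
  assumes "R \<in> link" and "c \<in> {0, 1}" "c' \<in> {0, 1::real}"
  shows "\<exists>R'\<in>link. \<forall>s\<in>{0..1}. \<forall>t\<in>{0..1}. R ((s + c) / 2) ((t + c') / 2) \<longleftrightarrow> R' s t"
  using assms(1)
proof (cases rule: link_cases)
  case empty
  then show ?thesis by (intro bexI[OF _ link_intros(1)]) auto
next
  case same
  have "c = c' \<or> c = 0 \<and> c' = 1 \<or> c = 1 \<and> c' = 0" using assms by auto
  then consider "c = c'" | "c = 0" "c' = 1" | "c = 1" "c' = 0" by blast
  then show ?thesis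
  proof cases
    case 1 then show ?thesis using same by (intro bexI[OF _ link_intros(2)]) auto
  next
    case 2 then show ?thesis using same by (intro bexI[OF _ link_intros(4)[of 1 0]]) auto
  next
    case 3 then show ?thesis using same by (intro bexI[OF _ link_intros(4)[of 0 1]]) auto
  qed
next
  case flip
  have "c = 1 - c' \<or> c = 0 \<and> c' = 0 \<or> c = 1 \<and> c' = 1" using assms by auto
  then consider "c = 1 - c'" | "c = 0" "c' = 0" | "c = 1" "c' = 1" by blast
  then show ?thesis
  proof cases
    case 1 then show ?thesis using flip by (intro bexI[OF _ link_intros(3)]) (auto simp: field_simps)
  next
    case 2 then show ?thesis using flip by (intro bexI[OF _ link_intros(4)[of 1 1]]) (auto simp: field_simps)
  next
    case 3 then show ?thesis using flip by (intro bexI[OF _ link_intros(4)[of 0 0]]) (auto simp: field_simps)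
  qed
next
  case (const b b')
  show ?thesis
  proof (cases "b = c \<and> b' = c'")
    case True
    have "(s + c) / 2 = c \<longleftrightarrow> s = c" for s by (auto simp: field_simps)
    moreover have "(s + c') / 2 = c' \<longleftrightarrow> s = c'" for s by (auto simp: field_simps)
    ultimately show ?thesis using True const
      by (intro bexI[OF _ link_intros(4)[of c c']]) auto
  next
    case False
    have *: "(s + e) / 2 \<noteq> e'" if "s \<in> {0..1}" "e \<in> {0, 1}" "e' \<in> {0, 1}" "e' \<noteq> e" for s e e' :: real
      using that by auto
    show ?thesis using False const assms *[of _ c b] *[of _ c' b']
      by (intro bexI[OF _ link_intros(1)]) blast
  qed
qed

lemma cell_map_child:
  "cell_map (Cell n (cell_map P ((1/2) *\<^sub>R b)) ((1/2) *\<^sub>R jac P)) \<zeta> = cell_map P ((1/2) *\<^sub>R (\<zeta> + b))"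
  by (simp add: cell_map_def algebra_simps scaleR_matrix_vector_assoc matrix_vector_right_distrib
      matrix_vector_mult_scaleR)

lemma childE:
  assumes "T \<in> children P"
  obtains b where "\<And>i. b $ i \<in> {0, 1}" "level T = Suc (level P)" "jac T = (1/2) *\<^sub>R jac P"
    "\<And>\<zeta>. cell_map T \<zeta> = cell_map P ((1/2) *\<^sub>R (\<zeta> + b))"
proof -
  obtain b where b: "\<forall>i. b $ i \<in> {0, 1}"
    "T = Cell (Suc (level P)) (cell_map P ((1/2) *\<^sub>R b)) ((1/2) *\<^sub>R jac P)"
    using assms unfolding children_def by blast
  with cell_map_child show ?thesis by (intro that[of b]) auto
qed

lemma half_mem_cube:
  assumes "\<zeta> \<in> cbox 0 (1::real^'d::finite)" and "\<And>i. b $ i \<in> {0, 1::real}"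
  shows "(1/2) *\<^sub>R (\<zeta> + b) \<in> cbox 0 1"
proof -
  have "0 \<le> (\<zeta> $ i + b $ i) / 2 \<and> (\<zeta> $ i + b $ i) / 2 \<le> 1" for i
    using assms(1) assms(2)[of i] by (auto simp: mem_cube_iff dest: spec[of _ i])
  then show ?thesis by (simp add: mem_cube_iff)
qed

text \<open>Conformity is inherited by all pairs of children, one coordinate at a time; the permutation
  stays the same.\<close>

lemma conforming_children:
  assumes "conforming P P'" and "T \<in> children P" and "T' \<in> children P'"
  shows "conforming T T'"
proof -
  obtain \<pi> R where \<pi>: "bij \<pi>" and R: "\<And>i. R i \<in> link"
    and PP: "\<And>\<xi> \<xi>'. \<xi> \<in> cbox 0 1 \<Longrightarrow> \<xi>' \<in> cbox 0 1 \<Longrightarrow>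
        cell_map P \<xi> = cell_map P' \<xi>' \<longleftrightarrow> (\<forall>i. R i (\<xi> $ i) (\<xi>' $ \<pi> i))"
    using assms(1) unfolding conforming_def by metis
  obtain b where b: "\<And>i. b $ i \<in> {0, 1}" "\<And>\<zeta>. cell_map T \<zeta> = cell_map P ((1/2) *\<^sub>R (\<zeta> + b))"
    using childE[OF assms(2)] by metis
  obtain b' where b': "\<And>i. b' $ i \<in> {0, 1}" "\<And>\<zeta>. cell_map T' \<zeta> = cell_map P' ((1/2) *\<^sub>R (\<zeta> + b'))"
    using childE[OF assms(3)] by metis
  have "\<exists>R'\<in>link. \<forall>s\<in>{0..1}. \<forall>t\<in>{0..1}. R i ((s + b $ i) / 2) ((t + b' $ \<pi> i) / 2) \<longleftrightarrow> R' s t" for i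
    by (rule link_halve[OF R b(1) b'(1)])
  then obtain R' where R': "\<And>i. R' i \<in> link"
    "\<And>i s t. s \<in> {0..1} \<Longrightarrow> t \<in> {0..1} \<Longrightarrow> R i ((s + b $ i) / 2) ((t + b' $ \<pi> i) / 2) \<longleftrightarrow> R' i s t"
    by metis
  show ?thesis
    unfolding conforming_def
  proof (intro exI[of _ \<pi>] exI[of _ R'] conjI allI ballI \<pi> R'(1))
    fix \<zeta> \<zeta>' :: "real^'a" assume z: "\<zeta> \<in> cbox 0 1" "\<zeta>' \<in> cbox 0 1"
    have "cell_map T \<zeta> = cell_map T' \<zeta>' \<longleftrightarrow> (\<forall>i. R i ((\<zeta> $ i + b $ i) / 2) ((\<zeta>' $ \<pi> i + b' $ \<pi> i) / 2))"
      unfolding b(2) b'(2) using PP[OF half_mem_cube[OF z(1) b(1)] half_mem_cube[OF z(2) b'(1)]] by simp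
    also have "\<dots> \<longleftrightarrow> (\<forall>i. R' i (\<zeta> $ i) (\<zeta>' $ \<pi> i))"
      using z by (simp add: R'(2) mem_cube_iff)
    finally show "cell_map T \<zeta> = cell_map T' \<zeta>' \<longleftrightarrow> (\<forall>i. R' i (\<zeta> $ i) (\<zeta>' $ \<pi> i))" .
  qed
qed

lemma conforming_refl:
  assumes "invertible (jac T)"
  shows "conforming T T"
  unfolding conforming_def
  by (intro exI[of _ id] exI[of _ "\<lambda>i s t. t = s"])
     (simp add: cell_map_eq_iff[OF assms] link_intros, auto simp: vec_eq_iff)

lemma conforming_disjoint:
  assumes "closed_cell T \<inter> closed_cell T' = {}"
  shows "conforming T T'"
  unfolding conforming_def
  using assms by (intro exI[of _ id] exI[of _ "\<lambda>i s t. False"]) (auto intro: link_intros simp: closed_cell_def)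

text \<open>A linear map that takes the unit ball of the maximum norm on the coordinates I onto the one on
  the coordinates J is, up to order and sign, the identity. A basis vector has an image of maximum
  norm exactly 1 (otherwise a multiple of it that leaves the ball would have its image in the
  ball), so some entry in its column is 1 or -1; any other nonzero entry in the row of that entry
  would allow a vector of the ball with a longer image.\<close>

lemma signed_rows:
  fixes M :: "real^'d::finite^'d"
  assumes "invertible M"
    and fwd: "\<And>\<delta>. (\<forall>i. \<bar>\<delta> $ i\<bar> \<le> 1) \<Longrightarrow> (\<forall>i. i \<notin> I \<longrightarrow> \<delta> $ i = 0) \<Longrightarrow>
        (\<forall>j. \<bar>(M *v \<delta>) $ j\<bar> \<le> 1) \<and> (\<forall>j. j \<notin> J \<longrightarrow> (M *v \<delta>) $ j = 0)"
    and bwd: "\<And>\<delta>'. (\<forall>i. \<bar>\<delta>' $ i\<bar> \<le> 1) \<Longrightarrow> (\<forall>i. i \<notin> J \<longrightarrow> \<delta>' $ i = 0) \<Longrightarrow>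
        \<exists>\<delta>. (\<forall>i. \<bar>\<delta> $ i\<bar> \<le> 1) \<and> (\<forall>i. i \<notin> I \<longrightarrow> \<delta> $ i = 0) \<and> M *v \<delta> = \<delta>'"
  obtains f where "inj_on f I" "f ` I \<subseteq> J" "\<And>i. i \<in> I \<Longrightarrow> \<bar>M $ f i $ i\<bar> = 1"
    "\<And>i k. i \<in> I \<Longrightarrow> k \<in> I \<Longrightarrow> k \<noteq> i \<Longrightarrow> M $ f i $ k = 0"
proof -
  have col: "(M *v axis i 1) $ j = M $ j $ i" for i j
    by (simp add: matrix_vector_mul_component inner_axis)
  have "\<exists>j\<in>J. \<bar>M $ j $ i\<bar> = 1" if i: "i \<in> I" for i
  proof (rule ccontr)
    assume no: "\<not> (\<exists>j\<in>J. \<bar>M $ j $ i\<bar> = 1)"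
    have ax: "(\<forall>k. \<bar>axis i 1 $ k\<bar> \<le> (1::real)) \<and> (\<forall>k. k \<notin> I \<longrightarrow> axis i (1::real) $ k = 0)"
      using i by (auto simp: axis_def)
    have le: "\<bar>M $ j $ i\<bar> \<le> 1" and z: "j \<notin> J \<Longrightarrow> M $ j $ i = 0" for j
      using fwd[of "axis i 1"] ax unfolding col by blast+
    have lt: "\<bar>M $ j $ i\<bar> < 1" for j
      using le[of j] z[of j] no by (cases "j \<in> J") (auto simp: less_le)
    define m where "m = Max (range (\<lambda>j. max (1/2) \<bar>M $ j $ i\<bar>))"
    have m: "m < 1" unfolding m_def using lt by (subst Max_less_iff) auto
    have mm: "max (1/2) \<bar>M $ j $ i\<bar> \<le> m" for j unfolding m_def by (rule Max_ge) auto
    then have m0: "0 < m" using mm[of undefined] by linarith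
    \<comment> \<open>the image of a basis vector, stretched by more than 1 but still in the ball\<close>
    define \<delta>' where "\<delta>' = (1/m) *\<^sub>R (M *v axis i 1)"
    have "\<bar>\<delta>' $ j\<bar> \<le> 1" for j
      using mm[of j] m0 by (simp add: \<delta>'_def col abs_mult field_simps)
    moreover have "j \<notin> J \<Longrightarrow> \<delta>' $ j = 0" for j using z by (simp add: \<delta>'_def col)
    ultimately obtain \<delta> where \<delta>: "\<forall>i. \<bar>\<delta> $ i\<bar> \<le> 1" "M *v \<delta> = \<delta>'"
      using bwd[of \<delta>'] by blast
    have "M *v \<delta> = M *v ((1/m) *\<^sub>R axis i 1)"
      by (simp add: \<delta> \<delta>'_def matrix_vector_mult_scaleR)
    then have "\<delta> = (1/m) *\<^sub>R axis i 1"
      using inj_matrix_vector_mult[OF assms(1)] by (metis injD)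
    then have "\<delta> $ i = 1/m" by (simp add: axis_def)
    moreover have "1/m > 1" using m m0 by simp
    ultimately show False using \<delta>(1)[rule_format, of i] by linarith
  qed
  then obtain f where f: "\<And>i. i \<in> I \<Longrightarrow> f i \<in> J \<and> \<bar>M $ f i $ i\<bar> = 1" by metis
  have row: "M $ f i $ k = 0" if "i \<in> I" "k \<in> I" "k \<noteq> i" for i k
  proof -
    have s: "\<bar>M $ f i $ i + s * M $ f i $ k\<bar> \<le> 1" if "\<bar>s\<bar> = 1" for s :: real
    proof -
      define \<delta> where "\<delta> = axis i 1 + s *\<^sub>R (axis k 1 :: real^'d)"
      have "\<forall>j. \<bar>\<delta> $ j\<bar> \<le> 1" "\<forall>j. j \<notin> I \<longrightarrow> \<delta> $ j = 0"
        using \<open>i \<in> I\<close> \<open>k \<in> I\<close> \<open>k \<noteq> i\<close> that by (auto simp: \<delta>_def axis_def)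
      then have "\<bar>(M *v \<delta>) $ f i\<bar> \<le> 1" using fwd by blast
      then show ?thesis
        by (simp add: \<delta>_def matrix_vector_right_distrib matrix_vector_mult_scaleR col)
    qed
    \<comment> \<open>one of the two signs increases the modulus of the entry unless the added one is 0\<close>
    show ?thesis using s[of 1] s[of "-1"] f[OF that(1)] by auto
  qed
  have "inj_on f I"
  proof (rule inj_onI, rule ccontr)
    fix i k assume "i \<in> I" "k \<in> I" "f i = f k" "i \<noteq> k"
    then show False using row[of i k] f[of k] by simp
  qed
  then show ?thesis using that[of f] f row by blast
qed

lemma extend_bij:
  fixes I J :: "'d::finite set"
  assumes "bij_betw f I J"
  obtains \<pi> where "bij \<pi>" "\<And>i. i \<in> I \<Longrightarrow> \<pi> i = f i"
proof -
  have "card (- I) = card (- J)"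
    using bij_betw_same_card[OF assms] by (simp add: Compl_eq_Diff_UNIV card_Diff_subset)
  then obtain g where g: "bij_betw g (- I) (- J)"
    using finite_same_card_bij[of "- I" "- J"] by (metis finite)
  define \<pi> where "\<pi> i = (if i \<in> I then f i else g i)" for i
  have "bij_betw \<pi> I J" using assms by (subst bij_betw_cong[of _ _ f]) (auto simp: \<pi>_def)
  moreover have "bij_betw \<pi> (- I) (- J)" using g by (subst bij_betw_cong[of _ _ g]) (auto simp: \<pi>_def)
  ultimately have "bij_betw \<pi> (I \<union> - I) (J \<union> - J)" by (rule bij_betw_combine) auto
  then show ?thesis using that[of \<pi>] by (simp add: \<pi>_def)
qed

lemma subcube_diff:
  fixes p \<delta> :: "real^'d::finite"
  assumes "p \<in> cbox 0 1" and "\<And>i. \<bar>\<delta> $ i\<bar> \<le> 1" and "\<And>i. p $ i \<in> {0, 1} \<Longrightarrow> \<delta> $ i = 0"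
  obtains \<xi> \<eta> where "\<xi> \<in> subcube p" "\<eta> \<in> subcube p" "\<delta> = \<xi> - \<eta>"
proof
  let ?\<xi> = "\<chi> i. if p $ i \<in> {0, 1} then p $ i else max (\<delta> $ i) 0"
  let ?\<eta> = "\<chi> i. if p $ i \<in> {0, 1} then p $ i else max (- (\<delta> $ i)) 0"
  have "\<delta> $ i \<le> 1 \<and> - (\<delta> $ i) \<le> 1" for i using assms(2)[of i] by linarith
  then show "?\<xi> \<in> subcube p" "?\<eta> \<in> subcube p"
    using assms(1) by (auto simp: subcube_def mem_cube_iff)
  show "\<delta> = ?\<xi> - ?\<eta>" using assms(3) by (auto simp: vec_eq_iff max_def)
qed

lemma subcube_diff_bounds:
  assumes "\<xi> \<in> subcube p" "\<eta> \<in> subcube p"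
  shows "\<bar>(\<xi> - \<eta>) $ i\<bar> \<le> 1" and "p $ i \<in> {0, 1} \<Longrightarrow> (\<xi> - \<eta>) $ i = 0"
proof -
  have "0 \<le> \<xi> $ i" "\<xi> $ i \<le> 1" "0 \<le> \<eta> $ i" "\<eta> $ i \<le> 1"
    using assms by (auto simp: subcube_def mem_cube_iff)
  then show "\<bar>(\<xi> - \<eta>) $ i\<bar> \<le> 1" by (simp add: abs_le_iff)
qed (use assms in \<open>auto simp: subcube_def\<close>)

lemma ref_coord_diff:
  assumes "invertible (jac T')"
  shows "ref_coord T' (cell_map T \<xi>) - ref_coord T' (cell_map T \<eta>) = (matrix_inv (jac T') ** jac T) *v (\<xi> - \<eta>)"
  unfolding ref_coord_def cell_map_def
  by (simp add: matrix_vector_mul_assoc[symmetric] matrix_vector_mult_diff_distrib matrix_vector_right_distrib)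

text \<open>Differences of points of a face fill the unit ball of the maximum norm on the free coordinates,
  so the change of reference coordinates on a common face falls under the preceding lemma.\<close>

lemma common_face_rows:
  assumes inv: "invertible (jac T)" "invertible (jac T')"
    and p: "p \<in> cbox 0 1" "p' \<in> cbox 0 1"
    and eq: "cell_map T ` subcube p = cell_map T' ` subcube p'"
  defines "M \<equiv> matrix_inv (jac T') ** jac T"
    and "I \<equiv> {i. p $ i \<notin> {0, 1}}" and "J \<equiv> {i. p' $ i \<notin> {0, 1}}"
  obtains f where "inj_on f I" "f ` I \<subseteq> J" "\<And>i. i \<in> I \<Longrightarrow> \<bar>M $ f i $ i\<bar> = 1"
    "\<And>i k. i \<in> I \<Longrightarrow> k \<in> I \<Longrightarrow> k \<noteq> i \<Longrightarrow> M $ f i $ k = 0"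
proof -
  let ?\<Phi> = "\<lambda>\<xi>. ref_coord T' (cell_map T \<xi>)"
  have im: "?\<Phi> ` subcube p = subcube p'"
  proof -
    have "?\<Phi> ` subcube p = ref_coord T' ` (cell_map T ` subcube p)" by (simp add: image_image)
    also have "\<dots> = subcube p'" unfolding eq by (simp add: image_image ref_coord_cell_map[OF inv(2)])
    finally show ?thesis .
  qed
  have D: "?\<Phi> \<xi> - ?\<Phi> \<eta> = M *v (\<xi> - \<eta>)" for \<xi> \<eta>
    unfolding M_def by (rule ref_coord_diff[OF inv(2)])
  have "invertible M"
    unfolding invertible_def
  proof (intro exI conjI)
    show "M ** (matrix_inv (jac T) ** jac T') = mat 1" "(matrix_inv (jac T) ** jac T') ** M = mat 1"
      unfolding M_def using inv
      by (metis matrix_inv_mult matrix_mul_assoc matrix_mul_lid)+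
  qed
  then show ?thesis
  proof (rule signed_rows[where I = "I" and J = "J"])
    fix \<delta> :: "real^'a" assume "\<forall>i. \<bar>\<delta> $ i\<bar> \<le> 1" "\<forall>i. i \<notin> I \<longrightarrow> \<delta> $ i = 0"
    then obtain \<xi> \<eta> where "\<xi> \<in> subcube p" "\<eta> \<in> subcube p" "\<delta> = \<xi> - \<eta>"
      using subcube_diff[OF p(1), of \<delta>] unfolding I_def J_def by (metis mem_Collect_eq)
    then have "?\<Phi> \<xi> \<in> subcube p'" "?\<Phi> \<eta> \<in> subcube p'" "M *v \<delta> = ?\<Phi> \<xi> - ?\<Phi> \<eta>"
      using im D by auto
    then show "(\<forall>j. \<bar>(M *v \<delta>) $ j\<bar> \<le> 1) \<and> (\<forall>j. j \<notin> J \<longrightarrow> (M *v \<delta>) $ j = 0)"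
      using subcube_diff_bounds[of "?\<Phi> \<xi>" p' "?\<Phi> \<eta>"] by (simp add: I_def J_def)
  next
    fix \<delta> :: "real^'a" assume "\<forall>i. \<bar>\<delta> $ i\<bar> \<le> 1" "\<forall>i. i \<notin> J \<longrightarrow> \<delta> $ i = 0"
    then obtain \<xi>' \<eta>' where *: "\<xi>' \<in> subcube p'" "\<eta>' \<in> subcube p'" "\<delta> = \<xi>' - \<eta>'"
      using subcube_diff[OF p(2), of \<delta>] unfolding I_def J_def by (metis mem_Collect_eq)
    have "\<xi>' \<in> ?\<Phi> ` subcube p" "\<eta>' \<in> ?\<Phi> ` subcube p" using *(1,2) im by simp_all
    then obtain \<xi> \<eta> where "\<xi> \<in> subcube p" "\<eta> \<in> subcube p" "\<xi>' = ?\<Phi> \<xi>" "\<eta>' = ?\<Phi> \<eta>"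
      by blast
    then show "\<exists>\<delta>'. (\<forall>i. \<bar>\<delta>' $ i\<bar> \<le> 1) \<and> (\<forall>i. i \<notin> I \<longrightarrow> \<delta>' $ i = 0) \<and> M *v \<delta>' = \<delta>"
      using subcube_diff_bounds[of \<xi> p \<eta>] D[of \<xi> \<eta>] *(3) by (intro exI[of _ "\<xi> - \<eta>"]) (simp add: I_def J_def)
  next
    fix f assume f: "inj_on f I" "f ` I \<subseteq> J" "\<And>i. i \<in> I \<Longrightarrow> \<bar>M $ f i $ i\<bar> = 1"
      "\<And>i k. i \<in> I \<Longrightarrow> k \<in> I \<Longrightarrow> k \<noteq> i \<Longrightarrow> M $ f i $ k = 0"
    show thesis by (rule that[OF f])
  qed
qed

text \<open>The base case: cells of the coarse mesh. The free coordinates of the common face are matched by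
  a permutation up to sign. The constant terms then need no computation: both coordinates range
  over the unit interval, so the sign 1 forces equal coordinates and the sign -1 a reflection.\<close>

lemma conforming_common_face:
  assumes inv: "invertible (jac T)" "invertible (jac T')"
    and f: "closed_cell T \<inter> closed_cell T' face_of closed_cell T"
      "closed_cell T \<inter> closed_cell T' face_of closed_cell T'"
    and ne: "closed_cell T \<inter> closed_cell T' \<noteq> {}"
  shows "conforming T T'"
proof -
  define G where "G = closed_cell T \<inter> closed_cell T'"
  have "rel_interior G \<noteq> {}"
    using ne unfolding G_def by (subst rel_interior_eq_empty) (auto intro: convex_Int convex_closed_cell)
  then obtain x where x: "x \<in> rel_interior G" by blast
  then have xG: "x \<in> G" using rel_interior_subset by blast
  have car: "smallest_face S x = G" if "G face_of closed_cell S" for S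
  proof
    show "smallest_face S x \<subseteq> G" by (rule smallest_face_subset[OF that xG])
    have "smallest_face S x face_of closed_cell S"
      using xG face_of_imp_subset[OF that] by (intro smallest_face_face_of) blast
    then show "G \<subseteq> smallest_face S x"
      using subset_of_face_of[of "smallest_face S x" "closed_cell S" G] x mem_smallest_face face_of_imp_subset[OF that] by blast
  qed
  define p where "p = ref_coord T x"
  define p' where "p' = ref_coord T' x"
  have p: "p \<in> cbox 0 1" "p' \<in> cbox 0 1" and xp: "x = cell_map T p" "x = cell_map T' p'"
    using xG inv by (auto simp: G_def p_def p'_def mem_closed_cell_iff cell_map_ref_coord)
  have G1: "cell_map T ` subcube p = G" and G2: "cell_map T' ` subcube p' = G"
    using car[of T] car[of T'] smallest_face_eq[OF inv(1) p(1)] smallest_face_eq[OF inv(2) p(2)] f xp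
    by (auto simp: G_def)
  define I where "I = {i. p $ i \<notin> {0, 1}}"
  define J where "J = {i. p' $ i \<notin> {0, 1}}"
  define M where "M = matrix_inv (jac T') ** jac T"
  have eqG: "cell_map T ` subcube p = cell_map T' ` subcube p'" using G1 G2 by simp
  obtain h where h: "inj_on h I" "h ` I \<subseteq> J" "\<And>i. i \<in> I \<Longrightarrow> \<bar>M $ h i $ i\<bar> = 1"
    "\<And>i k. i \<in> I \<Longrightarrow> k \<in> I \<Longrightarrow> k \<noteq> i \<Longrightarrow> M $ h i $ k = 0"
    by (rule common_face_rows[OF inv p eqG, folded I_def J_def M_def]) (rule that)
  obtain h' where h': "inj_on h' J" "h' ` J \<subseteq> I"
    by (rule common_face_rows[OF inv(2,1) p(2,1) eqG[symmetric], folded I_def J_def]) (rule that)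
  have "bij_betw h I J"
    unfolding bij_betw_def
    using h(1,2) card_subset_eq[OF finite h(2)] card_bij_eq[OF h(1,2) h' finite finite]
    by (simp add: card_image)
  then obtain \<pi> where \<pi>: "bij \<pi>" "\<And>i. i \<in> I \<Longrightarrow> \<pi> i = h i" using extend_bij by metis
  have \<pi>IJ: "\<pi> i \<in> J \<longleftrightarrow> i \<in> I" for i
  proof
    assume "\<pi> i \<in> J"
    then obtain k where "k \<in> I" "h k = \<pi> i" using \<open>bij_betw h I J\<close> by (metis bij_betw_imp_surj_on image_iff)
    then show "i \<in> I" using \<pi> by (metis bij_def injD)
  qed (use \<pi> h in auto)
  let ?\<Phi> = "\<lambda>\<xi>. ref_coord T' (cell_map T \<xi>)"
  have \<Phi>: "?\<Phi> \<xi> \<in> subcube p'" if "\<xi> \<in> subcube p" for \<xi>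
    using that G1 G2 by (metis (no_types, lifting) imageE imageI inv(2) ref_coord_cell_map)
  have sub: "subcube r \<subseteq> cbox 0 1" for r :: "real^'a" by (auto simp: subcube_def)
  have diff: "?\<Phi> \<xi> $ \<pi> i - ?\<Phi> \<eta> $ \<pi> i = M $ h i $ i * (\<xi> $ i - \<eta> $ i)"
    if "\<xi> \<in> subcube p" "\<eta> \<in> subcube p" "i \<in> I" for \<xi> \<eta> i
  proof -
    have "?\<Phi> \<xi> $ \<pi> i - ?\<Phi> \<eta> $ \<pi> i = (?\<Phi> \<xi> - ?\<Phi> \<eta>) $ h i" using \<pi> that by simp
    also have "\<dots> = (\<Sum>k\<in>UNIV. M $ h i $ k * (\<xi> - \<eta>) $ k)"
      unfolding ref_coord_diff[OF inv(2)] M_def[symmetric] by (simp add: matrix_vector_mult_def)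
    also have "\<dots> = (\<Sum>k\<in>{i}. M $ h i $ k * (\<xi> - \<eta>) $ k)"
    proof (rule sum.mono_neutral_right)
      show "\<forall>k\<in>UNIV - {i}. M $ h i $ k * (\<xi> - \<eta>) $ k = 0"
      proof
        fix k assume k: "k \<in> UNIV - {i}"
        show "M $ h i $ k * (\<xi> - \<eta>) $ k = 0"
        proof (cases "k \<in> I")
          case True then show ?thesis using h(4)[of i k] k that by simp
        next
          case False then show ?thesis using subcube_diff_bounds(2)[OF that(1,2), of k] by (simp add: I_def)
        qed
      qed
    qed auto
    finally show ?thesis by simp
  qed
  \<comment> \<open>the constant terms are found by letting a single coordinate run from 0 to 1\<close>
  have rng: "0 \<le> ?\<Phi> \<xi> $ j \<and> ?\<Phi> \<xi> $ j \<le> 1" if "\<xi> \<in> subcube p" for \<xi> j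
    using \<Phi>[OF that] by (auto simp: subcube_def mem_cube_iff)
  have val: "?\<Phi> \<xi> $ \<pi> i = (if M $ h i $ i = 1 then \<xi> $ i else 1 - \<xi> $ i)"
    if \<xi>: "\<xi> \<in> subcube p" and i: "i \<in> I" for \<xi> i
  proof -
    define lo where "lo = (\<chi> k. if k = i then 0 else \<xi> $ k)"
    define hi where "hi = (\<chi> k. if k = i then 1 else \<xi> $ k)"
    have lh: "lo \<in> subcube p" "hi \<in> subcube p"
      using \<xi> i by (auto simp: lo_def hi_def subcube_def mem_cube_iff I_def)
    have "?\<Phi> \<xi> $ \<pi> i - ?\<Phi> lo $ \<pi> i = M $ h i $ i * \<xi> $ i"
      "?\<Phi> \<xi> $ \<pi> i - ?\<Phi> hi $ \<pi> i = M $ h i $ i * (\<xi> $ i - 1)"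
      using diff[OF \<xi> lh(1) i] diff[OF \<xi> lh(2) i] by (simp_all add: lo_def hi_def)
    moreover have "M $ h i $ i = 1 \<or> M $ h i $ i = -1" using h(3)[OF i] by linarith
    ultimately show ?thesis using rng[OF lh(1), of "\<pi> i"] rng[OF lh(2), of "\<pi> i"] by auto
  qed
  define R where "R i = (if i \<in> I then if M $ h i $ i = 1 then (\<lambda>s t. t = s) else (\<lambda>s t. t = 1 - s)
      else (\<lambda>s t. s = p $ i \<and> t = p' $ \<pi> i))" for i
  show ?thesis
    unfolding conforming_def
  proof (intro exI[of _ \<pi>] exI[of _ R] conjI allI ballI \<pi>)
    fix i show "R i \<in> link"
      using \<pi>IJ[of i] by (cases "i \<in> I") (auto simp: R_def I_def J_def intro!: link_intros)
  next
    fix \<xi> \<xi>' :: "real^'a" assume c: "\<xi> \<in> cbox 0 1" "\<xi>' \<in> cbox 0 1"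
    show "cell_map T \<xi> = cell_map T' \<xi>' \<longleftrightarrow> (\<forall>i. R i (\<xi> $ i) (\<xi>' $ \<pi> i))"
    proof
      assume e: "cell_map T \<xi> = cell_map T' \<xi>'"
      have "cell_map T \<xi> \<in> G"
        using imageI[OF c(1), of "cell_map T"] imageI[OF c(2), of "cell_map T'"] e
        by (simp add: G_def closed_cell_def)
      then have \<xi>: "\<xi> \<in> subcube p"
        using G1 cell_map_eq_iff[OF inv(1)] by auto
      have \<xi>': "\<xi>' = ?\<Phi> \<xi>" using e by (simp add: ref_coord_cell_map[OF inv(2)])
      show "\<forall>i. R i (\<xi> $ i) (\<xi>' $ \<pi> i)"
      proof
        fix i show "R i (\<xi> $ i) (\<xi>' $ \<pi> i)"
        proof (cases "i \<in> I")
          case True then show ?thesis using val[OF \<xi> True] by (auto simp: R_def \<xi>')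
        next
          case False
          then show ?thesis using \<xi> \<Phi>[OF \<xi>] \<pi>IJ[of i] unfolding R_def \<xi>' subcube_def I_def J_def by auto
        qed
      qed
    next
      assume r: "\<forall>i. R i (\<xi> $ i) (\<xi>' $ \<pi> i)"
      have \<xi>: "\<xi> \<in> subcube p"
        unfolding subcube_def
      proof (intro CollectI conjI c allI impI)
        fix i assume "p $ i \<in> {0, 1}"
        then show "\<xi> $ i = p $ i" using r[rule_format, of i] by (auto simp: R_def I_def split: if_splits)
      qed
      have "?\<Phi> \<xi> $ \<pi> i = \<xi>' $ \<pi> i" for i
      proof (cases "i \<in> I")
        case True then show ?thesis using val[OF \<xi> True] r[rule_format, of i] by (auto simp: R_def split: if_splits)
      next
        case False
        then show ?thesis using r[rule_format, of i] \<Phi>[OF \<xi>] \<pi>IJ[of i]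
          unfolding R_def subcube_def I_def J_def by (auto split: if_splits)
      qed
      then have "?\<Phi> \<xi> = \<xi>'" using \<pi>(1) by (metis vec_eq_iff bij_pointE)
      then show "cell_map T \<xi> = cell_map T' \<xi>'" using cell_map_ref_coord[OF inv(2)] by metis
    qed
  qed
qed

section \<open>Lagrange shape functions and local degrees of freedom\<close>

definition grid :: "nat \<Rightarrow> real set" where
  "grid q = {real j / real q | j. j \<le> q}"

text \<open>The Lagrange basis polynomial of the node a on the uniform grid of q + 1 points of the unit interval.\<close>

definition lag :: "nat \<Rightarrow> real \<Rightarrow> real \<Rightarrow> real" where
  "lag q a s = (\<Prod>t\<in>grid q - {a}. (s - t) / (a - t))"

lemma grid_image: "grid q = (\<lambda>j. real j / real q) ` {..q}"
  unfolding grid_def by auto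

lemma finite_grid [simp]: "finite (grid q)"
  by (simp add: grid_image)

lemma card_grid: "q \<ge> 1 \<Longrightarrow> card (grid q) = Suc q"
  unfolding grid_image by (subst card_image) (auto simp: inj_on_def)

lemma grid_bounds: "s \<in> grid q \<Longrightarrow> 0 \<le> s \<and> s \<le> 1"
  unfolding grid_def by (auto simp: divide_le_eq_1)

lemma grid_ends: "q \<ge> 1 \<Longrightarrow> b \<in> {0, 1} \<Longrightarrow> b \<in> grid q"
  unfolding grid_def by (auto intro: exI[of _ 0] exI[of _ q])

lemma grid_flip: 
  assumes "q \<ge> 1" "s \<in> grid q" shows "1 - s \<in> grid q"
proof -
  obtain j where j: "s = real j / real q" "j \<le> q" using assms by (auto simp: grid_def)
  then have "1 - s = real (q - j) / real q" using assms by (simp add: field_simps of_nat_diff)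
  then show ?thesis unfolding grid_def by (metis (mono_tags, lifting) diff_le_self mem_Collect_eq)
qed

lemma lag_self: "lag q a a = 1"
  unfolding lag_def by (rule prod.neutral) auto

lemma lag_other: "s \<in> grid q \<Longrightarrow> s \<noteq> a \<Longrightarrow> lag q a s = 0"
  unfolding lag_def by (rule prod_zero) auto

lemma lag_flip:
  assumes "q \<ge> 1"
  shows "lag q (1 - a) (1 - s) = lag q a s"
  unfolding lag_def
proof (rule prod.reindex_bij_witness[of _ "\<lambda>t. 1 - t" "\<lambda>t. 1 - t"])
  fix t
  show "(s - (1 - t)) / (a - (1 - t)) = (1 - s - t) / (1 - a - t)"
    using minus_divide_divide[of "s - (1 - t)" "a - (1 - t)"] by (simp add: algebra_simps)
qed (use assms in \<open>auto simp: grid_flip\<close>)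

text \<open>Basis polynomials at linked nodes take equal values at linked points, since the grid is symmetric about 1/2 and a basis polynomial is 1 at its own node.\<close>

lemma lag_link:
  assumes "q \<ge> 1" "R \<in> link" "R a a'" "R s s'"
  shows "lag q a s = lag q a' s'"
  using assms(2)
proof (cases rule: link_cases)
  case empty then show ?thesis using assms by simp
next
  case same then show ?thesis using assms by simp
next
  case flip then show ?thesis using assms by (simp add: lag_flip)
next
  case (const b c) then show ?thesis using assms by (auto simp: lag_self)
qed

lemma link_grid:
  assumes "q \<ge> 1" "R \<in> link" "R s t" "s \<in> grid q"
  shows "t \<in> grid q"
  using assms(2)
  by (cases rule: link_cases) (use assms in \<open>auto simp: grid_flip grid_ends\<close>)

lemma shape_eq_prod_lag:
  "shape q T y x = (\<Prod>i\<in>UNIV. lag q (ref_coord T y $ i) (ref_coord T x $ i))"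
  unfolding shape_def lag_def grid_def ..

lemma nodes_eq: "nodes q T = cell_map T ` {\<xi>. \<forall>i. \<xi> $ i \<in> grid q}"
proof
  show "nodes q T \<subseteq> cell_map T ` {\<xi>. \<forall>i. \<xi> $ i \<in> grid q}"
    unfolding nodes_def grid_def by (rule subsetI, clarify, rule imageI) auto
  show "cell_map T ` {\<xi>. \<forall>i. \<xi> $ i \<in> grid q} \<subseteq> nodes q T"
  proof (rule image_subsetI, clarify)
    fix \<xi> :: "real^'a" assume "\<forall>i. \<xi> $ i \<in> grid q"
    then obtain k where k: "\<And>i. \<xi> $ i = real (k i) / real q \<and> k i \<le> q"
      unfolding grid_def by simp metis
    then have "\<xi> = (\<chi> i. real (k i) / real q)" by (simp add: vec_eq_iff)
    then show "cell_map T \<xi> \<in> nodes q T" unfolding nodes_def using k by blast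
  qed
qed

lemma nodes_iff:
  assumes "invertible (jac T)"
  shows "x \<in> nodes q T \<longleftrightarrow> (\<forall>i. ref_coord T x $ i \<in> grid q)"
proof
  assume "x \<in> nodes q T"
  then show "\<forall>i. ref_coord T x $ i \<in> grid q" unfolding nodes_eq by (auto simp: ref_coord_cell_map[OF assms])
next
  assume "\<forall>i. ref_coord T x $ i \<in> grid q"
  then have "cell_map T (ref_coord T x) \<in> nodes q T" unfolding nodes_eq by blast
  then show "x \<in> nodes q T" by (simp add: cell_map_ref_coord[OF assms])
qed

lemma nodes_subset: "nodes q T \<subseteq> closed_cell T"
  unfolding nodes_eq closed_cell_def
proof (rule image_mono, rule subsetI)
  fix \<xi> :: "real^'a" assume "\<xi> \<in> {\<xi>. \<forall>i. \<xi> $ i \<in> grid q}"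
  then have "0 \<le> \<xi> $ i \<and> \<xi> $ i \<le> 1" for i using grid_bounds[of "\<xi> $ i" q] by simp
  then show "\<xi> \<in> cbox 0 1" by (simp add: mem_cube_iff)
qed

lemma finite_nodes: "finite (nodes q T)"
proof -
  have "{\<xi>::real^'a. \<forall>i. \<xi> $ i \<in> grid q} = vec_lambda ` (PiE UNIV (\<lambda>_. grid q))"
    by (auto intro!: image_eqI[of _ vec_lambda "vec_nth _"])
  then show ?thesis unfolding nodes_eq by (simp add: finite_PiE)
qed

lemma local_dofs_eq: "local_dofs q T = (\<lambda>x. (smallest_face T x, x)) ` nodes q T"
  unfolding local_dofs_def smallest_face_def ..

lemma local_dofs_iff: "\<sigma> \<in> local_dofs q T \<longleftrightarrow> snd \<sigma> \<in> nodes q T \<and> fst \<sigma> = smallest_face T (snd \<sigma>)"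
  unfolding local_dofs_eq by (cases \<sigma>) auto

lemma finite_local_dofs [simp]: "finite (local_dofs q T)"
  by (simp add: local_dofs_eq finite_nodes)

lemma local_dof_mem: "\<sigma> \<in> local_dofs q T \<Longrightarrow> snd \<sigma> \<in> closed_cell T"
  using nodes_subset by (auto simp: local_dofs_iff)

lemma bij_local_dofs: "bij_betw snd (local_dofs q T) (nodes q T)"
  by (rule bij_betw_byWitness[of _ "\<lambda>x. (smallest_face T x, x)"]) (auto simp: local_dofs_eq)

text \<open>The polynomial on the whole space whose nodal values on T are given by v. In the interior of an active cell T it is the finite element function of v, and elsewhere its extension.\<close>

definition poly_ext :: "nat \<Rightarrow> 'd::finite cell \<Rightarrow> ('d dof \<Rightarrow> real) \<Rightarrow> real^'d \<Rightarrow> real" where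
  "poly_ext q T v z = (\<Sum>\<sigma>\<in>local_dofs q T. v \<sigma> * shape q T (snd \<sigma>) z)"

text \<open>If a reference coordinate of z is 0 or 1, then it is a grid point, and the corresponding factor
  of the shape function of y vanishes unless y has the same coordinate. This locality is what
  makes traces on VEFs depend only on the degrees of freedom of the VEF.\<close>

lemma shape_nonzero_smallest_face:
  assumes "invertible (jac T)" "q \<ge> 1" "y \<in> nodes q T" "z \<in> closed_cell T" "shape q T y z \<noteq> 0"
  shows "y \<in> smallest_face T z"
proof -
  let ?y = "ref_coord T y" and ?z = "ref_coord T z"
  have "lag q (?y $ i) (?z $ i) \<noteq> 0" for i
    using assms(5) unfolding shape_eq_prod_lag by (metis UNIV_I finite prod_zero)
  then have "?z $ i \<in> {0, 1} \<Longrightarrow> ?y $ i = ?z $ i" for i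
    using lag_other[OF grid_ends[OF assms(2)]] by metis
  moreover have "?y \<in> cbox 0 1" using assms nodes_subset mem_closed_cell_iff by blast
  ultimately have "?y \<in> subcube ?z" by (simp add: subcube_def)
  then have "cell_map T ?y \<in> smallest_face T (cell_map T ?z)"
    using assms by (subst smallest_face_eq) (auto simp: mem_closed_cell_iff)
  then show ?thesis using assms(1) by (simp add: cell_map_ref_coord)
qed

lemma shape_node:
  assumes "invertible (jac T)" "y \<in> nodes q T" "z \<in> nodes q T"
  shows "shape q T y z = (if y = z then 1 else 0)"
proof (cases "y = z")
  case True then show ?thesis by (simp add: shape_eq_prod_lag lag_self)
next
  case False
  then have "ref_coord T y \<noteq> ref_coord T z" 
    using cell_map_ref_coord[OF assms(1), of y] cell_map_ref_coord[OF assms(1), of z] by auto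
  then obtain i where "ref_coord T z $ i \<noteq> ref_coord T y $ i" by (metis vec_eq_iff)
  then have "lag q (ref_coord T y $ i) (ref_coord T z $ i) = 0"
    using assms nodes_iff lag_other by blast
  then show ?thesis using False by (auto simp: shape_eq_prod_lag)
qed

lemma poly_ext_node:
  assumes "invertible (jac T)" "\<sigma> \<in> local_dofs q T"
  shows "poly_ext q T v (snd \<sigma>) = v \<sigma>"
proof -
  have "poly_ext q T v (snd \<sigma>) = (\<Sum>\<tau>\<in>local_dofs q T. if \<tau> = \<sigma> then v \<tau> else 0)"
    unfolding poly_ext_def
  proof (rule sum.cong[OF refl])
    fix \<tau> assume "\<tau> \<in> local_dofs q T"
    then show "v \<tau> * shape q T (snd \<tau>) (snd \<sigma>) = (if \<tau> = \<sigma> then v \<tau> else 0)"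
      using assms by (auto simp: shape_node local_dofs_iff prod_eq_iff)
  qed
  then show ?thesis using assms by simp
qed

section \<open>Agreement of faces, nodes and traces on conforming cells\<close>

lemma conformingE:
  assumes "conforming T T'" "invertible (jac T)" "invertible (jac T')"
  obtains \<pi> R where "bij \<pi>" "\<And>i. R i \<in> link"
    "\<And>x i. x \<in> closed_cell T \<Longrightarrow> x \<in> closed_cell T' \<Longrightarrow> R i (ref_coord T x $ i) (ref_coord T' x $ \<pi> i)"
    "\<And>\<xi> \<xi>'. \<xi> \<in> cbox 0 1 \<Longrightarrow> \<xi>' \<in> cbox 0 1 \<Longrightarrow> (\<forall>i. R i (\<xi> $ i) (\<xi>' $ \<pi> i)) \<Longrightarrow> cell_map T \<xi> = cell_map T' \<xi>'"
proof -
  obtain \<pi> R where \<pi>: "bij \<pi>" and R: "\<And>i. R i \<in> link"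
    and eq: "\<And>\<xi> \<xi>'. \<xi> \<in> cbox 0 1 \<Longrightarrow> \<xi>' \<in> cbox 0 1 \<Longrightarrow>
        cell_map T \<xi> = cell_map T' \<xi>' \<longleftrightarrow> (\<forall>i. R i (\<xi> $ i) (\<xi>' $ \<pi> i))"
    using assms(1) unfolding conforming_def by metis
  show ?thesis
  proof (rule that[OF \<pi> R])
    fix x i assume "x \<in> closed_cell T" "x \<in> closed_cell T'"
    then show "R i (ref_coord T x $ i) (ref_coord T' x $ \<pi> i)"
      using eq[of "ref_coord T x" "ref_coord T' x"] assms by (simp add: mem_closed_cell_iff cell_map_ref_coord)
  qed (use eq in blast)
qed

text \<open>A coordinate of the common point x that is frozen in one cell is linked to a frozen coordinate
  of the other one, so a point of the face in T can be transported coordinatewise to T'.\<close>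

lemma smallest_face_subset_conforming:
  assumes "conforming T T'" "invertible (jac T)" "invertible (jac T')"
    and x: "x \<in> closed_cell T" "x \<in> closed_cell T'"
  shows "smallest_face T x \<subseteq> smallest_face T' x"
proof
  fix z assume z: "z \<in> smallest_face T x"
  obtain \<pi> R where \<pi>: "bij \<pi>" and R: "\<And>i. R i \<in> link"
    and Rx: "\<And>x i. x \<in> closed_cell T \<Longrightarrow> x \<in> closed_cell T' \<Longrightarrow> R i (ref_coord T x $ i) (ref_coord T' x $ \<pi> i)"
    and eq: "\<And>\<xi> \<xi>'. \<xi> \<in> cbox 0 1 \<Longrightarrow> \<xi>' \<in> cbox 0 1 \<Longrightarrow> (\<forall>i. R i (\<xi> $ i) (\<xi>' $ \<pi> i)) \<Longrightarrow> cell_map T \<xi> = cell_map T' \<xi>'"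
    by (rule conformingE[OF assms(1-3)]) (rule that)
  define p where "p = ref_coord T x"
  define p' where "p' = ref_coord T' x"
  have p: "p \<in> cbox 0 1" "p' \<in> cbox 0 1" using x assms by (auto simp: p_def p'_def mem_closed_cell_iff)
  have xp: "cell_map T p = x" "cell_map T' p' = x" using assms by (auto simp: p_def p'_def cell_map_ref_coord)
  have Rp: "R i (p $ i) (p' $ \<pi> i)" for i using Rx[OF x] by (simp add: p_def p'_def)
  obtain \<zeta> where \<zeta>: "z = cell_map T \<zeta>" "\<zeta> \<in> subcube p"
    using z smallest_face_eq[OF assms(2) p(1)] xp by auto
  have "\<exists>t. 0 \<le> t \<and> t \<le> 1 \<and> R i (\<zeta> $ i) t \<and> (p' $ \<pi> i \<in> {0, 1} \<longrightarrow> t = p' $ \<pi> i)" for i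
  proof -
    have z01: "0 \<le> \<zeta> $ i" "\<zeta> $ i \<le> 1" using \<zeta> by (auto simp: subcube_def mem_cube_iff)
    have zp: "p $ i \<in> {0, 1} \<Longrightarrow> \<zeta> $ i = p $ i" using \<zeta> by (auto simp: subcube_def)
    show ?thesis using R[of i]
    proof (cases rule: link_cases)
      case empty then show ?thesis using Rp[of i] by simp
    next
      case same then show ?thesis using Rp[of i] z01 zp by auto
    next
      case flip then show ?thesis using Rp[of i] z01 zp by (intro exI[of _ "1 - \<zeta> $ i"]) auto
    next
      case (const b c) then show ?thesis using Rp[of i] zp by (intro exI[of _ c]) auto
    qed
  qed
  then obtain t where t: "\<And>i. 0 \<le> t i \<and> t i \<le> 1 \<and> R i (\<zeta> $ i) (t i) \<and> (p' $ \<pi> i \<in> {0, 1} \<longrightarrow> t i = p' $ \<pi> i)"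
    by metis
  define \<zeta>' where "\<zeta>' = (\<chi> j. t (inv \<pi> j))"
  have \<zeta>'\<pi>: "\<zeta>' $ \<pi> i = t i" for i using \<pi> by (simp add: \<zeta>'_def bij_is_inj inv_f_f)
  have \<pi>inv: "\<pi> (inv \<pi> j) = j" for j using \<pi> by (simp add: bij_is_surj surj_f_inv_f)
  have "\<zeta>' \<in> subcube p'"
    unfolding subcube_def
  proof (intro CollectI conjI allI impI)
    show "\<zeta>' \<in> cbox 0 1" using t by (simp add: \<zeta>'_def mem_cube_iff)
    fix j assume "p' $ j \<in> {0, 1}"
    then show "\<zeta>' $ j = p' $ j" using t[of "inv \<pi> j"] by (simp add: \<zeta>'_def \<pi>inv)
  qed
  moreover have "cell_map T \<zeta> = cell_map T' \<zeta>'"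
  proof (rule eq)
    show "\<zeta> \<in> cbox 0 1" "\<zeta>' \<in> cbox 0 1" using \<zeta>(2) calculation by (simp_all add: subcube_def)
    show "\<forall>i. R i (\<zeta> $ i) (\<zeta>' $ \<pi> i)" using t by (simp add: \<zeta>'\<pi>)
  qed
  ultimately show "z \<in> smallest_face T' x"
    using smallest_face_eq[OF assms(3) p(2)] xp \<zeta> by auto
qed

lemma node_conforming:
  assumes "conforming T T'" "invertible (jac T)" "invertible (jac T')" "q \<ge> 1"
    and "x \<in> nodes q T" "x \<in> closed_cell T'"
  shows "x \<in> nodes q T'"
proof -
  obtain \<pi> R where \<pi>: "bij \<pi>" and R: "\<And>i. R i \<in> link"
    and Rx: "\<And>x i. x \<in> closed_cell T \<Longrightarrow> x \<in> closed_cell T' \<Longrightarrow> R i (ref_coord T x $ i) (ref_coord T' x $ \<pi> i)"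
    by (rule conformingE[OF assms(1-3)]) (rule that)
  have "R i (ref_coord T x $ i) (ref_coord T' x $ \<pi> i)" for i
    using Rx assms nodes_subset by blast
  then have "ref_coord T' x $ \<pi> i \<in> grid q" for i
    using link_grid[OF assms(4) R] assms(5) nodes_iff[OF assms(2)] by blast
  then show ?thesis unfolding nodes_iff[OF assms(3)] using \<pi> by (metis bij_pointE)
qed

lemma shape_conforming:
  assumes "conforming T T'" "invertible (jac T)" "invertible (jac T')" "q \<ge> 1"
    and "y \<in> closed_cell T" "y \<in> closed_cell T'" "z \<in> closed_cell T" "z \<in> closed_cell T'"
  shows "shape q T y z = shape q T' y z"
proof -
  obtain \<pi> R where \<pi>: "bij \<pi>" and R: "\<And>i. R i \<in> link"
    and Rx: "\<And>x i. x \<in> closed_cell T \<Longrightarrow> x \<in> closed_cell T' \<Longrightarrow> R i (ref_coord T x $ i) (ref_coord T' x $ \<pi> i)"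
    by (rule conformingE[OF assms(1-3)]) (rule that)
  have "shape q T y z = (\<Prod>i\<in>UNIV. lag q (ref_coord T' y $ \<pi> i) (ref_coord T' z $ \<pi> i))"
    unfolding shape_eq_prod_lag
    by (intro prod.cong refl lag_link[OF assms(4) R Rx Rx] assms)
  also have "\<dots> = shape q T' y z"
    unfolding shape_eq_prod_lag by (rule prod.reindex_bij_betw[OF \<pi>])
  finally show ?thesis .
qed

text \<open>The intersection contains the smallest face around each of its points.\<close>

lemma Int_face_of_conforming:
  assumes "conforming T T'" "invertible (jac T)" "invertible (jac T')"
  shows "closed_cell T \<inter> closed_cell T' face_of closed_cell T"
  unfolding face_of_def
proof (intro conjI ballI impI)
  fix a b x assume ab: "a \<in> closed_cell T" "b \<in> closed_cell T"
    and x: "x \<in> closed_cell T \<inter> closed_cell T'" "x \<in> open_segment a b"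
  have "a \<in> smallest_face T x \<and> b \<in> smallest_face T x"
    using face_ofD[OF smallest_face_face_of x(2) ab] x(1) mem_smallest_face by blast
  moreover have "smallest_face T x \<subseteq> smallest_face T' x"
    using smallest_face_subset_conforming[OF assms] x by blast
  moreover have "smallest_face T' x \<subseteq> closed_cell T'"
    using smallest_face_face_of face_of_imp_subset x by blast
  ultimately show "a \<in> closed_cell T \<inter> closed_cell T'" "b \<in> closed_cell T \<inter> closed_cell T'"
    using ab by blast+
qed (auto intro: convex_Int convex_closed_cell)

section \<open>Forest-of-trees meshes\<close>

lemma child_invertible:
  assumes "T \<in> children P" "invertible (jac P)"
  shows "invertible (jac T)"
  using assms scalar_invertible[of "1/2" "jac P"] by (metis childE zero_neq_numeral divide_eq_0_iff one_neq_zero)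

lemma child_closed_subset:
  assumes "T \<in> children P"
  shows "closed_cell T \<subseteq> closed_cell P"
proof -
  obtain b where b: "\<And>i. b $ i \<in> {0, 1}" "\<And>\<zeta>. cell_map T \<zeta> = cell_map P ((1/2) *\<^sub>R (\<zeta> + b))"
    using childE[OF assms] by metis
  show ?thesis
    unfolding closed_cell_def b(2) using half_mem_cube[OF _ b(1)] by blast
qed

lemma child_open_subset:
  assumes "T \<in> children P"
  shows "open_cell T \<subseteq> open_cell P"
proof -
  obtain b where b: "\<And>i. b $ i \<in> {0, 1}" "\<And>\<zeta>. cell_map T \<zeta> = cell_map P ((1/2) *\<^sub>R (\<zeta> + b))"
    using childE[OF assms] by metis
  have "(1/2) *\<^sub>R (\<zeta> + b) \<in> box 0 1" if "\<zeta> \<in> box 0 1" for \<zeta>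
    unfolding mem_open_cube_iff
  proof
    fix i show "0 < ((1/2) *\<^sub>R (\<zeta> + b)) $ i \<and> ((1/2) *\<^sub>R (\<zeta> + b)) $ i < 1"
      using that b(1)[of i] by (auto simp: mem_open_cube_iff dest: spec[of _ i])
  qed
  then show ?thesis unfolding open_cell_def b(2) by blast
qed

lemma children_cover:
  assumes "y \<in> closed_cell P"
  shows "\<exists>T\<in>children P. y \<in> closed_cell T"
proof -
  obtain \<xi> where \<xi>: "\<xi> \<in> cbox 0 1" "y = cell_map P \<xi>" using assms by (auto simp: closed_cell_def)
  define b :: "real^'a" where "b = (\<chi> i. if \<xi> $ i \<le> 1/2 then 0 else 1)"
  define T where "T = Cell (Suc (level P)) (cell_map P ((1/2) *\<^sub>R b)) ((1/2) *\<^sub>R jac P)"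
  have "\<forall>i. b $ i \<in> {0, 1}" by (simp add: b_def)
  then have T: "T \<in> children P" unfolding T_def children_def by blast
  have "cell_map T \<zeta> = cell_map P ((1/2) *\<^sub>R (\<zeta> + b))" for \<zeta>
    unfolding T_def by (rule cell_map_child)
  from this[of "2 *\<^sub>R \<xi> - b"] have "y = cell_map T (2 *\<^sub>R \<xi> - b)" by (simp add: \<xi>)
  moreover have "2 *\<^sub>R \<xi> - b \<in> cbox 0 1"
    using \<xi>(1) by (auto simp: mem_cube_iff b_def)
  ultimately show ?thesis using T unfolding closed_cell_def by blast
qed

lemma finite_children: "finite (children P)"
proof -
  have "children P \<subseteq> (\<lambda>b. Cell (Suc (level P)) (cell_map P ((1/2) *\<^sub>R b)) ((1/2) *\<^sub>R jac P)) ` vec_lambda ` PiE UNIV (\<lambda>_. {0, 1})"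
    unfolding children_def
    by (clarify, intro imageI image_eqI[of _ vec_lambda "vec_nth _"]) auto
  then show ?thesis by (rule finite_subset) (simp add: finite_PiE)
qed

lemma children_disjoint:
  assumes "invertible (jac P)" "T \<in> children P" "S \<in> children P" "T \<noteq> S"
  shows "open_cell T \<inter> open_cell S = {}"
proof (rule ccontr)
  assume "open_cell T \<inter> open_cell S \<noteq> {}"
  obtain b where b: "\<forall>i. b $ i \<in> {0, 1}"
    "T = Cell (Suc (level P)) (cell_map P ((1/2) *\<^sub>R b)) ((1/2) *\<^sub>R jac P)"
    using assms(2) unfolding children_def by blast
  obtain c where c: "\<forall>i. c $ i \<in> {0, 1}"
    "S = Cell (Suc (level P)) (cell_map P ((1/2) *\<^sub>R c)) ((1/2) *\<^sub>R jac P)"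
    using assms(3) unfolding children_def by blast
  have bT: "cell_map T \<zeta> = cell_map P ((1/2) *\<^sub>R (\<zeta> + b))" for \<zeta>
    unfolding b(2) by (rule cell_map_child)
  have cS: "cell_map S \<zeta> = cell_map P ((1/2) *\<^sub>R (\<zeta> + c))" for \<zeta>
    unfolding c(2) by (rule cell_map_child)
  obtain \<zeta> \<zeta>' where z: "\<zeta> \<in> box 0 1" "\<zeta>' \<in> box 0 1" "cell_map T \<zeta> = cell_map S \<zeta>'"
    using \<open>open_cell T \<inter> open_cell S \<noteq> {}\<close> by (auto simp: open_cell_def)
  then have "(1/2) *\<^sub>R (\<zeta> + b) = (1/2) *\<^sub>R (\<zeta>' + c)"
    by (simp only: bT cS cell_map_eq_iff[OF assms(1)])
  then have e: "\<zeta> + b = \<zeta>' + c" by simp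
  have "b $ i = c $ i" for i
  proof -
    have "\<zeta> $ i + b $ i = \<zeta>' $ i + c $ i" using e by (metis vector_add_component)
    moreover have "0 < \<zeta> $ i" "\<zeta> $ i < 1" "0 < \<zeta>' $ i" "\<zeta>' $ i < 1" using z by (auto simp: mem_open_cube_iff)
    ultimately show ?thesis using b(1)[rule_format, of i] c(1)[rule_format, of i] by auto
  qed
  then have "b = c" by (simp add: vec_eq_iff)
  then show False using b c assms(4) by simp
qed

text \<open>An interior point has no frozen coordinate, so its smallest face is the whole cell.\<close>

lemma face_meets_open_cell:
  assumes "invertible (jac T)" "g face_of closed_cell T" "x \<in> g" "x \<in> open_cell T"
  shows "g = closed_cell T"
proof -
  define p where "p = ref_coord T x"
  have p: "p \<in> box 0 1" using assms by (simp add: p_def mem_open_cell_iff)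
  have "p $ i \<notin> {0, 1}" for i using p[unfolded mem_open_cube_iff, rule_format, of i] by auto
  then have "subcube p = cbox 0 1" unfolding subcube_def by blast
  moreover have "smallest_face T (cell_map T p) = cell_map T ` subcube p"
    by (rule smallest_face_eq[OF assms(1)]) (use p box_subset_cbox in blast)
  ultimately have "smallest_face T x = closed_cell T"
    by (simp add: closed_cell_def p_def cell_map_ref_coord[OF assms(1)])
  then show ?thesis using smallest_face_subset[OF assms(2,3)] face_of_imp_subset[OF assms(2)] by blast
qed

text \<open>The cells of the n-th uniform refinement of the coarse mesh. They need not belong to the mesh
  under consideration, but every mesh cell belongs to one of these families. The parents of mesh
  cells are compared with mesh cells there.\<close>

primrec unif :: "'d::finite cell set \<Rightarrow> nat \<Rightarrow> 'd cell set" where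
  "unif \<C> 0 = \<C>"
| "unif \<C> (Suc n) = (\<Union>P\<in>unif \<C> n. children P)"

locale forest =
  fixes art :: "(real^'d::finite) set" and \<C> \<T> :: "'d cell set"
  assumes coarse_mesh: "coarse_mesh art \<C>"
    and refinement: "refinement_of \<C> \<T>"
    and balanced: "balanced \<T>"
begin

lemma unif_level: "T \<in> unif \<C> n \<Longrightarrow> level T = n"
proof (induction n arbitrary: T)
  case 0 then show ?case using coarse_mesh by (auto simp: coarse_mesh_def)
next
  case (Suc n) then show ?case by (auto elim!: childE)
qed

lemma unif_invertible: "T \<in> unif \<C> n \<Longrightarrow> invertible (jac T)"
proof (induction n arbitrary: T)
  case 0 then show ?case using coarse_mesh by (auto simp: coarse_mesh_def)
next
  case (Suc n) then show ?case using child_invertible by fastforce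
qed

text \<open>Uniform refinement keeps a conforming mesh conforming.\<close>

lemma unif_conforming: "T \<in> unif \<C> n \<Longrightarrow> T' \<in> unif \<C> n \<Longrightarrow> conforming T T'"
proof (induction n arbitrary: T T')
  case 0
  then have inv: "invertible (jac T)" "invertible (jac T')" using unif_invertible by blast+
  show ?case
  proof (cases "T = T'")
    case True then show ?thesis using conforming_refl inv by blast
  next
    case False
    then have "closed_cell T \<inter> closed_cell T' \<in> {{}} \<union> (vefs T \<inter> vefs T')"
      using coarse_mesh 0 by (auto simp: coarse_mesh_def)
    then show ?thesis
      using conforming_disjoint[of T T'] conforming_common_face[OF inv] by (auto simp: vefs_def)
  qed
next
  case (Suc n) then show ?case using conforming_children by fastforce
qed

lemma refinement_unif: "refinement_of \<C> \<S> \<Longrightarrow> T \<in> \<S> \<Longrightarrow> T \<in> unif \<C> (level T)"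
proof (induction arbitrary: T rule: refinement_of.induct)
  case coarse
  then show ?case using unif_level[of T 0] by simp
next
  case (refine \<S> T\<^sub>0)
  show ?case
  proof (cases "T \<in> children T\<^sub>0")
    case True
    then have "level T = Suc (level T\<^sub>0)" using childE by metis
    then show ?thesis using True refine by auto
  next
    case False then show ?thesis using refine by auto
  qed
qed

lemmas mesh_unif = refinement_unif[OF refinement]

lemma finite_mesh: "finite \<T>"
  using refinement
proof induction
  case coarse then show ?case using coarse_mesh by (auto simp: coarse_mesh_def)
qed (auto simp: finite_children)

lemma mesh_invertible: "T \<in> \<T> \<Longrightarrow> invertible (jac T)"
  using mesh_unif unif_invertible by blast

lemma refinement_disjoint:
  assumes "refinement_of \<C> \<S>"
  shows "(\<forall>T\<in>\<S>. invertible (jac T)) \<and> (\<forall>T\<in>\<S>. \<forall>T'\<in>\<S>. T \<noteq> T' \<longrightarrow> open_cell T \<inter> open_cell T' = {})"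
  using assms
proof induction
  case coarse
  have "open_cell T \<inter> open_cell T' = {}" if T: "T \<in> \<C>" "T' \<in> \<C>" "T \<noteq> T'" for T T'
  proof (rule ccontr)
    assume "open_cell T \<inter> open_cell T' \<noteq> {}"
    then obtain x where x: "x \<in> open_cell T" "x \<in> closed_cell T \<inter> closed_cell T'"
      using open_cell_subset by blast
    then have "closed_cell T \<inter> closed_cell T' \<in> vefs T"
      using coarse_mesh T by (fastforce simp: coarse_mesh_def)
    then show False
      using face_meets_open_cell[of T "closed_cell T \<inter> closed_cell T'" x] x T unif_invertible[of T 0]
      by (auto simp: vefs_def)
  qed
  then show ?case using unif_invertible[of _ 0] by auto
next
  case (refine \<T> T\<^sub>0)
  have "open_cell T \<inter> open_cell T' = {}"
    if T: "T \<in> \<T> - {T\<^sub>0} \<union> children T\<^sub>0" "T' \<in> \<T> - {T\<^sub>0} \<union> children T\<^sub>0" "T \<noteq> T'" for T T'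
  proof -
    have inv: "invertible (jac T\<^sub>0)" using refine by blast
    have old: "open_cell S \<inter> open_cell T\<^sub>0 = {}" if "S \<in> \<T> - {T\<^sub>0}" for S using refine that by blast
    consider "T \<in> children T\<^sub>0" "T' \<in> children T\<^sub>0" | "T \<in> children T\<^sub>0" "T' \<in> \<T> - {T\<^sub>0}"
      | "T \<in> \<T> - {T\<^sub>0}" "T' \<in> children T\<^sub>0" | "T \<in> \<T> - {T\<^sub>0}" "T' \<in> \<T> - {T\<^sub>0}"
      using T by blast
    then show ?thesis
    proof cases
      case 1 then show ?thesis using children_disjoint[OF inv] T by blast
    next
      case 2 then show ?thesis using child_open_subset[of T] old[of T'] by blast
    next
      case 3 then show ?thesis using child_open_subset[of T'] old[of T] by blast
    next
      case 4 then show ?thesis using refine T by blast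
    qed
  qed
  moreover have "invertible (jac T)" if "T \<in> \<T> - {T\<^sub>0} \<union> children T\<^sub>0" for T
    using refine that child_invertible by blast
  ultimately show ?case by blast
qed

lemma mesh_disjoint: "T \<in> \<T> \<Longrightarrow> T' \<in> \<T> \<Longrightarrow> T \<noteq> T' \<Longrightarrow> open_cell T \<inter> open_cell T' = {}"
  using refinement_disjoint[OF refinement] by blast

lemma mesh_open_closed_disjoint:
  assumes "T \<in> \<T>" "T' \<in> \<T>" "T \<noteq> T'"
  shows "open_cell T \<inter> closed_cell T' = {}"
proof -
  have "open_cell T \<inter> closure (open_cell T') = {}"
    using mesh_disjoint[OF assms] open_open_cell[OF mesh_invertible[OF assms(1)]]
    by (simp add: open_Int_closure_eq_empty)
  then show ?thesis using closed_cell_subset_closure by blast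
qed

text \<open>A cell that was refined stays covered by cells of higher level. This is the form in which the
  2:1 balance will be used: near any point of the parent P of a mesh cell there is a mesh cell as
  fine as the children of P.\<close>

lemma refinement_parent:
  assumes "refinement_of \<C> \<S>" "T \<in> \<S>" "level T = Suc n"
  shows "\<exists>P\<in>unif \<C> n. T \<in> children P \<and>
    (\<forall>y\<in>closed_cell P. \<exists>S\<in>\<S>. Suc n \<le> level S \<and> y \<in> closed_cell S)"
  using assms
proof (induction arbitrary: T n)
  case coarse
  then show ?case using unif_level[of T 0] by simp
next
  case (refine \<T> T\<^sub>0)
  show ?case
  proof (cases "T \<in> children T\<^sub>0")
    case True
    then have "level T\<^sub>0 = n" using refine childE by (metis old.nat.inject)
    then have "T\<^sub>0 \<in> unif \<C> n" using refine refinement_unif by blast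
    moreover have "\<exists>S\<in>\<T> - {T\<^sub>0} \<union> children T\<^sub>0. Suc n \<le> level S \<and> y \<in> closed_cell S" if "y \<in> closed_cell T\<^sub>0" for y
      using children_cover[OF that] \<open>level T\<^sub>0 = n\<close> childE by (metis UnCI le_refl)
    ultimately show ?thesis using True by blast
  next
    case False
    then have "T \<in> \<T>" using refine by blast
    then obtain P where P: "P \<in> unif \<C> n" "T \<in> children P"
      "\<And>y. y \<in> closed_cell P \<Longrightarrow> \<exists>S\<in>\<T>. Suc n \<le> level S \<and> y \<in> closed_cell S"
      using refine by metis
    have "\<exists>S\<in>\<T> - {T\<^sub>0} \<union> children T\<^sub>0. Suc n \<le> level S \<and> y \<in> closed_cell S" if y: "y \<in> closed_cell P" for y
    proof -
      obtain S where S: "S \<in> \<T>" "Suc n \<le> level S" "y \<in> closed_cell S" using P(3)[OF y] by blast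
      show ?thesis
      proof (cases "S = T\<^sub>0")
        case True
        then obtain S' where "S' \<in> children T\<^sub>0" "y \<in> closed_cell S'" using children_cover S by blast
        moreover have "level S' = Suc (level T\<^sub>0)" using calculation childE by metis
        ultimately show ?thesis using S True by (intro bexI[of _ S']) auto
      qed (use S in blast)
    qed
    then show ?thesis using P by blast
  qed
qed

lemmas mesh_parent = refinement_parent[OF refinement]

end

section \<open>Owner VEFs and refinement levels\<close>

context forest
begin

lemma unif_smallest_face_eq:
  assumes "T \<in> unif \<C> n" "T' \<in> unif \<C> n" "x \<in> closed_cell T" "x \<in> closed_cell T'"
  shows "smallest_face T x = smallest_face T' x"
proof
  note c = unif_conforming[OF assms(1,2)] unif_conforming[OF assms(2,1)]
    and i = unif_invertible[OF assms(1)] unif_invertible[OF assms(2)]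
  show "smallest_face T x \<subseteq> smallest_face T' x" by (rule smallest_face_subset_conforming[OF c(1) i assms(3,4)])
  show "smallest_face T' x \<subseteq> smallest_face T x" by (rule smallest_face_subset_conforming[OF c(2) i(2,1) assms(4,3)])
qed

lemma unif_local_dof:
  assumes "q \<ge> 1" "T \<in> unif \<C> n" "T' \<in> unif \<C> n" "\<sigma> \<in> local_dofs q T" "snd \<sigma> \<in> closed_cell T'"
  shows "\<sigma> \<in> local_dofs q T'"
  using node_conforming[OF unif_conforming[OF assms(2,3)] unif_invertible[OF assms(2)]
      unif_invertible[OF assms(3)] assms(1) _ assms(5)]
    unif_smallest_face_eq[OF assms(2,3) local_dof_mem[OF assms(4)] assms(5)] assms(4)
  by (simp add: local_dofs_iff)

lemma poly_ext_smallest_face: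
  assumes "invertible (jac T)" "q \<ge> 1" "z \<in> closed_cell T"
  shows "poly_ext q T v z = (\<Sum>\<sigma> | \<sigma> \<in> local_dofs q T \<and> snd \<sigma> \<in> smallest_face T z. v \<sigma> * shape q T (snd \<sigma>) z)"
  unfolding poly_ext_def
  by (rule sum.mono_neutral_right)
     (use shape_nonzero_smallest_face[OF assms(1,2) _ assms(3)] in \<open>auto simp: local_dofs_iff\<close>)

text \<open>Conforming cells have the same trace on their intersection: near z only the degrees of freedom
  of the smallest face of z contribute, and these and their shape functions are common.\<close>

lemma unif_ext_eq:
  assumes "q \<ge> 1" "T \<in> unif \<C> n" "T' \<in> unif \<C> n" "z \<in> closed_cell T" "z \<in> closed_cell T'"
  shows "poly_ext q T v z = poly_ext q T' v z"
proof -
  have car: "smallest_face T z = smallest_face T' z" using assms unif_smallest_face_eq by blast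
  have sub: "smallest_face T z \<subseteq> closed_cell T" "smallest_face T z \<subseteq> closed_cell T'"
    using smallest_face_face_of[OF assms(4)] smallest_face_face_of[OF assms(5)] face_of_imp_subset car by auto
  have "{\<sigma>. \<sigma> \<in> local_dofs q T \<and> snd \<sigma> \<in> smallest_face T z} = {\<sigma>. \<sigma> \<in> local_dofs q T' \<and> snd \<sigma> \<in> smallest_face T' z}"
    using unif_local_dof[OF assms(1-3)] unif_local_dof[OF assms(1,3,2)] sub car by blast
  then show ?thesis
    unfolding poly_ext_smallest_face[OF unif_invertible[OF assms(2)] assms(1,4)]
      poly_ext_smallest_face[OF unif_invertible[OF assms(3)] assms(1,5)]
    using sub car
    by (intro sum.cong refl arg_cong2[of _ _ _ _ "(*)"] shape_conforming[OF unif_conforming[OF assms(2,3)]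
          unif_invertible[OF assms(2)] unif_invertible[OF assms(3)] assms(1) _ _ assms(4,5)]) auto
qed

lemma unif_Int_face_of:
  assumes "T \<in> unif \<C> n" "T' \<in> unif \<C> n"
  shows "closed_cell T \<inter> closed_cell T' face_of closed_cell T"
  by (rule Int_face_of_conforming[OF unif_conforming[OF assms] unif_invertible[OF assms(1)] unif_invertible[OF assms(2)]])

lemma parentE:
  assumes "T \<in> \<T>" "level T = Suc n"
  obtains P where "P \<in> unif \<C> n" "T \<in> children P"
    "\<And>y. y \<in> closed_cell P \<Longrightarrow> \<exists>S\<in>\<T>. Suc n \<le> level S \<and> y \<in> closed_cell S"
  using mesh_parent[OF assms] by blast

text \<open>Intersect the common face of the parent and T' with the child.\<close>

lemma child_Int_face_of:
  assumes P: "P \<in> unif \<C> n" and T: "T \<in> children P" and T': "T' \<in> unif \<C> n"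
  shows "closed_cell T \<inter> closed_cell T' face_of closed_cell T"
proof -
  have "closed_cell P \<inter> closed_cell T' \<inter> closed_cell T face_of closed_cell P \<inter> closed_cell T"
    by (rule face_of_slice[OF unif_Int_face_of[OF P T'] convex_closed_cell])
  moreover have "closed_cell P \<inter> closed_cell T' \<inter> closed_cell T = closed_cell T \<inter> closed_cell T'"
    "closed_cell P \<inter> closed_cell T = closed_cell T"
    using child_closed_subset[OF T] by blast+
  ultimately show ?thesis by simp
qed

lemma level_le_Suc:
  assumes "T \<in> \<T>" "T' \<in> \<T>" "x \<in> closed_cell T" "x \<in> closed_cell T'"
  shows "level T \<le> Suc (level T')"
proof -
  have "closed_cell T \<inter> closed_cell T' \<noteq> {}" using assms by blast
  then have "level T \<le> level T' + 1" using balanced assms(1,2) unfolding balanced_def by blast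
  then show ?thesis by simp
qed

text \<open>An owner is exactly one level coarser. Cells of equal level conform, and a cell that is finer
  than T meets T in one of its own faces; both exclude a proper subset of an owner VEF.\<close>

lemma owner_level:
  assumes own: "owner \<A> T g T' f'" and "T \<in> \<T>" "\<A> \<subseteq> \<T>"
  shows "T' \<in> \<A>" "level T = Suc (level T')" "g \<subseteq> closed_cell T'" "g \<subseteq> f'"
    "f' face_of closed_cell T'"
proof -
  let ?f = "closed_cell T \<inter> closed_cell T'"
  have f: "?f \<in> vefs T" "?f \<notin> vefs T'" "?f \<subset> f'" "g \<subseteq> ?f" "f' \<in> vefs T'" and T'A: "T' \<in> \<A>"
    using own by (auto simp: owner_def Let_def)
  show "T' \<in> \<A>" "g \<subseteq> closed_cell T'" "g \<subseteq> f'" "f' face_of closed_cell T'"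
    using f T'A by (auto simp: vefs_def)
  have T': "T' \<in> \<T>" using T'A assms(3) by blast
  obtain x where x: "x \<in> closed_cell T" "x \<in> closed_cell T'" using f(1) by (auto simp: vefs_def)
  have sub: "f' \<subseteq> closed_cell T'" using f(5) by (auto simp: vefs_def face_of_imp_subset)
  have not_face: "\<not> ?f face_of closed_cell T'"
    using f(1,2,3) sub by (auto simp: vefs_def)
  have ne: "level T \<noteq> level T'"
    using not_face unif_Int_face_of[OF mesh_unif[OF T'], of T] mesh_unif[OF assms(2)]
    by (auto simp: Int_commute)
  have "level T' \<noteq> Suc (level T)"
  proof
    assume "level T' = Suc (level T)"
    then obtain P where "P \<in> unif \<C> (level T)" "T' \<in> children P" using parentE[OF T'] by metis
    then show False
      using child_Int_face_of[of P "level T" T' T] mesh_unif[OF assms(2)] not_face by (simp add: Int_commute)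
  qed
  then show "level T = Suc (level T')"
    using ne level_le_Suc[OF assms(2) T' x] level_le_Suc[OF T' assms(2) x(2,1)] by linarith
qed

text \<open>A face f of the parent P that fits into the child T is a single vertex. Indeed, if a coordinate
  of a point of f were free in P, then f would contain points at both ends of an edge of P, but T
  covers only one half of it.\<close>

lemma vertex_local_dof:
  assumes q: "q \<ge> 1" and P: "P \<in> unif \<C> n" and T: "T \<in> children P" and T': "T' \<in> unif \<C> n"
    and \<sigma>: "\<sigma> \<in> local_dofs q T" and f: "f face_of closed_cell P" "f \<subseteq> closed_cell T"
    and x: "snd \<sigma> \<in> f" "snd \<sigma> \<in> closed_cell T'"
  shows "\<sigma> \<in> local_dofs q T'"
proof -
  obtain c where c: "\<And>i. c $ i \<in> {0, 1}" "\<And>\<zeta>. cell_map T \<zeta> = cell_map P ((1/2) *\<^sub>R (\<zeta> + c))"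
    using childE[OF T] by metis
  have invP: "invertible (jac P)" and invT: "invertible (jac T)"
    using P T unif_invertible child_invertible by blast+
  define p where "p = ref_coord P (snd \<sigma>)"
  have xP: "snd \<sigma> \<in> closed_cell P" using f x face_of_imp_subset by blast
  have p: "p \<in> cbox 0 1" "cell_map P p = snd \<sigma>"
    using xP invP by (auto simp: p_def mem_closed_cell_iff cell_map_ref_coord)
  have car: "cell_map P ` subcube p \<subseteq> closed_cell T"
    using smallest_face_subset[OF f(1) x(1)] f(2) smallest_face_eq[OF invP p(1)] p(2) by auto
  have half: "c $ i / 2 \<le> \<xi> $ i \<and> \<xi> $ i \<le> (1 + c $ i) / 2" if "\<xi> \<in> subcube p" for \<xi> i
  proof -
    have "cell_map P \<xi> \<in> cell_map T ` cbox 0 1" using car that by (auto simp: closed_cell_def)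
    then obtain \<zeta> where \<zeta>: "\<zeta> \<in> cbox 0 1" "cell_map P \<xi> = cell_map P ((1/2) *\<^sub>R (\<zeta> + c))"
      unfolding c(2) by blast
    then have "\<xi> = (1/2) *\<^sub>R (\<zeta> + c)" by (simp add: cell_map_eq_iff[OF invP])
    then have "\<xi> $ i = (\<zeta> $ i + c $ i) / 2" by simp
    moreover have "0 \<le> \<zeta> $ i" "\<zeta> $ i \<le> 1" using \<zeta>(1) by (auto simp: mem_cube_iff)
    ultimately show ?thesis by simp
  qed
  have p01: "p $ i \<in> {0, 1}" for i
  proof (rule ccontr)
    assume n: "p $ i \<notin> {0, 1}"
    have "(\<chi> j. if j = i then s else p $ j) \<in> subcube p" if "s \<in> {0, 1}" for s
      using p(1) n that by (auto simp: subcube_def mem_cube_iff)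
    from half[OF this[of 0], of i] half[OF this[of 1], of i] show False by simp
  qed
  have "p \<in> subcube p" using p by (simp add: subcube_def)
  have pc: "p $ i = c $ i" for i
    using p01[of i] c(1)[of i] half[OF \<open>p \<in> subcube p\<close>, of i] by auto
  have sub: "subcube r = {r}" if "\<And>i. r $ i \<in> {0, 1}" for r :: "real^'d"
  proof -
    have "0 \<le> r $ i \<and> r $ i \<le> 1" for i using that[of i] by auto
    then have "r \<in> subcube r" by (simp add: subcube_def mem_cube_iff)
    moreover have "\<xi> = r" if "\<xi> \<in> subcube r" for \<xi>
      using that \<open>\<And>i. r $ i \<in> {0, 1}\<close> unfolding subcube_def vec_eq_iff by blast
    ultimately show ?thesis by blast
  qed
  have carP: "smallest_face P (snd \<sigma>) = {snd \<sigma>}"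
    using smallest_face_eq[OF invP p(1)] p(2) sub[of p] p01 by simp
  have cT: "snd \<sigma> = cell_map T c"
  proof -
    have "(1/2) *\<^sub>R (c + c) = p" using pc by (simp add: vec_eq_iff)
    then show ?thesis using p(2) c(2) by simp
  qed
  have "c \<in> cbox 0 1" using pc p(1) by (simp add: mem_cube_iff)
  then have carT: "smallest_face T (snd \<sigma>) = {snd \<sigma>}"
    using smallest_face_eq[OF invT, of c] cT sub[of c] c(1) by simp
  have "snd \<sigma> \<in> nodes q P"
    using nodes_iff[OF invP] p01 grid_ends[OF q] by (simp add: p_def)
  then have "\<sigma> \<in> local_dofs q P" using \<sigma> carT carP by (simp add: local_dofs_iff)
  then show ?thesis using unif_local_dof[OF q P T'] x by blast
qed

text \<open>A converse of owner_level: a degree of freedom of T on the boundary of a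
  cell T' one level coarser is either shared with T' or hanging on a VEF of T'. The owner VEF is
  the intersection F of T' with the parent P of T. It is a VEF of both, by conformity, and T meets
  T' in the part of F that belongs to T. If this part is itself a VEF of T', it is a vertex.\<close>

lemma coarser_neighbour_dof:
  assumes q: "q \<ge> 1" and T: "T \<in> \<A>" "T' \<in> \<A>" "\<A> \<subseteq> \<T>" and lev: "level T = Suc (level T')"
    and \<sigma>: "\<sigma> \<in> local_dofs q T" "snd \<sigma> \<in> closed_cell T'"
  shows "\<sigma> \<in> local_dofs q T' \<or> (\<exists>f'. owner \<A> T (fst \<sigma>) T' f')"
proof -
  have mesh: "T \<in> \<T>" "T' \<in> \<T>" using T by auto
  define n where "n = level T'"
  obtain P where P: "P \<in> unif \<C> n" "T \<in> children P"
    "\<And>y. y \<in> closed_cell P \<Longrightarrow> \<exists>S\<in>\<T>. Suc n \<le> level S \<and> y \<in> closed_cell S"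
    using parentE[OF mesh(1), of n] lev by (metis n_def)
  have T': "T' \<in> unif \<C> n" using mesh_unif[OF mesh(2)] by (simp add: n_def)
  let ?F = "closed_cell P \<inter> closed_cell T'" and ?f = "closed_cell T \<inter> closed_cell T'"
  have TP: "closed_cell T \<subseteq> closed_cell P" by (rule child_closed_subset[OF P(2)])
  have x: "snd \<sigma> \<in> ?f" using \<sigma> local_dof_mem by blast
  have F: "?F face_of closed_cell P" "?F face_of closed_cell T'"
    using unif_Int_face_of[OF P(1) T'] unif_Int_face_of[OF T' P(1)] by (auto simp: Int_commute)
  have f: "?f face_of closed_cell T" by (rule child_Int_face_of[OF P(1,2) T'])
  have "T \<noteq> T'" using lev by auto
  have "?F \<noteq> closed_cell T'"
  proof
    assume "?F = closed_cell T'"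
    then have "center T' \<in> closed_cell P" using center_in_open_cell open_cell_subset by blast
    then obtain S where S: "S \<in> \<T>" "Suc n \<le> level S" "center T' \<in> closed_cell S" using P(3) by blast
    then have "S \<noteq> T'" by (auto simp: n_def)
    then show False using mesh_open_closed_disjoint[of T' S] S mesh center_in_open_cell by blast
  qed
  then have F': "?F \<in> vefs T'" using F x TP by (auto simp: vefs_def)
  have "?f \<noteq> closed_cell T"
    using mesh_open_closed_disjoint[OF mesh \<open>T \<noteq> T'\<close>] center_in_open_cell[of T] open_cell_subset[of T] by blast
  then have f': "?f \<in> vefs T" using f x by (auto simp: vefs_def)
  show ?thesis
  proof (cases "?f \<in> vefs T'")
    case True
    then have "?f face_of closed_cell T'" by (simp add: vefs_def)
    then have "?f face_of ?F" by (rule face_of_subset) (use TP in auto)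
    then have "?f face_of closed_cell P" using F face_of_trans by blast
    then show ?thesis
      using vertex_local_dof[OF q P(1,2) T' \<sigma>(1), of ?f] x by blast
  next
    case False
    have g: "fst \<sigma> = smallest_face T (snd \<sigma>)" using \<sigma> by (simp add: local_dofs_iff)
    have gf: "smallest_face T (snd \<sigma>) \<subseteq> ?f" using smallest_face_subset[OF f x] .
    then have "smallest_face T (snd \<sigma>) \<noteq> closed_cell T" using \<open>?f \<noteq> closed_cell T\<close> by blast
    then have "fst \<sigma> \<in> vefs T"
      unfolding g vefs_def using smallest_face_face_of[of "snd \<sigma>" T] mem_smallest_face x by blast
    moreover have "?f \<subset> ?F" using TP F' False by auto
    ultimately have "owner \<A> T (fst \<sigma>) T' ?F"
      using T F' f' False gf g by (simp add: owner_def Let_def)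
    then show ?thesis by blast
  qed
qed

end

section \<open>Interpolation of polynomials on children\<close>

lemma lag_poly:
  assumes "q \<ge> 1" "a \<in> grid q"
  obtains p where "degree p \<le> q" "\<And>s. poly p s = lag q a (\<alpha> * s + \<beta>)"
proof
  let ?p = "\<Prod>t\<in>grid q - {a}. smult (1 / (a - t)) [:\<beta> - t, \<alpha>:]"
  have "degree ?p \<le> (\<Sum>t\<in>grid q - {a}. degree (smult (1 / (a - t)) [:\<beta> - t, \<alpha>:]))"
    by (rule degree_prod_sum_le[unfolded o_def]) simp
  also have "\<dots> \<le> (\<Sum>t\<in>grid q - {a}. 1)"
    by (rule sum_mono) (auto intro: order.trans[OF degree_smult_le])
  also have "\<dots> = q" using assms by (simp add: card_grid)
  finally show "degree ?p \<le> q" .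
  show "poly ?p s = lag q a (\<alpha> * s + \<beta>)" for s
    unfolding lag_def poly_prod by (rule prod.cong) (simp_all add: add_divide_distrib diff_divide_distrib)
qed

lemma poly_interpolation:
  assumes "q \<ge> 1" "degree p \<le> q"
  shows "poly p s = (\<Sum>t\<in>grid q. poly p t * lag q t s)"
proof -
  have "\<exists>l. degree l \<le> q \<and> (\<forall>s. poly l s = lag q t s)" if "t \<in> grid q" for t
    using lag_poly[OF assms(1) that, of 1 0] by auto
  then obtain l where l: "\<And>t. t \<in> grid q \<Longrightarrow> degree (l t) \<le> q" "\<And>t s. t \<in> grid q \<Longrightarrow> poly (l t) s = lag q t s"
    by metis
  define r where "r = (\<Sum>t\<in>grid q. smult (poly p t) (l t))"
  have r: "poly r s = (\<Sum>t\<in>grid q. poly p t * lag q t s)" for s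
    by (simp add: r_def poly_sum l)
  have "p = r"
  proof (rule poly_eqI_degree[of "grid q"])
    fix x assume x: "x \<in> grid q"
    have "poly r x = (\<Sum>t\<in>grid q. if t = x then poly p t else 0)"
      unfolding r by (rule sum.cong) (auto simp: lag_self lag_other x)
    then show "poly p x = poly r x" using x by simp
  next
    show "degree p < card (grid q)" using assms by (simp add: card_grid)
    have "degree r \<le> q" unfolding r_def
      by (rule degree_sum_le) (auto intro: order.trans[OF degree_smult_le] l)
    then show "degree r < card (grid q)" using assms by (simp add: card_grid)
  qed
  then have "poly p s = poly r s" by (rule arg_cong)
  then show ?thesis unfolding r .
qed

text \<open>A polynomial of degree at most q is reproduced by interpolation on any q + 1 points, here on
  the grid of one half of the unit interval.\<close>

lemma lag_reproduce:
  assumes "q \<ge> 1" "a \<in> grid q"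
  shows "lag q a ((s + c) / 2) = (\<Sum>t\<in>grid q. lag q a ((t + c) / 2) * lag q t s)"
proof -
  obtain p where p: "degree p \<le> q" "\<And>s. poly p s = lag q a (1/2 * s + c/2)"
    using lag_poly[OF assms, of "1/2" "c/2"] by metis
  have e: "1/2 * s + c/2 = (s + c) / 2" for s :: real by (simp add: field_simps)
  show ?thesis using poly_interpolation[OF assms(1) p(1), of s] unfolding p(2) e .
qed

lemma sum_nodes:
  assumes "invertible (jac T)"
  shows "(\<Sum>y\<in>nodes q T. f y) = (\<Sum>g\<in>PiE UNIV (\<lambda>_. grid q). f (cell_map T (\<chi> i. g i)))"
proof (rule sum.reindex_bij_betw[symmetric])
  show "bij_betw (\<lambda>g. cell_map T (\<chi> i. g i)) (PiE UNIV (\<lambda>_. grid q)) (nodes q T)"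
  proof (rule bij_betw_byWitness[of _ "\<lambda>y i. ref_coord T y $ i"])
    show "\<forall>y\<in>nodes q T. cell_map T (\<chi> i. ref_coord T y $ i) = y"
      by (simp add: cell_map_ref_coord[OF assms])
    show "(\<lambda>y i. ref_coord T y $ i) ` nodes q T \<subseteq> PiE UNIV (\<lambda>_. grid q)"
      using nodes_iff[OF assms] by auto
    show "(\<lambda>g. cell_map T (\<chi> i. g i)) ` PiE UNIV (\<lambda>_. grid q) \<subseteq> nodes q T"
      unfolding nodes_eq by (intro image_subsetI imageI) (auto simp: PiE_iff)
  qed (simp add: ref_coord_cell_map[OF assms])
qed

lemma child_ref_coord:
  assumes "invertible (jac P)" "invertible (jac T)" "\<And>\<zeta>. cell_map T \<zeta> = cell_map P ((1/2) *\<^sub>R (\<zeta> + c))"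
  shows "ref_coord P z = (1/2) *\<^sub>R (ref_coord T z + c)"
proof -
  have "cell_map P (ref_coord P z) = cell_map P ((1/2) *\<^sub>R (ref_coord T z + c))"
    using assms(3)[of "ref_coord T z"] by (simp add: cell_map_ref_coord[OF assms(1)] cell_map_ref_coord[OF assms(2)])
  then show ?thesis by (simp add: cell_map_eq_iff[OF assms(1)])
qed

lemma shape_child:
  assumes q: "q \<ge> 1" and inv: "invertible (jac P)" and T: "T \<in> children P" and w: "w \<in> nodes q P"
  shows "shape q P w z = (\<Sum>y\<in>nodes q T. shape q P w y * shape q T y z)"
proof -
  obtain c where c: "\<And>\<zeta>. cell_map T \<zeta> = cell_map P ((1/2) *\<^sub>R (\<zeta> + c))"
    using childE[OF T] by metis
  have invT: "invertible (jac T)" using child_invertible[OF T inv] .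
  let ?w = "ref_coord P w" and ?z = "ref_coord T z"
  have wg: "?w $ i \<in> grid q" for i using w nodes_iff[OF inv] by blast
  have P: "ref_coord P x $ i = (ref_coord T x $ i + c $ i) / 2" for x i
    unfolding child_ref_coord[OF inv invT c] by simp
  have "shape q P w z = (\<Prod>i\<in>UNIV. \<Sum>t\<in>grid q. lag q (?w $ i) ((t + c $ i) / 2) * lag q t (?z $ i))"
    unfolding shape_eq_prod_lag P[of z] by (rule prod.cong[OF refl lag_reproduce[OF q wg]])
  also have "\<dots> = (\<Sum>g\<in>PiE UNIV (\<lambda>_. grid q). \<Prod>i\<in>UNIV. lag q (?w $ i) ((g i + c $ i) / 2) * lag q (g i) (?z $ i))"
    by (rule prod_sum_PiE) auto
  also have "\<dots> = (\<Sum>y\<in>nodes q T. shape q P w y * shape q T y z)"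
    unfolding sum_nodes[OF invT] shape_eq_prod_lag P prod.distrib
    by (simp add: ref_coord_cell_map[OF invT])
  finally show ?thesis .
qed

text \<open>Interpolating the polynomial of a cell on the nodes of one of its children gives the same polynomial back, also outside of the child.\<close>

lemma poly_ext_child:
  assumes "q \<ge> 1" "invertible (jac P)" "T \<in> children P"
  shows "poly_ext q P v z = (\<Sum>y\<in>nodes q T. poly_ext q P v y * shape q T y z)"
proof -
  have "poly_ext q P v z = (\<Sum>\<sigma>\<in>local_dofs q P. \<Sum>y\<in>nodes q T. v \<sigma> * (shape q P (snd \<sigma>) y * shape q T y z))"
    unfolding poly_ext_def
  proof (rule sum.cong[OF refl])
    fix \<sigma> assume "\<sigma> \<in> local_dofs q P"
    then have "snd \<sigma> \<in> nodes q P" by (simp add: local_dofs_iff)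
    from shape_child[OF assms this, of z]
    show "v \<sigma> * shape q P (snd \<sigma>) z = (\<Sum>y\<in>nodes q T. v \<sigma> * (shape q P (snd \<sigma>) y * shape q T y z))"
      by (simp add: sum_distrib_left)
  qed
  also have "\<dots> = (\<Sum>y\<in>nodes q T. \<Sum>\<sigma>\<in>local_dofs q P. v \<sigma> * (shape q P (snd \<sigma>) y * shape q T y z))"
    by (rule sum.swap)
  also have "\<dots> = (\<Sum>y\<in>nodes q T. poly_ext q P v y * shape q T y z)"
    by (simp add: poly_ext_def sum_distrib_right mult.assoc)
  finally show ?thesis .
qed

lemma poly_ext_eq_sum_nodes: "poly_ext q T v z = (\<Sum>y\<in>nodes q T. v (smallest_face T y, y) * shape q T y z)"
proof -
  have "(\<Sum>y\<in>nodes q T. v (smallest_face T y, y) * shape q T y z)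
      = (\<Sum>\<sigma>\<in>local_dofs q T. v (smallest_face T (snd \<sigma>), snd \<sigma>) * shape q T (snd \<sigma>) z)"
    by (rule sum.reindex_bij_betw[OF bij_local_dofs, of "\<lambda>y. v (smallest_face T y, y) * shape q T y z" q T, symmetric])
  also have "\<dots> = poly_ext q T v z"
    unfolding poly_ext_def
  proof (rule sum.cong[OF refl])
    fix \<sigma> assume "\<sigma> \<in> local_dofs q T"
    then have "(smallest_face T (snd \<sigma>), snd \<sigma>) = \<sigma>" by (simp add: local_dofs_iff prod_eq_iff)
    then show "v (smallest_face T (snd \<sigma>), snd \<sigma>) * shape q T (snd \<sigma>) z = v \<sigma> * shape q T (snd \<sigma>) z" by simp
  qed
  finally show ?thesis ..
qed

section \<open>Hanging constraints\<close>

locale active_forest = forest art \<C> \<T> for art :: "(real^'d::finite) set" and \<C> \<T> +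
  fixes q :: nat and \<A> :: "'d cell set"
  assumes q: "q \<ge> 1" and sub: "\<A> \<subseteq> \<T>"
begin

abbreviation "master_cell \<sigma> \<equiv> fst (dof_owner q \<A> \<sigma>)"

lemma hanging_owner:
  assumes "\<sigma> \<in> hanging_dofs q \<A>"
  obtains T where "T \<in> \<A>" "\<sigma> \<in> local_dofs q T"
    "owner \<A> T (fst \<sigma>) (master_cell \<sigma>) (snd (dof_owner q \<A> \<sigma>))"
proof -
  let ?Q = "\<lambda>(T', f'). \<exists>T\<in>\<A>. \<sigma> \<in> local_dofs q T \<and> owner \<A> T (fst \<sigma>) T' f'"
  obtain T where T: "T \<in> \<A>" "\<sigma> \<in> local_dofs q T" using assms unfolding hanging_dofs_def dofs_def by blast
  then obtain T' f' where "owner \<A> T (fst \<sigma>) T' f'" using assms unfolding hanging_dofs_def by blast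
  then have "?Q (T', f')" using T by blast
  then have "?Q (dof_owner q \<A> \<sigma>)" unfolding dof_owner_def by (rule someI)
  then show ?thesis using that unfolding case_prod_beta by blast
qed

lemma snd_mem_fst: "\<sigma> \<in> local_dofs q T \<Longrightarrow> snd \<sigma> \<in> fst \<sigma>"
  by (simp add: local_dofs_iff mem_smallest_face)

lemma master_cell_mem:
  assumes "\<sigma> \<in> hanging_dofs q \<A>"
  shows "master_cell \<sigma> \<in> \<A>" "snd \<sigma> \<in> closed_cell (master_cell \<sigma>)" "snd \<sigma> \<in> snd (dof_owner q \<A> \<sigma>)"
    "snd (dof_owner q \<A> \<sigma>) face_of closed_cell (master_cell \<sigma>)"
proof -
  obtain T where T: "T \<in> \<A>" "\<sigma> \<in> local_dofs q T"
    "owner \<A> T (fst \<sigma>) (master_cell \<sigma>) (snd (dof_owner q \<A> \<sigma>))"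
    by (rule hanging_owner[OF assms])
  have "T \<in> \<T>" using T sub by blast
  note o = owner_level[OF T(3) this sub]
  show "master_cell \<sigma> \<in> \<A>" "snd (dof_owner q \<A> \<sigma>) face_of closed_cell (master_cell \<sigma>)" by (fact o)+
  show "snd \<sigma> \<in> closed_cell (master_cell \<sigma>)" "snd \<sigma> \<in> snd (dof_owner q \<A> \<sigma>)"
    using o snd_mem_fst[OF T(2)] by blast+
qed

text \<open>The level of the master cell is the same seen from any active cell T around the degree of
  freedom, although the owner was chosen for one of them: all the cells involved contain its node,
  so a longer range of levels would violate the balance.\<close>

lemma hanging_level:
  assumes \<sigma>: "\<sigma> \<in> hanging_dofs q \<A>" and T: "T \<in> \<A>" "\<sigma> \<in> local_dofs q T"
  shows "level T = Suc (level (master_cell \<sigma>))"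
proof -
  obtain S where S: "S \<in> \<A>" "\<sigma> \<in> local_dofs q S"
    "owner \<A> S (fst \<sigma>) (master_cell \<sigma>) (snd (dof_owner q \<A> \<sigma>))"
    by (rule hanging_owner[OF \<sigma>])
  obtain T' f' where own: "owner \<A> T (fst \<sigma>) T' f'" using \<sigma> T by (auto simp: hanging_dofs_def)
  have mesh: "S \<in> \<T>" "T \<in> \<T>" using S T sub by auto
  have lS: "level S = Suc (level (master_cell \<sigma>))" using owner_level(2)[OF S(3) mesh(1) sub] .
  have lT: "level T = Suc (level T')" and T': "T' \<in> \<T>" "fst \<sigma> \<subseteq> closed_cell T'"
    using owner_level[OF own mesh(2) sub] sub by auto
  have x: "snd \<sigma> \<in> closed_cell T'" using T' snd_mem_fst[OF T(2)] by blast
  have m: "master_cell \<sigma> \<in> \<T>" using master_cell_mem[OF \<sigma>] sub by blast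
  have "level T \<le> Suc (level (master_cell \<sigma>))"
    using level_le_Suc[OF mesh(2) m local_dof_mem[OF T(2)] master_cell_mem(2)[OF \<sigma>]] .
  moreover have "level S \<le> Suc (level T')"
    using level_le_Suc[OF mesh(1) T'(1) local_dof_mem[OF S(2)] x] .
  ultimately show ?thesis using lS lT by linarith
qed

lemma masters_smallest_face:
  assumes "\<sigma> \<in> hanging_dofs q \<A>" "\<tau> \<in> masters q \<A> \<sigma>"
  shows "\<tau> \<in> local_dofs q (master_cell \<sigma>)" "snd \<tau> \<in> smallest_face (master_cell \<sigma>) (snd \<sigma>)"
proof -
  show t: "\<tau> \<in> local_dofs q (master_cell \<sigma>)" using assms by (simp add: masters_def)
  show "snd \<tau> \<in> smallest_face (master_cell \<sigma>) (snd \<sigma>)"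
    using shape_nonzero_smallest_face[OF mesh_invertible q _ master_cell_mem(2)[OF assms(1)]]
      master_cell_mem(1)[OF assms(1)] sub assms(2) t
    by (auto simp: masters_def hanging_coeff_def local_dofs_iff)
qed

text \<open>The masters are the degrees of freedom of the master cell with a nonzero coefficient, since
  such degrees of freedom lie on the smallest face of the node and hence on the owner VEF. The
  hanging constraint thus prescribes the value of the polynomial of the master cell.\<close>

lemma sum_masters:
  assumes "\<sigma> \<in> hanging_dofs q \<A>"
  shows "(\<Sum>\<tau>\<in>masters q \<A> \<sigma>. hanging_coeff q \<A> \<sigma> \<tau> * v \<tau>) = poly_ext q (master_cell \<sigma>) v (snd \<sigma>)"
proof -
  have inv: "invertible (jac (master_cell \<sigma>))"
    using mesh_invertible master_cell_mem(1)[OF assms] sub by blast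
  have "hanging_coeff q \<A> \<sigma> \<tau> = 0" if "\<tau> \<in> local_dofs q (master_cell \<sigma>) - masters q \<A> \<sigma>" for \<tau>
  proof (rule ccontr)
    assume n: "hanging_coeff q \<A> \<sigma> \<tau> \<noteq> 0"
    then have "snd \<tau> \<in> smallest_face (master_cell \<sigma>) (snd \<sigma>)"
      using shape_nonzero_smallest_face[OF inv q _ master_cell_mem(2)[OF assms]] that
      by (auto simp: hanging_coeff_def local_dofs_iff)
    then have "snd \<tau> \<in> snd (dof_owner q \<A> \<sigma>)"
      using smallest_face_subset[OF master_cell_mem(4,3)[OF assms]] by blast
    then show False using that n by (simp add: masters_def)
  qed
  then have "(\<Sum>\<tau>\<in>masters q \<A> \<sigma>. hanging_coeff q \<A> \<sigma> \<tau> * v \<tau>)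
      = (\<Sum>\<tau>\<in>local_dofs q (master_cell \<sigma>). hanging_coeff q \<A> \<sigma> \<tau> * v \<tau>)"
    by (intro sum.mono_neutral_left) (auto simp: masters_def)
  then show ?thesis by (simp add: poly_ext_def hanging_coeff_def mult.commute)
qed

text \<open>There are no chains of constraints. Let T be a fine cell with a hanging degree of freedom, P its
  parent and T' the master cell. A master lies on the common face of P and T', where P has been
  refined. If it were hanging, then it would touch a cell coarser than T', whose level differs by
  two from that of a fine cell in P at the same point.\<close>

lemma masters_free:
  assumes \<sigma>: "\<sigma> \<in> hanging_dofs q \<A>" and \<tau>: "\<tau> \<in> masters q \<A> \<sigma>"
  shows "\<tau> \<in> free_dofs q \<A>"
proof -
  let ?T' = "master_cell \<sigma>"
  obtain T where T: "T \<in> \<A>" "\<sigma> \<in> local_dofs q T"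
    using hanging_owner[OF \<sigma>] by metis
  have lT: "level T = Suc (level ?T')" by (rule hanging_level[OF \<sigma> T])
  have mesh: "T \<in> \<T>" "?T' \<in> \<T>" using T sub master_cell_mem[OF \<sigma>] by auto
  obtain P where P: "P \<in> unif \<C> (level ?T')" "T \<in> children P"
    "\<And>y. y \<in> closed_cell P \<Longrightarrow> \<exists>S\<in>\<T>. Suc (level ?T') \<le> level S \<and> y \<in> closed_cell S"
    using parentE[OF mesh(1) lT] by metis
  have xP: "snd \<sigma> \<in> closed_cell P"
    using child_closed_subset[OF P(2)] local_dof_mem[OF T(2)] by blast
  have "snd \<tau> \<in> smallest_face P (snd \<sigma>)"
    using masters_smallest_face(2)[OF \<sigma> \<tau>]
      unif_smallest_face_eq[OF P(1) mesh_unif[OF mesh(2)] xP master_cell_mem(2)[OF \<sigma>]] by simp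
  then have "snd \<tau> \<in> closed_cell P" using smallest_face_face_of[OF xP] face_of_imp_subset by blast
  then obtain S where S: "S \<in> \<T>" "Suc (level ?T') \<le> level S" "snd \<tau> \<in> closed_cell S" using P(3) by blast
  have \<tau>T: "\<tau> \<in> local_dofs q ?T'" by (rule masters_smallest_face(1)[OF \<sigma> \<tau>])
  have "\<tau> \<notin> hanging_dofs q \<A>"
  proof
    assume "\<tau> \<in> hanging_dofs q \<A>"
    then obtain T'' f'' where own: "owner \<A> ?T' (fst \<tau>) T'' f''"
      using \<tau>T master_cell_mem(1)[OF \<sigma>] by (auto simp: hanging_dofs_def)
    have "T'' \<in> \<T>" "level ?T' = Suc (level T'')" "snd \<tau> \<in> closed_cell T''"
      using owner_level[OF own mesh(2) sub] sub snd_mem_fst[OF \<tau>T] by auto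
    then show False using level_le_Suc[OF S(1) _ S(3)] S(2) by fastforce
  qed
  then show ?thesis using \<tau>T master_cell_mem(1)[OF \<sigma>] by (auto simp: free_dofs_def dofs_def)
qed

text \<open>A function of the standard space is continuous at the nodes of T on T'. If the degree of freedom
  is hanging, then its value is the one of the polynomial of some master cell, which has the level
  of T' and hence the same trace. If it is free, then some cell around it has no owner for it, and
  whatever the level of this cell is, the degree of freedom is shared with T'.\<close>

lemma poly_ext_coarse_at_fine_node:
  assumes v: "v \<in> V_std q \<A>" and T: "T \<in> \<A>" "T' \<in> \<A>" "level T = Suc (level T')"
    and \<rho>: "\<rho> \<in> local_dofs q T" "snd \<rho> \<in> closed_cell T'"
  shows "poly_ext q T' v (snd \<rho>) = v \<rho>"
proof -
  have mesh: "T \<in> \<T>" "T' \<in> \<T>" using T sub by auto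
  show ?thesis
  proof (cases "\<rho> \<in> hanging_dofs q \<A>")
    case True
    let ?S = "master_cell \<rho>"
    have "level ?S = level T'" using hanging_level[OF True T(1) \<rho>(1)] T(3) by simp
    then have S: "?S \<in> unif \<C> (level T')" using mesh_unif[of ?S] master_cell_mem(1)[OF True] sub by auto
    have "v \<rho> = poly_ext q ?S v (snd \<rho>)" using v True sum_masters[OF True] by (simp add: V_std_def)
    then show ?thesis
      using unif_ext_eq[OF q S mesh_unif[OF mesh(2)] master_cell_mem(2)[OF True] \<rho>(2)] by simp
  next
    case False
    then obtain T1 where T1: "T1 \<in> \<A>" "\<rho> \<in> local_dofs q T1" "\<not> (\<exists>S f'. owner \<A> T1 (fst \<rho>) S f')"
      using \<rho> T(1) unfolding hanging_dofs_def dofs_def by blast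
    have m1: "T1 \<in> \<T>" using T1 sub by blast
    have "level T1 \<le> Suc (level T')"
      by (rule level_le_Suc[OF m1 mesh(2) local_dof_mem[OF T1(2)] \<rho>(2)])
    moreover have "level T \<le> Suc (level T1)"
      by (rule level_le_Suc[OF mesh(1) m1 local_dof_mem[OF \<rho>(1)] local_dof_mem[OF T1(2)]])
    ultimately have "level T1 = level T' \<or> level T1 = Suc (level T')" using T(3) by linarith
    then have "\<rho> \<in> local_dofs q T'"
    proof
      assume "level T1 = level T'"
      then show ?thesis using unif_local_dof[OF q _ _ T1(2) \<rho>(2)] mesh_unif[OF m1] mesh_unif[OF mesh(2)] by metis
    next
      assume "level T1 = Suc (level T')"
      then show ?thesis using coarser_neighbour_dof[OF q T1(1) T(2) sub _ T1(2) \<rho>(2)] T1(3) by blast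
    qed
    then show ?thesis by (rule poly_ext_node[OF mesh_invertible[OF mesh(2)]])
  qed
qed

text \<open>The value at a master is determined by the fine cell T, even if the master does not lie on T:
  it is the value there of the extended polynomial of T. Let P be the parent of T and m the
  smallest face of the hanging node, which is the same in P and in the master cell T'. On m, the
  polynomials of P and T' agree. Interpolate the polynomial of P on the nodes of T: only nodes on m
  contribute to the value at a point of m, as T touches m and the coordinates frozen on m are end points in T, too, and
  at these nodes the polynomial of T' takes the nodal values of T.\<close>

lemma master_value:
  assumes v: "v \<in> V_std q \<A>" and \<sigma>: "\<sigma> \<in> hanging_dofs q \<A>" and T: "T \<in> \<A>" "\<sigma> \<in> local_dofs q T"
    and \<tau>: "\<tau> \<in> masters q \<A> \<sigma>"
  shows "v \<tau> = poly_ext q T v (snd \<tau>)"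
proof -
  let ?T' = "master_cell \<sigma>" and ?x = "snd \<sigma>" and ?y = "snd \<tau>"
  have lT: "level T = Suc (level ?T')" by (rule hanging_level[OF \<sigma> T])
  have mesh: "T \<in> \<T>" "?T' \<in> \<T>" using T sub master_cell_mem[OF \<sigma>] by auto
  obtain P where P: "P \<in> unif \<C> (level ?T')" "T \<in> children P"
    using parentE[OF mesh(1) lT] by metis
  note T'u = mesh_unif[OF mesh(2)]
  have inv: "invertible (jac P)" "invertible (jac T)" using unif_invertible P mesh_invertible mesh by blast+
  have xP: "?x \<in> closed_cell P"
    using child_closed_subset[OF P(2)] local_dof_mem[OF T(2)] by blast
  have car: "smallest_face P ?x = smallest_face ?T' ?x"
    by (rule unif_smallest_face_eq[OF P(1) T'u xP master_cell_mem(2)[OF \<sigma>]])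
  have carsub: "smallest_face P ?x \<subseteq> closed_cell P" "smallest_face P ?x \<subseteq> closed_cell ?T'"
    using smallest_face_face_of[OF xP] smallest_face_face_of[OF master_cell_mem(2)[OF \<sigma>]] car face_of_imp_subset by auto
  have y: "?y \<in> smallest_face P ?x" using masters_smallest_face(2)[OF \<sigma> \<tau>] car by simp
  have "\<tau> \<in> local_dofs q P"
    using unif_local_dof[OF q T'u P(1) masters_smallest_face(1)[OF \<sigma> \<tau>]] y carsub by blast
  then have "v \<tau> = poly_ext q P v ?y" by (simp add: poly_ext_node[OF inv(1)])
  also have "\<dots> = (\<Sum>z\<in>nodes q T. poly_ext q P v z * shape q T z ?y)"
    by (rule poly_ext_child[OF q inv(1) P(2)])
  also have "\<dots> = (\<Sum>z\<in>nodes q T. v (smallest_face T z, z) * shape q T z ?y)"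
  proof (rule sum.cong[OF refl])
    fix z assume z: "z \<in> nodes q T"
    show "poly_ext q P v z * shape q T z ?y = v (smallest_face T z, z) * shape q T z ?y"
    proof (cases "shape q T z ?y = 0")
      case False
      have "z \<in> smallest_face P ?x"
      proof -
        obtain c where c: "\<And>i. c $ i \<in> {0, 1}" "\<And>\<zeta>. cell_map T \<zeta> = cell_map P ((1/2) *\<^sub>R (\<zeta> + c))"
          using childE[OF P(2)] by metis
        have rP: "ref_coord P w $ i = (ref_coord T w $ i + c $ i) / 2" for w i
          unfolding child_ref_coord[OF inv c(2)] by simp
        let ?p = "ref_coord P ?x"
        have p: "?p \<in> cbox 0 1" "cell_map P ?p = ?x"
          using xP by (simp_all add: mem_closed_cell_iff[OF inv(1)] cell_map_ref_coord[OF inv(1)])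
        have carp: "smallest_face P ?x = cell_map P ` subcube ?p"
          using smallest_face_eq[OF inv(1) p(1)] p(2) by simp
        have yp: "ref_coord P ?y \<in> subcube ?p"
          using y carp ref_coord_cell_map[OF inv(1)] by auto
        have xT: "0 \<le> ref_coord T ?x $ i \<and> ref_coord T ?x $ i \<le> 1" for i
          using local_dof_mem[OF T(2)] by (simp add: mem_closed_cell_iff[OF inv(2)] mem_cube_iff)
        have zP: "z \<in> closed_cell P" using z nodes_subset child_closed_subset[OF P(2)] by blast
        have "ref_coord P z $ i = ?p $ i" if pi: "?p $ i \<in> {0, 1}" for i
        proof -
          have ci: "c $ i = ?p $ i" using pi c(1)[of i] xT[of i] rP[of ?x i] by auto
          have "ref_coord P ?y $ i = ?p $ i" using yp pi unfolding subcube_def by blast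
          then have "ref_coord T ?y $ i = ?p $ i" using rP[of ?y i] ci by simp
          moreover have "lag q (ref_coord T z $ i) (ref_coord T ?y $ i) \<noteq> 0"
            using False unfolding shape_eq_prod_lag by (metis UNIV_I finite prod_zero)
          ultimately have "ref_coord T z $ i = ?p $ i"
            using lag_other[OF grid_ends[OF q pi]] by metis
          then show ?thesis using rP[of z i] ci by simp
        qed
        then have "ref_coord P z \<in> subcube ?p"
          using zP by (simp add: subcube_def mem_closed_cell_iff[OF inv(1)])
        then have "cell_map P (ref_coord P z) \<in> smallest_face P ?x" unfolding carp by (rule imageI)
        then show ?thesis by (simp add: cell_map_ref_coord[OF inv(1)])
      qed
      then have zz: "z \<in> closed_cell P" "z \<in> closed_cell ?T'" using carsub by blast+
      have "poly_ext q P v z = poly_ext q ?T' v z" by (rule unif_ext_eq[OF q P(1) T'u zz])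
      also have "\<dots> = v (smallest_face T z, z)"
        using poly_ext_coarse_at_fine_node[OF v T(1) master_cell_mem(1)[OF \<sigma>] lT, of "(smallest_face T z, z)"] z zz
        by (simp add: local_dofs_iff)
      finally show ?thesis by simp
    qed simp
  qed
  also have "\<dots> = poly_ext q T v ?y" by (rule poly_ext_eq_sum_nodes[symmetric])
  finally show ?thesis .
qed

end

section \<open>The root cell map\<close>

text \<open>The best root exists and is unique: among the candidates at minimal distance, take the one with the largest index.\<close>

lemma best_root_mem:
  assumes "finite S" "S \<noteq> {}" "inj_on idx S"
  shows "best_root idx T S \<in> S"
proof -
  let ?m = "Min ((\<lambda>K. rel_distance K T) ` S)"
  define S' where "S' = {K \<in> S. rel_distance K T = ?m}"
  have min: "?m \<le> rel_distance K T" if "K \<in> S" for K using assms that by simp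
  have "?m \<in> (\<lambda>K. rel_distance K T) ` S" using assms by (intro Min_in) auto
  then have S': "finite S'" "S' \<noteq> {}" using assms(1) unfolding S'_def by auto
  have "Max (idx ` S') \<in> idx ` S'" using S' by (intro Max_in) auto
  then obtain K where K: "K \<in> S'" "idx K = Max (idx ` S')" by auto
  have Kmax: "idx K' \<le> idx K" if "K' \<in> S'" for K' using S' that K by simp
  let ?Q = "\<lambda>K. K \<in> S \<and> (\<forall>K'\<in>S. rel_distance K T < rel_distance K' T \<or>
      (rel_distance K T = rel_distance K' T \<and> idx K' \<le> idx K))"
  have "?Q K"
    using K Kmax min by (force simp: S'_def less_le)
  moreover have "L = K" if L: "?Q L" for L
  proof -
    have "rel_distance L T = rel_distance K T \<and> idx K = idx L"
    proof -
      have "rel_distance L T < rel_distance K T \<or> (rel_distance L T = rel_distance K T \<and> idx K \<le> idx L)"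
        and "rel_distance K T < rel_distance L T \<or> (rel_distance K T = rel_distance L T \<and> idx L \<le> idx K)"
        using L \<open>?Q K\<close> by blast+
      then show ?thesis by force
    qed
    then show ?thesis using L \<open>?Q K\<close> assms(3) by (auto dest: inj_onD)
  qed
  ultimately have "?Q (THE K. ?Q K)" by (rule theI)
  then show ?thesis unfolding best_root_def by blast
qed

lemma aggregate_well:
  assumes "finite \<W>" "inj_on idx \<W>"
  shows "aggregate idx \<Omega> \<W> \<I> n T = Some L \<Longrightarrow> L \<in> \<W>"
proof (induction n arbitrary: T L)
  case 0
  then show ?case by (auto split: if_splits)
next
  case (Suc n)
  let ?cand = "{L. \<exists>T'. aggregate idx \<Omega> \<W> \<I> n T' = Some L \<and> facet_neighbours \<Omega> T T'}"
  have cand: "?cand \<subseteq> \<W>" using Suc.IH by blast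
  show ?case
  proof (cases "aggregate idx \<Omega> \<W> \<I> n T = None \<and> T \<in> \<I> \<and> ?cand \<noteq> {}")
    case True
    then have "L = best_root idx T ?cand" using Suc.prems by (simp add: Let_def)
    moreover have "best_root idx T ?cand \<in> ?cand"
      using True cand assms by (intro best_root_mem) (auto intro: finite_subset inj_on_subset)
    ultimately show ?thesis using cand by auto
  next
    case False
    then have "aggregate idx \<Omega> \<W> \<I> n T = Some L" using Suc.prems by (auto simp: Let_def split: if_splits)
    then show ?thesis by (rule Suc.IH)
  qed
qed

lemma root_cell_map_well:
  assumes "root_cell_map idx \<Omega> \<W> \<I> R" "finite \<W>" "inj_on idx \<W>" "T \<in> \<W> \<union> \<I>"
  shows "R T \<in> \<W>"
  using assms aggregate_well[OF assms(2,3)] unfolding root_cell_map_def by metis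

section \<open>The aggregated space\<close>

lemma continuous_on_shape: "continuous_on S (shape q T y)"
  unfolding shape_def divide_inverse by (intro continuous_intros continuous_on_ref_coord)

text \<open>A bound for one interpolation step on the mesh: evaluating the polynomial of a cell anywhere on the mesh, even far from the cell, multiplies the maximum of the nodal values by at most this constant.\<close>

lemma (in forest) lebesgue_constant:
  obtains \<Lambda> where "\<Lambda> \<ge> 1"
    "\<And>T z. T \<in> \<T> \<Longrightarrow> z \<in> (\<Union>T\<in>\<T>. closed_cell T) \<Longrightarrow> (\<Sum>\<sigma>\<in>local_dofs q T. \<bar>shape q T (snd \<sigma>) z\<bar>) \<le> \<Lambda>"
proof -
  let ?U = "\<Union>T\<in>\<T>. closed_cell T"
  have U: "compact ?U" by (intro compact_UN finite_mesh compact_closed_cell) 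
  have "\<exists>b. \<forall>z\<in>?U. (\<Sum>\<sigma>\<in>local_dofs q T. \<bar>shape q T (snd \<sigma>) z\<bar>) \<le> b" for T
  proof -
    have "continuous_on ?U (\<lambda>z. \<Sum>\<sigma>\<in>local_dofs q T. \<bar>shape q T (snd \<sigma>) z\<bar>)"
      by (intro continuous_intros continuous_on_shape)
    then have "bounded ((\<lambda>z. \<Sum>\<sigma>\<in>local_dofs q T. \<bar>shape q T (snd \<sigma>) z\<bar>) ` ?U)"
      using U compact_continuous_image compact_imp_bounded by blast
    then obtain b where "\<forall>z\<in>?U. \<bar>\<Sum>\<sigma>\<in>local_dofs q T. \<bar>shape q T (snd \<sigma>) z\<bar>\<bar> \<le> b"
      unfolding bounded_iff by auto
    then show ?thesis by (meson abs_le_D1)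
  qed
  then obtain b where b: "\<And>T z. z \<in> ?U \<Longrightarrow> (\<Sum>\<sigma>\<in>local_dofs q T. \<bar>shape q T (snd \<sigma>) z\<bar>) \<le> b T"
    by metis
  let ?L = "1 + (\<Sum>T\<in>\<T>. \<bar>b T\<bar>)"
  show ?thesis
  proof (rule that[of ?L])
    show "1 \<le> ?L" by (simp add: sum_nonneg)
    fix T z assume "T \<in> \<T>" "z \<in> ?U"
    then have "(\<Sum>\<sigma>\<in>local_dofs q T. \<bar>shape q T (snd \<sigma>) z\<bar>) \<le> \<bar>b T\<bar>" using b[of z T] by simp
    also have "\<dots> \<le> (\<Sum>T\<in>\<T>. \<bar>b T\<bar>)" using \<open>T \<in> \<T>\<close> finite_mesh by (intro member_le_sum) auto
    finally show "(\<Sum>\<sigma>\<in>local_dofs q T. \<bar>shape q T (snd \<sigma>) z\<bar>) \<le> ?L" by simp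
  qed
qed

text \<open>The discrete data that vary with the cut: the active and well-posed cells, and the root cell of each ill-posed free degree of freedom. The Lebesgue constant \<Lambda> belongs to the whole mesh, so that bounds in terms of it are uniform in these data.\<close>

locale aggregated = active_forest art \<C> \<T> q \<A> for art :: "(real^'d::finite) set" and \<C> \<T> q \<A> +
  fixes \<W> :: "'d cell set" and K :: "'d dof \<Rightarrow> 'd cell" and \<Lambda> :: real
  assumes well_sub: "\<W> \<subseteq> \<A>"
    and root_well: "\<And>\<sigma>. \<sigma> \<in> ill_free_dofs q \<A> \<W> \<Longrightarrow> K \<sigma> \<in> \<W>"
    and L1: "\<Lambda> \<ge> 1"
    and L: "\<And>T z. T \<in> \<T> \<Longrightarrow> z \<in> (\<Union>T\<in>\<T>. closed_cell T) \<Longrightarrow> (\<Sum>\<sigma>\<in>local_dofs q T. \<bar>shape q T (snd \<sigma>) z\<bar>) \<le> \<Lambda>"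
begin

abbreviation "S \<equiv> well_free_dofs q \<A> \<W>"

lemma finite_dofs: "finite (dofs q \<A>)"
  unfolding dofs_def using finite_subset[OF sub finite_mesh] by simp

lemma finite_S: "finite S"
  by (rule finite_subset[OF _ finite_dofs]) (auto simp: well_free_dofs_def free_dofs_def)

lemma dof_pos: "\<sigma> \<in> dofs q \<A> \<Longrightarrow> snd \<sigma> \<in> (\<Union>T\<in>\<T>. closed_cell T)"
  using local_dof_mem sub by (fastforce simp: dofs_def)

lemma abs_sum_shape_le:
  assumes "T \<in> \<T>" "z \<in> (\<Union>T\<in>\<T>. closed_cell T)" "D \<subseteq> local_dofs q T" "\<And>\<sigma>. \<sigma> \<in> D \<Longrightarrow> \<bar>v \<sigma>\<bar> \<le> b" "0 \<le> b"
  shows "\<bar>\<Sum>\<sigma>\<in>D. v \<sigma> * shape q T (snd \<sigma>) z\<bar> \<le> \<Lambda> * b"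
proof -
  have "\<bar>\<Sum>\<sigma>\<in>D. v \<sigma> * shape q T (snd \<sigma>) z\<bar> \<le> (\<Sum>\<sigma>\<in>D. \<bar>v \<sigma>\<bar> * \<bar>shape q T (snd \<sigma>) z\<bar>)"
    by (rule order.trans[OF sum_abs]) (simp add: abs_mult)
  also have "\<dots> \<le> (\<Sum>\<sigma>\<in>D. b * \<bar>shape q T (snd \<sigma>) z\<bar>)"
    using assms by (intro sum_mono mult_right_mono) auto
  also have "\<dots> \<le> (\<Sum>\<sigma>\<in>local_dofs q T. b * \<bar>shape q T (snd \<sigma>) z\<bar>)"
    using assms by (intro sum_mono2) auto
  also have "\<dots> = b * (\<Sum>\<sigma>\<in>local_dofs q T. \<bar>shape q T (snd \<sigma>) z\<bar>)" by (simp add: sum_distrib_left)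
  also have "\<dots> \<le> b * \<Lambda>" using assms L by (intro mult_left_mono) auto
  finally show ?thesis by (simp add: mult.commute)
qed

lemma poly_ext_abs_le:
  assumes "T \<in> \<T>" "z \<in> (\<Union>T\<in>\<T>. closed_cell T)" "\<And>\<sigma>. \<sigma> \<in> local_dofs q T \<Longrightarrow> \<bar>v \<sigma>\<bar> \<le> b" "0 \<le> b"
  shows "\<bar>poly_ext q T v z\<bar> \<le> \<Lambda> * b"
  unfolding poly_ext_def by (rule abs_sum_shape_le) (use assms in auto)

lemma masters_abs_le:
  assumes "\<sigma> \<in> hanging_dofs q \<A>" "\<And>\<tau>. \<tau> \<in> masters q \<A> \<sigma> \<Longrightarrow> \<bar>v \<tau>\<bar> \<le> b" "0 \<le> b"
  shows "\<bar>\<Sum>\<tau>\<in>masters q \<A> \<sigma>. hanging_coeff q \<A> \<sigma> \<tau> * v \<tau>\<bar> \<le> \<Lambda> * b"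
proof -
  have "\<sigma> \<in> dofs q \<A>" using assms(1) by (simp add: hanging_dofs_def)
  then have "\<bar>\<Sum>\<tau>\<in>masters q \<A> \<sigma>. v \<tau> * shape q (master_cell \<sigma>) (snd \<tau>) (snd \<sigma>)\<bar> \<le> \<Lambda> * b"
    using master_cell_mem(1)[OF assms(1)] sub dof_pos masters_smallest_face(1)[OF assms(1)] assms(2,3)
    by (intro abs_sum_shape_le) auto
  then show ?thesis by (simp add: hanging_coeff_def mult.commute)
qed

text \<open>All values on a well-posed cell are known after one step from the well-posed free ones: this is what the second clause in the definition of well-posed free degrees of freedom is for.\<close>

lemma well_local_dof:
  assumes "T \<in> \<W>" "\<sigma> \<in> local_dofs q T"
  shows "\<sigma> \<in> S \<or> (\<sigma> \<in> hanging_dofs q \<A> \<and> masters q \<A> \<sigma> \<subseteq> S)"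
proof (cases "\<sigma> \<in> hanging_dofs q \<A>")
  case True
  then have "\<sigma> \<in> well_hanging_dofs q \<A> \<W>" using assms by (auto simp: well_hanging_dofs_def)
  then show ?thesis using True masters_free[OF True] by (auto simp: well_free_dofs_def)
next
  case False
  moreover have "\<sigma> \<in> dofs q \<A>" using assms well_sub by (auto simp: dofs_def)
  ultimately show ?thesis using assms by (auto simp: well_free_dofs_def free_dofs_def)
qed

lemma V_agD:
  assumes "v \<in> V_ag q \<A> \<W> K"
  shows "v \<in> V_std q \<A>"
    "\<sigma> \<notin> dofs q \<A> \<Longrightarrow> v \<sigma> = 0"
    "\<sigma> \<in> hanging_dofs q \<A> \<Longrightarrow> v \<sigma> = (\<Sum>\<tau>\<in>masters q \<A> \<sigma>. hanging_coeff q \<A> \<sigma> \<tau> * v \<tau>)"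
    "\<sigma> \<in> ill_free_dofs q \<A> \<W> \<Longrightarrow> v \<sigma> = poly_ext q (K \<sigma>) v (snd \<sigma>)"
proof -
  show "v \<in> V_std q \<A>" using assms by (simp add: V_ag_def)
  show "\<sigma> \<notin> dofs q \<A> \<Longrightarrow> v \<sigma> = 0"
    "\<sigma> \<in> hanging_dofs q \<A> \<Longrightarrow> v \<sigma> = (\<Sum>\<tau>\<in>masters q \<A> \<sigma>. hanging_coeff q \<A> \<sigma> \<tau> * v \<tau>)"
    using assms unfolding V_ag_def V_std_def V_ncf_def by blast+
  show "\<sigma> \<in> ill_free_dofs q \<A> \<W> \<Longrightarrow> v \<sigma> = poly_ext q (K \<sigma>) v (snd \<sigma>)"
    using assms by (simp add: V_ag_def poly_ext_def mult.commute)
qed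

text \<open>Three steps lead from the well-posed free values to all values: to the hanging degrees of
  freedom of well-posed cells, from root cells to the ill-posed free ones, and from the free to
  the remaining hanging ones. With b = 0 this gives uniqueness of the shape functions.\<close>

lemma V_ag_bound:
  assumes v: "v \<in> V_ag q \<A> \<W> K" and b: "\<And>\<sigma>. \<sigma> \<in> S \<Longrightarrow> \<bar>v \<sigma>\<bar> \<le> b" "0 \<le> b"
  shows "\<bar>v \<sigma>\<bar> \<le> \<Lambda> ^ 3 * b"
proof -
  have pow: "b \<le> \<Lambda> * b" "\<Lambda> * b \<le> \<Lambda> * (\<Lambda> * b)" "\<Lambda> * (\<Lambda> * b) \<le> \<Lambda> * (\<Lambda> * (\<Lambda> * b))" "0 \<le> \<Lambda> * b"
  proof -
    have step: "c \<le> \<Lambda> * c \<and> 0 \<le> \<Lambda> * c" if "0 \<le> c" for c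
      using mult_right_mono[OF L1 that] that by simp
    show "b \<le> \<Lambda> * b" "\<Lambda> * b \<le> \<Lambda> * (\<Lambda> * b)" "\<Lambda> * (\<Lambda> * b) \<le> \<Lambda> * (\<Lambda> * (\<Lambda> * b))" "0 \<le> \<Lambda> * b"
      using step b(2) by blast+
  qed
  have well: "\<bar>v \<rho>\<bar> \<le> \<Lambda> * b" if "T \<in> \<W>" "\<rho> \<in> local_dofs q T" for T \<rho>
    using well_local_dof[OF that]
  proof
    assume "\<rho> \<in> S" then show ?thesis using b(1) pow by fastforce
  next
    assume h: "\<rho> \<in> hanging_dofs q \<A> \<and> masters q \<A> \<rho> \<subseteq> S"
    then show ?thesis using masters_abs_le[of \<rho> v b] V_agD(3)[OF v, of \<rho>] b by auto
  qed
  have ill: "\<bar>v \<rho>\<bar> \<le> \<Lambda> * (\<Lambda> * b)" if "\<rho> \<in> ill_free_dofs q \<A> \<W>" for \<rho>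
  proof -
    have K: "K \<rho> \<in> \<W>" by (rule root_well[OF that])
    have "\<rho> \<in> dofs q \<A>" using that by (simp add: ill_free_dofs_def free_dofs_def)
    then have "\<bar>poly_ext q (K \<rho>) v (snd \<rho>)\<bar> \<le> \<Lambda> * (\<Lambda> * b)"
      using K well_sub sub dof_pos well[OF K] pow by (intro poly_ext_abs_le) auto
    then show ?thesis using V_agD(4)[OF v that] by simp
  qed
  have free: "\<bar>v \<rho>\<bar> \<le> \<Lambda> * (\<Lambda> * b)" if "\<rho> \<in> free_dofs q \<A>" for \<rho>
  proof (cases "\<rho> \<in> S")
    case True then show ?thesis using b(1)[of \<rho>] pow by linarith
  next
    case False then show ?thesis using ill[of \<rho>] that by (simp add: ill_free_dofs_def)
  qed
  have "\<bar>v \<sigma>\<bar> \<le> \<Lambda> * (\<Lambda> * (\<Lambda> * b))"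
  proof (cases "\<sigma> \<in> hanging_dofs q \<A>")
    case True
    then show ?thesis using masters_abs_le[of \<sigma> v "\<Lambda> * (\<Lambda> * b)"] V_agD(3)[OF v True] free masters_free[OF True] pow
      by auto
  next
    case False
    then show ?thesis using free[of \<sigma>] V_agD(2)[OF v, of \<sigma>] pow by (cases "\<sigma> \<in> dofs q \<A>") (auto simp: free_dofs_def)
  qed
  then show ?thesis by (simp add: power3_eq_cube mult.assoc)
qed

lemma V_ag_lincomb:
  assumes "finite I" "\<And>i. i \<in> I \<Longrightarrow> v i \<in> V_ag q \<A> \<W> K"
  shows "(\<lambda>\<sigma>. \<Sum>i\<in>I. x i * v i \<sigma>) \<in> V_ag q \<A> \<W> K"
proof -
  have "(\<Sum>i\<in>I. x i * v i \<sigma>) = 0" if "\<sigma> \<notin> dofs q \<A>" for \<sigma>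
    using V_agD(2)[OF assms(2) that] by simp
  moreover have "(\<Sum>i\<in>I. x i * v i \<sigma>) = (\<Sum>\<tau>\<in>masters q \<A> \<sigma>. hanging_coeff q \<A> \<sigma> \<tau> * (\<Sum>i\<in>I. x i * v i \<tau>))"
    if "\<sigma> \<in> hanging_dofs q \<A>" for \<sigma>
  proof -
    have "(\<Sum>i\<in>I. x i * v i \<sigma>) = (\<Sum>i\<in>I. \<Sum>\<tau>\<in>masters q \<A> \<sigma>. hanging_coeff q \<A> \<sigma> \<tau> * (x i * v i \<tau>))"
      using V_agD(3)[OF assms(2) that] by (simp add: sum_distrib_left mult.left_commute)
    then show ?thesis by (subst (asm) sum.swap) (simp add: sum_distrib_left)
  qed
  moreover have "(\<Sum>i\<in>I. x i * v i \<sigma>) = (\<Sum>\<tau>\<in>local_dofs q (K \<sigma>). shape q (K \<sigma>) (snd \<tau>) (snd \<sigma>) * (\<Sum>i\<in>I. x i * v i \<tau>))"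
    if "\<sigma> \<in> ill_free_dofs q \<A> \<W>" for \<sigma>
  proof -
    have "(\<Sum>i\<in>I. x i * v i \<sigma>) = (\<Sum>i\<in>I. \<Sum>\<tau>\<in>local_dofs q (K \<sigma>). shape q (K \<sigma>) (snd \<tau>) (snd \<sigma>) * (x i * v i \<tau>))"
      using V_agD(4)[OF assms(2) that] by (simp add: poly_ext_def sum_distrib_left ac_simps)
    then show ?thesis by (subst (asm) sum.swap) (simp add: sum_distrib_left)
  qed
  ultimately show ?thesis unfolding V_ag_def V_std_def V_ncf_def by blast
qed

lemma V_ag_unique:
  assumes "v \<in> V_ag q \<A> \<W> K" "w \<in> V_ag q \<A> \<W> K" "\<And>\<sigma>. \<sigma> \<in> S \<Longrightarrow> v \<sigma> = w \<sigma>"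
  shows "v = w"
proof
  fix \<sigma>
  \<comment> \<open>the difference of v and w as a linear combination\<close>
  have "(\<lambda>\<sigma>. \<Sum>i\<in>{True, False}. (if i then 1 else -1) * (if i then v else w) \<sigma>) \<in> V_ag q \<A> \<W> K"
    by (rule V_ag_lincomb) (use assms in auto)
  then have "(\<lambda>\<sigma>. v \<sigma> - w \<sigma>) \<in> V_ag q \<A> \<W> K" by simp
  from V_ag_bound[OF this, of 0] show "v \<sigma> = w \<sigma>" using assms(3) by simp
qed

text \<open>The same three steps, taken as a definition: b holds the values on well-posed cells, c those at free degrees of freedom.\<close>

lemma V_ag_exists:
  obtains v where "v \<in> V_ag q \<A> \<W> K" "\<And>\<sigma>. \<sigma> \<in> S \<Longrightarrow> v \<sigma> = x \<sigma>"
proof -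
  let ?H = "hanging_dofs q \<A>"
  define b where "b \<sigma> = (if \<sigma> \<in> S then x \<sigma> else \<Sum>\<tau>\<in>masters q \<A> \<sigma>. hanging_coeff q \<A> \<sigma> \<tau> * x \<tau>)" for \<sigma>
  define c where "c \<sigma> = (if \<sigma> \<in> S then x \<sigma> else poly_ext q (K \<sigma>) b (snd \<sigma>))" for \<sigma>
  define v where "v \<sigma> = (if \<sigma> \<in> free_dofs q \<A> then c \<sigma>
      else if \<sigma> \<in> ?H then \<Sum>\<tau>\<in>masters q \<A> \<sigma>. hanging_coeff q \<A> \<sigma> \<tau> * c \<tau> else 0)" for \<sigma>
  have SF: "\<sigma> \<in> free_dofs q \<A>" if "\<sigma> \<in> S" for \<sigma> using that by (simp add: well_free_dofs_def)
  have HF: "\<sigma> \<notin> free_dofs q \<A>" if "\<sigma> \<in> ?H" for \<sigma> using that by (simp add: free_dofs_def)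
  have vS: "v \<sigma> = x \<sigma>" if "\<sigma> \<in> S" for \<sigma> using that SF by (simp add: v_def c_def)
  have vH: "v \<sigma> = (\<Sum>\<tau>\<in>masters q \<A> \<sigma>. hanging_coeff q \<A> \<sigma> \<tau> * v \<tau>)" if "\<sigma> \<in> ?H" for \<sigma>
  proof -
    have "v \<sigma> = (\<Sum>\<tau>\<in>masters q \<A> \<sigma>. hanging_coeff q \<A> \<sigma> \<tau> * c \<tau>)" using that HF by (simp add: v_def)
    also have "\<dots> = (\<Sum>\<tau>\<in>masters q \<A> \<sigma>. hanging_coeff q \<A> \<sigma> \<tau> * v \<tau>)"
      by (rule sum.cong) (use masters_free[OF that] in \<open>auto simp: v_def\<close>)
    finally show ?thesis .
  qed
  have vb: "v \<sigma> = b \<sigma>" if "T \<in> \<W>" "\<sigma> \<in> local_dofs q T" for T \<sigma>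
    using well_local_dof[OF that]
  proof
    assume "\<sigma> \<in> S" then show ?thesis using vS by (simp add: b_def)
  next
    assume h: "\<sigma> \<in> ?H \<and> masters q \<A> \<sigma> \<subseteq> S"
    then have "\<sigma> \<notin> S" using HF SF by blast
    have "v \<sigma> = (\<Sum>\<tau>\<in>masters q \<A> \<sigma>. hanging_coeff q \<A> \<sigma> \<tau> * x \<tau>)"
      unfolding vH[OF conjunct1[OF h]] by (rule sum.cong) (use h vS in auto)
    then show ?thesis using \<open>\<sigma> \<notin> S\<close> by (simp add: b_def)
  qed
  have vI: "v \<sigma> = poly_ext q (K \<sigma>) v (snd \<sigma>)" if "\<sigma> \<in> ill_free_dofs q \<A> \<W>" for \<sigma>
  proof -
    have "v \<sigma> = poly_ext q (K \<sigma>) b (snd \<sigma>)" using that by (simp add: v_def c_def ill_free_dofs_def)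
    also have "\<dots> = poly_ext q (K \<sigma>) v (snd \<sigma>)"
      unfolding poly_ext_def by (rule sum.cong) (use vb[OF root_well[OF that]] in auto)
    finally show ?thesis .
  qed
  have "v \<sigma> = 0" if "\<sigma> \<notin> dofs q \<A>" for \<sigma>
    using that by (simp add: v_def free_dofs_def hanging_dofs_def)
  then have "v \<in> V_ag q \<A> \<W> K"
    using vH vI unfolding V_ag_def V_std_def V_ncf_def poly_ext_def by (simp add: mult.commute)
  then show ?thesis using that vS by blast
qed

definition basis :: "'d dof \<Rightarrow> 'd dof \<Rightarrow> real" where
  "basis \<sigma> = (THE v. v \<in> V_ag q \<A> \<W> K \<and> (\<forall>\<sigma>'\<in>S. v \<sigma>' = (if \<sigma>' = \<sigma> then 1 else 0)))"

lemma basis: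
  shows "basis \<sigma> \<in> V_ag q \<A> \<W> K" "\<sigma>' \<in> S \<Longrightarrow> basis \<sigma> \<sigma>' = (if \<sigma>' = \<sigma> then 1 else 0)"
proof -
  obtain v where v: "v \<in> V_ag q \<A> \<W> K" "\<And>\<sigma>'. \<sigma>' \<in> S \<Longrightarrow> v \<sigma>' = (if \<sigma>' = \<sigma> then 1 else 0)"
    by (rule V_ag_exists[of "\<lambda>\<sigma>'. if \<sigma>' = \<sigma> then 1 else 0"]) (rule that)
  let ?Q = "\<lambda>v. v \<in> V_ag q \<A> \<W> K \<and> (\<forall>\<sigma>'\<in>S. v \<sigma>' = (if \<sigma>' = \<sigma> then 1 else 0))"
  have "?Q v" using v by blast
  moreover have "w = v" if "?Q w" for w using that v by (intro V_ag_unique) auto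
  ultimately have "?Q (basis \<sigma>)" unfolding basis_def by (rule theI)
  then show "basis \<sigma> \<in> V_ag q \<A> \<W> K" "\<sigma>' \<in> S \<Longrightarrow> basis \<sigma> \<sigma>' = (if \<sigma>' = \<sigma> then 1 else 0)" by blast+
qed

lemma ag_shape_eq: "ag_shape q \<A> \<W> K \<sigma> = fe_fun q \<A> (basis \<sigma>)"
  unfolding ag_shape_def basis_def ..

text \<open>Well-posed cells see all well-posed free degrees of freedom. The two cases are those in the
  definition; the second is the one for masters of hanging degrees of freedom.\<close>

lemma well_free_value:
  assumes v: "v \<in> V_ag q \<A> \<W> K" and "\<sigma> \<in> S"
  obtains T where "T \<in> \<W>" "v \<sigma> = poly_ext q T v (snd \<sigma>)"
proof -
  consider T where "T \<in> \<W>" "\<sigma> \<in> local_dofs q T" | \<rho> where "\<rho> \<in> well_hanging_dofs q \<A> \<W>" "\<sigma> \<in> masters q \<A> \<rho>"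
    using assms(2) unfolding well_free_dofs_def by blast
  then show ?thesis
  proof cases
    case (1 T)
    have "invertible (jac T)" using mesh_invertible 1 well_sub sub by blast
    from poly_ext_node[OF this 1(2)] show ?thesis using that[OF 1(1)] by simp
  next
    case (2 \<rho>)
    then obtain T where T: "T \<in> \<W>" "\<rho> \<in> local_dofs q T" "\<rho> \<in> hanging_dofs q \<A>"
      by (auto simp: well_hanging_dofs_def)
    then show ?thesis
      using master_value[OF V_agD(1)[OF v] T(3) _ T(2) 2(2)] well_sub that[OF T(1)] by blast
  qed
qed

lemma fe_fun_open_cell:
  assumes "T \<in> \<A>" "x \<in> open_cell T"
  shows "fe_fun q \<A> v x = poly_ext q T v x"
proof -
  have "x \<notin> open_cell T'" if "T' \<in> \<A>" "T' \<noteq> T" for T'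
    using mesh_disjoint[of T T'] that assms sub by blast
  then have "fe_fun q \<A> v x = (\<Sum>T'\<in>\<A>. if T' = T then poly_ext q T v x else 0)"
    unfolding fe_fun_def by (intro sum.cong) (auto simp: assms poly_ext_def)
  then show ?thesis using assms finite_subset[OF sub finite_mesh] by simp
qed

lemma fe_fun_outside: "x \<notin> (\<Union>T\<in>\<A>. open_cell T) \<Longrightarrow> fe_fun q \<A> v x = 0"
  unfolding fe_fun_def by (intro sum.neutral) auto

lemma fe_fun_bound:
  assumes "\<And>\<sigma>. \<bar>v \<sigma>\<bar> \<le> b" "0 \<le> b"
  shows "\<bar>fe_fun q \<A> v x\<bar> \<le> \<Lambda> * b"
proof (cases "x \<in> (\<Union>T\<in>\<A>. open_cell T)")
  case True
  then obtain T where T: "T \<in> \<A>" "x \<in> open_cell T" by blast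
  then have "\<bar>poly_ext q T v x\<bar> \<le> \<Lambda> * b"
    using sub open_cell_subset assms by (intro poly_ext_abs_le) auto
  then show ?thesis using fe_fun_open_cell[OF T] by simp
next
  case False
  then show ?thesis using fe_fun_outside[OF False] L1 assms(2) by simp
qed

lemma fe_fun_lincomb: "fe_fun q \<A> (\<lambda>\<sigma>. \<Sum>i\<in>I. x i * v i \<sigma>) y = (\<Sum>i\<in>I. x i * fe_fun q \<A> (v i) y)"
proof (cases "y \<in> (\<Union>T\<in>\<A>. open_cell T)")
  case True
  then obtain T where T: "T \<in> \<A>" "y \<in> open_cell T" by blast
  have "(\<Sum>\<sigma>\<in>local_dofs q T. (\<Sum>i\<in>I. x i * v i \<sigma>) * shape q T (snd \<sigma>) y)
      = (\<Sum>\<sigma>\<in>local_dofs q T. \<Sum>i\<in>I. x i * (v i \<sigma> * shape q T (snd \<sigma>) y))"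
    by (simp add: sum_distrib_right mult.assoc)
  also have "\<dots> = (\<Sum>i\<in>I. \<Sum>\<sigma>\<in>local_dofs q T. x i * (v i \<sigma> * shape q T (snd \<sigma>) y))"
    by (rule sum.swap)
  finally show ?thesis by (simp add: fe_fun_open_cell[OF T] poly_ext_def sum_distrib_left)
next
  case False
  then show ?thesis using fe_fun_outside by simp
qed

end

section \<open>Zero sets of tensor-product polynomials\<close>

text \<open>Fubini, one variable at a time. For almost every value y of the last variable, the coefficient
  polynomials in y do not all vanish, and then the induction hypothesis applies to the remaining
  variables.\<close>

lemma tensor_AE_nonzero:
  fixes l :: "'g \<Rightarrow> real \<Rightarrow> real"
  assumes "finite I" and G: "finite G"
    and [measurable]: "\<And>t. l t \<in> borel_measurable borel"
    and nz: "\<And>a. \<exists>t\<in>G. a t \<noteq> 0 \<Longrightarrow> AE s in lborel. (\<Sum>t\<in>G. a t * l t s) \<noteq> 0"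
    and "\<exists>k\<in>PiE I (\<lambda>_. G). a k \<noteq> 0"
  shows "AE x in PiM I (\<lambda>_. lborel). (\<Sum>k\<in>PiE I (\<lambda>_. G). a k * (\<Prod>i\<in>I. l (k i) (x i))) \<noteq> 0"
  using assms(1,5)
proof (induction I arbitrary: a rule: finite_induct)
  case empty
  then show ?case by (simp add: AE_I2)
next
  case (insert i I)
  interpret product_sigma_finite "\<lambda>_::'b. lborel :: real measure" by standard
  let ?P = "\<lambda>I. PiM I (\<lambda>_. lborel :: real measure)"
  define h where "h x = (\<Sum>k\<in>PiE (insert i I) (\<lambda>_. G). a k * (\<Prod>j\<in>insert i I. l (k j) (x j)))" for x
  define a' where "a' y g = (\<Sum>t\<in>G. a (g(i := t)) * l t y)" for y g
  have [measurable]: "h \<in> borel_measurable (?P (insert i I))"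
    unfolding h_def by measurable
  have h: "h (x(i := y)) = (\<Sum>g\<in>PiE I (\<lambda>_. G). a' y g * (\<Prod>j\<in>I. l (g j) (x j)))" for x y
  proof -
    have "h (x(i := y)) = (\<Sum>(t, g)\<in>G \<times> PiE I (\<lambda>_. G). a (g(i := t)) * (\<Prod>j\<in>insert i I. l ((g(i := t)) j) ((x(i := y)) j)))"
      unfolding h_def PiE_insert_eq
      by (subst sum.reindex[OF inj_combinator[OF insert(2)]]) (simp add: case_prod_beta o_def)
    also have "\<dots> = (\<Sum>(t, g)\<in>G \<times> PiE I (\<lambda>_. G). a (g(i := t)) * l t y * (\<Prod>j\<in>I. l (g j) (x j)))"
    proof (rule sum.cong[OF refl], clarify)
      fix t g
      have "(\<Prod>j\<in>I. l ((g(i := t)) j) ((x(i := y)) j)) = (\<Prod>j\<in>I. l (g j) (x j))"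
        using insert(2) by (intro prod.cong) auto
      then show "a (g(i := t)) * (\<Prod>j\<in>insert i I. l ((g(i := t)) j) ((x(i := y)) j))
          = a (g(i := t)) * l t y * (\<Prod>j\<in>I. l (g j) (x j))"
        using insert(1,2) by simp
    qed
    also have "\<dots> = (\<Sum>t\<in>G. \<Sum>g\<in>PiE I (\<lambda>_. G). a (g(i := t)) * l t y * (\<Prod>j\<in>I. l (g j) (x j)))"
      by (rule sum.cartesian_product[symmetric])
    also have "\<dots> = (\<Sum>g\<in>PiE I (\<lambda>_. G). \<Sum>t\<in>G. a (g(i := t)) * l t y * (\<Prod>j\<in>I. l (g j) (x j)))"
      by (rule sum.swap)
    finally show ?thesis by (simp add: a'_def sum_distrib_right)
  qed
  obtain g t where gt: "g \<in> PiE I (\<lambda>_. G)" "t \<in> G" "a (g(i := t)) \<noteq> 0"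
    using insert(4) unfolding PiE_insert_eq by auto
  have "AE y in lborel. a' y g \<noteq> 0"
    unfolding a'_def using gt by (intro nz) auto
  then have zero: "AE y in lborel. (\<integral>\<^sup>+ x. indicator {x. h x = 0} (x(i := y)) \<partial>?P I) = 0"
  proof eventually_elim
    case (elim y)
    have "AE x in ?P I. h (x(i := y)) \<noteq> 0"
      unfolding h using elim gt by (intro insert.IH) auto
    then have "AE x in ?P I. indicator {x. h x = 0} (x(i := y)) = (0::ennreal)"
      by eventually_elim simp
    then show ?case by (simp add: nn_integral_cong_AE)
  qed
  have ms: "(\<lambda>x. indicator {x. h x = 0} x :: ennreal) \<in> borel_measurable (?P (insert i I))"
    by (rule measurable_cong[THEN iffD1, of _ "indicator {x \<in> space (?P (insert i I)). h x = 0}"])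
       (auto simp: indicator_def)
  have "(\<integral>\<^sup>+ x. indicator {x. h x = 0} x \<partial>?P (insert i I)) = 0"
    unfolding product_nn_integral_insert_rev[OF insert(1,2) ms]
    using zero by (simp add: nn_integral_cong_AE)
  then have "AE x in ?P (insert i I). h x \<noteq> 0"
    by (subst AE_iff_nn_integral) auto
  then show ?case unfolding h_def .
qed

lemma grid_AE_nonzero:
  assumes "q \<ge> 1" "\<exists>t\<in>grid q. a t \<noteq> 0"
  shows "AE s in lborel. (\<Sum>t\<in>grid q. a t * lag q t s) \<noteq> 0"
proof -
  have "\<exists>l. \<forall>s. poly l s = lag q t s" if "t \<in> grid q" for t
    using lag_poly[OF assms(1) that, of 1 0] by auto
  then obtain l where l: "\<And>t s. t \<in> grid q \<Longrightarrow> poly (l t) s = lag q t s" by metis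
  define r where "r = (\<Sum>t\<in>grid q. smult (a t) (l t))"
  have r: "poly r s = (\<Sum>t\<in>grid q. a t * lag q t s)" for s by (simp add: r_def poly_sum l)
  obtain t where t: "t \<in> grid q" "a t \<noteq> 0" using assms by blast
  have "poly r t = (\<Sum>u\<in>grid q. if u = t then a u else 0)"
    unfolding r by (rule sum.cong) (auto simp: lag_self lag_other t)
  then have "r \<noteq> 0" using t by auto
  then have "countable {s. poly r s = 0}" by (simp add: poly_roots_finite countable_finite)
  then have "{s. poly r s = 0} \<in> null_sets lborel" by (rule countable_imp_null_set_lborel)
  then have "AE s in lborel. s \<notin> {s. poly r s = 0}" by (rule AE_not_in)
  then show ?thesis by (simp add: r)
qed

lemma lag_measurable [measurable]: "lag q t \<in> borel_measurable borel"
  unfolding lag_def by measurable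

lemma tensor_AE_nonzero_vec:
  fixes a :: "('d::finite \<Rightarrow> real) \<Rightarrow> real"
  assumes q: "q \<ge> 1" and nz: "\<exists>k\<in>PiE UNIV (\<lambda>_. grid q). a k \<noteq> 0"
  shows "AE x in (lborel :: (real^'d) measure). (\<Sum>k\<in>PiE UNIV (\<lambda>_. grid q). a k * (\<Prod>i\<in>UNIV. lag q (k i) (x $ i))) \<noteq> 0"
proof -
  let ?B = "Basis :: (real^'d) set" and ?e = "\<lambda>i. axis i 1 :: real^'d"
  have B: "?B = range ?e" by (auto simp: Basis_vec_def)
  have inj: "inj ?e" by (auto simp: inj_def axis_eq_axis)
  let ?\<phi> = "\<lambda>(k :: real^'d \<Rightarrow> real) i. k (?e i)"
  have bij: "bij_betw ?\<phi> (PiE ?B (\<lambda>_. grid q)) (PiE UNIV (\<lambda>_. grid q))"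
  proof (rule bij_betw_byWitness[of _ "\<lambda>k. restrict (\<lambda>b. k (inv ?e b)) ?B"])
    show "\<forall>k\<in>PiE ?B (\<lambda>_. grid q). restrict (\<lambda>b. ?\<phi> k (inv ?e b)) ?B = k"
    proof
      fix k assume k: "k \<in> PiE ?B (\<lambda>_. grid q)"
      show "restrict (\<lambda>b. ?\<phi> k (inv ?e b)) ?B = k"
      proof
        fix b show "restrict (\<lambda>b. ?\<phi> k (inv ?e b)) ?B b = k b"
          using k by (cases "b \<in> ?B") (auto simp: B inv_f_f[OF inj] PiE_def extensional_def)
      qed
    qed
    show "\<forall>k\<in>PiE UNIV (\<lambda>_. grid q). ?\<phi> (restrict (\<lambda>b. k (inv ?e b)) ?B) = k"
      by (auto simp: B inv_f_f[OF inj])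
  qed (auto simp: B)
  have "AE x in PiM ?B (\<lambda>_. lborel). (\<Sum>k\<in>PiE ?B (\<lambda>_. grid q). a (?\<phi> k) * (\<Prod>b\<in>?B. lag q (k b) (x b))) \<noteq> 0"
  proof (rule tensor_AE_nonzero)
    obtain k where k: "k \<in> PiE UNIV (\<lambda>_. grid q)" "a k \<noteq> 0" using nz by blast
    then obtain k' where "k' \<in> PiE ?B (\<lambda>_. grid q)" "?\<phi> k' = k"
      using bij unfolding bij_betw_def by (metis (no_types, lifting) imageE)
    then show "\<exists>k\<in>PiE ?B (\<lambda>_. grid q). a (?\<phi> k) \<noteq> 0" using k by blast
  qed (use grid_AE_nonzero[OF q] in auto)
  moreover have "(\<Sum>k\<in>PiE ?B (\<lambda>_. grid q). a (?\<phi> k) * (\<Prod>b\<in>?B. lag q (k b) (x b)))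
      = (\<Sum>k\<in>PiE UNIV (\<lambda>_. grid q). a k * (\<Prod>i\<in>UNIV. lag q (k i) (x (?e i))))" for x
  proof -
    have "(\<Prod>b\<in>?B. lag q (k b) (x b)) = (\<Prod>i\<in>UNIV. lag q (k (?e i)) (x (?e i)))" for k :: "real^'d \<Rightarrow> real"
      unfolding B by (subst prod.reindex[OF inj]) simp
    then show ?thesis
      using sum.reindex_bij_betw[OF bij, of "\<lambda>k. a k * (\<Prod>i\<in>UNIV. lag q (k i) (x (?e i)))"] by simp
  qed
  ultimately have *: "AE x in PiM ?B (\<lambda>_. lborel).
      (\<Sum>k\<in>PiE UNIV (\<lambda>_. grid q). a k * (\<Prod>i\<in>UNIV. lag q (k i) (x (?e i)))) \<noteq> 0" by simp
  have coord: "(\<Sum>b\<in>?B. f b *\<^sub>R b) $ i = f (?e i)" for f i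
  proof -
    have "(\<Sum>b\<in>?B. f b *\<^sub>R b) $ i = (\<Sum>j\<in>UNIV. f (?e j) * (?e j) $ i)"
      unfolding B by (subst sum.reindex[OF inj]) (simp add: sum_component)
    also have "\<dots> = (\<Sum>j\<in>UNIV. if j = i then f (?e j) else 0)"
      by (rule sum.cong) (auto simp: axis_def)
    finally show ?thesis by simp
  qed
  have "AE x in PiM ?B (\<lambda>_. lborel).
      (\<Sum>k\<in>PiE UNIV (\<lambda>_. grid q). a k * (\<Prod>i\<in>UNIV. lag q (k i) ((\<Sum>b\<in>?B. x b *\<^sub>R b) $ i))) \<noteq> 0"
    unfolding coord by (rule *)
  then show ?thesis
    by (subst lborel_eq, subst AE_distr_iff) simp_all
qed

section \<open>Function spaces seen from large subsets\<close>

text \<open>The squared L2 norm over B controls the coefficients, uniformly in all subsets B of measure at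
  least \<eta>. Otherwise there are normalised coefficient vectors and sets for which the norm tends
  to 0; a subsequence of the vectors converges to some l on the unit sphere. The limit function
  vanishes only on a null set, so its modulus exceeds some \<delta> off a set of measure less than
  \<eta> / 2, and the functions of the subsequence eventually exceed \<delta> / 2 there. As B keeps
  measure at least \<eta> / 2 off this exceptional set, the norms are bounded from below.\<close>

lemma quadratic_lower_bound:
  fixes f :: "'i \<Rightarrow> 'a \<Rightarrow> real"
  assumes fin: "finite I" and T: "T \<in> sets M" "emeasure M T < \<infinity>"
    and [measurable]: "\<And>i. i \<in> I \<Longrightarrow> f i \<in> borel_measurable M"
    and bnd: "\<And>i y. i \<in> I \<Longrightarrow> y \<in> T \<Longrightarrow> \<bar>f i y\<bar> \<le> b"
    and nz: "\<And>x. \<exists>i\<in>I. x i \<noteq> 0 \<Longrightarrow> AE y in M. y \<in> T \<longrightarrow> (\<Sum>i\<in>I. x i * f i y) \<noteq> 0"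
    and \<eta>: "0 < \<eta>"
  shows "\<exists>c>0. \<forall>x B. B \<in> sets M \<and> B \<subseteq> T \<and> \<eta> \<le> measure M B \<longrightarrow>
    c * (\<Sum>i\<in>I. (x i)\<^sup>2) \<le> (\<integral>y\<in>B. (\<Sum>i\<in>I. x i * f i y)\<^sup>2 \<partial>M)"
proof (rule ccontr)
  let ?p = "\<lambda>x y. \<Sum>i\<in>I. x i * f i y"
  let ?J = "\<lambda>x B. \<integral>y\<in>B. (?p x y)\<^sup>2 \<partial>M"
  assume "\<not> ?thesis"
  then have "\<forall>c>0. \<exists>x B. B \<in> sets M \<and> B \<subseteq> T \<and> \<eta> \<le> measure M B \<and> ?J x B < c * (\<Sum>i\<in>I. (x i)\<^sup>2)"
    by (meson not_le)
  then have "\<forall>n. \<exists>x B. B \<in> sets M \<and> B \<subseteq> T \<and> \<eta> \<le> measure M B \<and> ?J x B < inverse (real (Suc n)) * (\<Sum>i\<in>I. (x i)\<^sup>2)"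
    by simp
  then obtain x where "\<forall>n. \<exists>B. B \<in> sets M \<and> B \<subseteq> T \<and> \<eta> \<le> measure M B \<and> ?J (x n) B < inverse (real (Suc n)) * (\<Sum>i\<in>I. (x n i)\<^sup>2)"
    unfolding choice_iff by blast
  then obtain B where B: "\<And>n. B n \<in> sets M" "\<And>n. B n \<subseteq> T" "\<And>n. \<eta> \<le> measure M (B n)"
    and J: "\<And>n. ?J (x n) (B n) < inverse (real (Suc n)) * (\<Sum>i\<in>I. (x n i)\<^sup>2)"
    unfolding choice_iff by blast
  have J0: "0 \<le> ?J x B" for x B
    unfolding set_lebesgue_integral_def by (rule Bochner_Integration.integral_nonneg) simp
  define N where "N n = (\<Sum>i\<in>I. (x n i)\<^sup>2)" for n
  have N: "0 < N n" for n
  proof -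
    have "0 \<le> ?J (x n) (B n)" by (rule J0)
    then have "0 < inverse (real (Suc n)) * N n" using J[of n] unfolding N_def by linarith
    then show ?thesis by (simp add: zero_less_mult_iff)
  qed
  define u where "u n i = x n i / sqrt (N n)" for n i
  have u1: "(\<Sum>i\<in>I. (u n i)\<^sup>2) = 1" for n
    using N[of n] by (simp add: u_def power_divide N_def[symmetric] flip: sum_divide_distrib)
  have uJ: "?J (u n) (B n) < inverse (real (Suc n))" for n
  proof -
    have "?p (u n) y = ?p (x n) y / sqrt (N n)" for y
      by (simp add: u_def sum_divide_distrib)
    then have "?J (u n) (B n) = ?J (x n) (B n) / N n"
      using N[of n] by (simp add: power_divide set_integral_divide_zero)
    also have "\<dots> < inverse (real (Suc n))"
      using J[of n] N[of n] by (simp add: N_def[symmetric] pos_divide_less_eq)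
    finally show ?thesis .
  qed
  have "\<bar>u n i\<bar> \<le> 1" if "i \<in> I" for n i
  proof -
    have "(u n i)\<^sup>2 \<le> (\<Sum>i\<in>I. (u n i)\<^sup>2)" using that fin by (intro member_le_sum) auto
    then show ?thesis unfolding u1 by (simp add: abs_square_le_1)
  qed
  then have "bounded ((\<lambda>v. v i) ` range u)" if "i \<in> I" for i
    using that unfolding bounded_iff by auto
  then have "\<forall>\<delta>\<subseteq>I. \<exists>l r. strict_mono r \<and> (\<forall>\<epsilon>>0. \<forall>\<^sub>F n in sequentially. \<forall>i\<in>\<delta>. dist (u (r n) i) (l i) < \<epsilon>)"
    by (intro compact_lemma_general[of I "\<lambda>v i. v i" u "\<lambda>v. v"]) (auto simp: fin)
  then obtain l r where r: "strict_mono (r :: nat \<Rightarrow> nat)"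
    and lr: "\<And>\<epsilon>. \<epsilon> > 0 \<Longrightarrow> \<forall>\<^sub>F n in sequentially. \<forall>i\<in>I. dist (u (r n) i) (l i) < \<epsilon>" by blast
  have lim: "(\<lambda>n. u (r n) i) \<longlonglongrightarrow> l i" if "i \<in> I" for i
    unfolding tendsto_iff using lr that by (fastforce elim: eventually_mono)
  have "(\<lambda>n. \<Sum>i\<in>I. (u (r n) i)\<^sup>2) \<longlonglongrightarrow> (\<Sum>i\<in>I. (l i)\<^sup>2)"
    by (intro tendsto_sum tendsto_power lim)
  then have "(\<Sum>i\<in>I. (l i)\<^sup>2) = 1" unfolding u1 using LIMSEQ_unique tendsto_const by blast
  moreover have "(\<Sum>i\<in>I. (l i)\<^sup>2) = 0" if "\<forall>i\<in>I. l i = 0"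
    using that by simp
  ultimately have "\<exists>i\<in>I. l i \<noteq> 0" by fastforce
  from nz[OF this] have AE: "AE y in M. y \<in> T \<longrightarrow> ?p l y \<noteq> 0" .
  have p_meas [measurable]: "(\<lambda>y. ?p v y) \<in> borel_measurable M" for v
    by (intro borel_measurable_sum borel_measurable_times borel_measurable_const assms(4))
  define A where "A m = {y \<in> T. \<bar>?p l y\<bar> \<le> inverse (real (Suc m))}" for m
  have A: "A m \<in> sets M" for m
  proof -
    have "A m = T \<inter> {y \<in> space M. \<bar>?p l y\<bar> \<le> inverse (real (Suc m))}"
      using sets.sets_into_space[OF T(1)] by (auto simp: A_def)
    also have "\<dots> \<in> sets M" using T(1) by measurable
    finally show ?thesis .
  qed
  have finT: "emeasure M X \<noteq> \<infinity>" if "X \<subseteq> T" for X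
    using emeasure_mono[OF that T(1)] T(2) by (auto simp: top_unique)
  have "(\<lambda>m. measure M (A m)) \<longlonglongrightarrow> measure M (\<Inter>m. A m)"
  proof (rule Lim_measure_decseq)
    show "range A \<subseteq> sets M" using A by blast
    show "emeasure M (A i) \<noteq> \<infinity>" for i by (rule finT) (auto simp: A_def)
    show "decseq A"
    proof (rule decseq_SucI)
      fix m
      have "inverse (real (Suc (Suc m))) \<le> inverse (real (Suc m))" by (simp add: field_simps)
      then show "A (Suc m) \<subseteq> A m" unfolding A_def by (auto intro: order.trans)
    qed
  qed
  moreover have "measure M (\<Inter>m. A m) = 0"
  proof -
    have "(\<Inter>m. A m) \<subseteq> {y \<in> T. ?p l y = 0}"
    proof
      fix y assume y: "y \<in> (\<Inter>m. A m)"
      have "\<bar>?p l y\<bar> \<le> 0"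
      proof (rule field_le_epsilon)
        fix e :: real assume "0 < e"
        then obtain m where "inverse (real (Suc m)) < e" using reals_Archimedean by blast
        then show "\<bar>?p l y\<bar> \<le> 0 + e" using y by (auto simp: A_def dest!: spec[of _ m] intro: order.trans)
      qed
      then show "y \<in> {y \<in> T. ?p l y = 0}" using y by (auto simp: A_def)
    qed
    then have "AE y in M. y \<notin> (\<Inter>m. A m)" 
      by (intro eventually_mono[OF AE]) blast
    moreover have "(\<Inter>m. A m) \<in> sets M" using A by auto
    ultimately have "(\<Inter>m. A m) \<in> null_sets M" by (simp add: AE_iff_null_sets)
    then show ?thesis by (simp add: null_sets_def measure_def)
  qed
  ultimately have "(\<lambda>m. measure M (A m)) \<longlonglongrightarrow> 0" by simp
  then obtain m where m: "measure M (A m) < \<eta> / 2"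
    using \<eta> by (metis half_gt_zero order_tendstoD(2) eventually_sequentially order_refl)
  define \<delta> where "\<delta> = inverse (real (Suc m))"
  have \<delta>: "0 < \<delta>" by (simp add: \<delta>_def)
  \<comment> \<open>the summand 1 only avoids a division by 0\<close>
  define \<epsilon> where "\<epsilon> = \<delta> / (2 * (real (card I) * \<bar>b\<bar> + 1))"
  have \<epsilon>: "0 < \<epsilon>" using \<delta> unfolding \<epsilon>_def by (intro divide_pos_pos mult_pos_pos add_nonneg_pos) auto
  have \<epsilon>b: "real (card I) * (\<epsilon> * \<bar>b\<bar>) \<le> \<delta> / 2"
  proof -
    have "real (card I) * (\<epsilon> * \<bar>b\<bar>) \<le> \<epsilon> * (real (card I) * \<bar>b\<bar> + 1)" using \<epsilon> by (simp add: algebra_simps)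
    also have "\<dots> = \<delta> / 2"
    proof -
      have "real (card I) * \<bar>b\<bar> + 1 > 0" by (intro add_nonneg_pos) auto
      then show ?thesis by (simp add: \<epsilon>_def field_simps)
    qed
    finally show ?thesis .
  qed
  define \<kappa> where "\<kappa> = (\<delta> / 2)\<^sup>2 * (\<eta> / 2)"
  have "0 < \<kappa>" using \<delta> \<eta> by (simp add: \<kappa>_def)
  then obtain n0 where n0: "inverse (real (Suc n0)) < \<kappa>" using reals_Archimedean by blast
  obtain n where n: "n \<ge> n0" "\<forall>i\<in>I. dist (u (r n) i) (l i) < \<epsilon>"
    using eventually_happens[OF eventually_conj[OF eventually_ge_at_top[of n0] lr[OF \<epsilon>]]] by auto
  define w where "w = u (r n)"
  define E where "E = B (r n)"
  have E: "E \<in> sets M" "E \<subseteq> T" "\<eta> \<le> measure M E" using B by (auto simp: E_def)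
  have big: "\<delta> / 2 \<le> \<bar>?p w y\<bar>" if y: "y \<in> E - A m" for y
  proof -
    have yT: "y \<in> T" using y E by blast
    then have "\<delta> < \<bar>?p l y\<bar>" using y by (auto simp: A_def \<delta>_def)
    moreover have "\<bar>?p l y - ?p w y\<bar> \<le> \<delta> / 2"
    proof -
      have "\<bar>?p l y - ?p w y\<bar> = \<bar>\<Sum>i\<in>I. (l i - w i) * f i y\<bar>" by (simp add: sum_subtractf left_diff_distrib)
      also have "\<dots> \<le> (\<Sum>i\<in>I. \<bar>l i - w i\<bar> * \<bar>f i y\<bar>)" by (rule order.trans[OF sum_abs]) (simp add: abs_mult)
      also have "\<dots> \<le> (\<Sum>i\<in>I. \<epsilon> * \<bar>b\<bar>)"
      proof (intro sum_mono mult_mono)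
        fix i assume i: "i \<in> I"
        show "\<bar>l i - w i\<bar> \<le> \<epsilon>" using n(2) i by (auto simp: w_def dist_real_def abs_minus_commute less_imp_le)
        show "\<bar>f i y\<bar> \<le> \<bar>b\<bar>" using bnd[OF i yT] by linarith
      qed (use \<epsilon> in auto)
      also have "\<dots> = real (card I) * (\<epsilon> * \<bar>b\<bar>)" by simp
      finally show ?thesis using \<epsilon>b by linarith
    qed
    ultimately show ?thesis by linarith
  qed
  have mE: "\<eta> / 2 \<le> measure M (E - A m)"
  proof -
    have "measure M E \<le> measure M ((E - A m) \<union> A m)"
      using E A by (intro measure_mono_fmeasurable) (auto simp: fmeasurable_def intro!: finT[unfolded infinity_ennreal_def, THEN less_top[THEN iffD1]] simp: A_def)
    also have "\<dots> \<le> measure M (E - A m) + measure M (A m)"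
      using E A by (intro measure_Un_le) auto
    finally show ?thesis using m E(3) by linarith
  qed
  have "\<kappa> \<le> (\<delta> / 2)\<^sup>2 * measure M (E - A m)" unfolding \<kappa>_def by (rule mult_left_mono[OF mE]) simp
  also have "\<dots> = (\<integral>y. (\<delta> / 2)\<^sup>2 * indicator (E - A m) y \<partial>M)"
    using E A by simp
  also have "\<dots> \<le> ?J w E"
    unfolding set_lebesgue_integral_def
  proof (rule integral_mono)
    have "E - A m \<subseteq> T" using E by blast
    then have fE: "emeasure M (E - A m) < \<infinity>" using finT by (simp add: less_top)
    then show "integrable M (\<lambda>y. (\<delta> / 2)\<^sup>2 * indicator (E - A m) y)"
      using E A by (intro integrable_mult_right integrable_real_indicator) auto
    show "integrable M (\<lambda>y. indicator E y *\<^sub>R (?p w y)\<^sup>2)"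
    proof (rule integrableI_bounded_set[OF E(1) _ _ AE_I2])
      show "emeasure M E < \<infinity>" using finT[OF E(2)] by (simp add: less_top)
      show "(\<lambda>y. indicator E y *\<^sub>R (?p w y)\<^sup>2) \<in> borel_measurable M" using E(1) by measurable
      fix y assume "y \<in> space M"
      show "y \<in> E \<longrightarrow> norm (indicator E y *\<^sub>R (?p w y)\<^sup>2) \<le> ((\<Sum>i\<in>I. \<bar>w i\<bar> * b))\<^sup>2"
      proof
        assume "y \<in> E"
        have "\<bar>?p w y\<bar> \<le> (\<Sum>i\<in>I. \<bar>w i\<bar> * \<bar>f i y\<bar>)" by (rule order.trans[OF sum_abs]) (simp add: abs_mult)
        also have "\<dots> \<le> (\<Sum>i\<in>I. \<bar>w i\<bar> * b)"
          using \<open>y \<in> E\<close> E bnd by (intro sum_mono mult_left_mono) auto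
        finally have "\<bar>?p w y\<bar>\<^sup>2 \<le> (\<Sum>i\<in>I. \<bar>w i\<bar> * b)\<^sup>2" by (intro power_mono) auto
        then show "norm (indicator E y *\<^sub>R (?p w y)\<^sup>2) \<le> ((\<Sum>i\<in>I. \<bar>w i\<bar> * b))\<^sup>2" using \<open>y \<in> E\<close> by simp
      qed
    qed (auto)
    show "(\<delta> / 2)\<^sup>2 * indicator (E - A m) y \<le> indicator E y *\<^sub>R (?p w y)\<^sup>2" for y
    proof (cases "y \<in> E - A m")
      case True
      then have "(\<delta> / 2)\<^sup>2 \<le> \<bar>?p w y\<bar>\<^sup>2" using big \<delta> by (intro power_mono) auto
      then show ?thesis using True by simp
    qed simp
  qed
  also have "\<dots> < inverse (real (Suc (r n)))" unfolding w_def E_def by (rule uJ)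
  also have "\<dots> \<le> inverse (real (Suc n0))"
    using n(1) seq_suble[OF r, of n] by (simp add: field_simps)
  finally show False using n0 by simp
qed

section \<open>Condition number of a positive definite matrix\<close>

text \<open>Elimination of one unknown: solve on S without k for the right-hand side and for the column of
  k, and combine. The pivot s is a Schur complement, and it is positive because it is the value
  of the quadratic form at the vector z, which is 1 at k and annihilates the other equations.\<close>

lemma positive_definite_solvable:
  fixes A :: "'i \<Rightarrow> 'i \<Rightarrow> real"
  assumes "finite S" and "\<And>x. \<exists>i\<in>S. x i \<noteq> 0 \<Longrightarrow> 0 < (\<Sum>i\<in>S. x i * (\<Sum>j\<in>S. A i j * x j))"
  shows "\<exists>y. \<forall>i\<in>S. (\<Sum>j\<in>S. A i j * y j) = b i"
  using assms
proof (induction S arbitrary: b rule: finite_induct)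
  case empty
  then show ?case by simp
next
  case (insert k S)
  have sub: "0 < (\<Sum>i\<in>S. x i * (\<Sum>j\<in>S. A i j * x j))" if x: "\<exists>i\<in>S. x i \<noteq> 0" for x
  proof -
    define x' where "x' i = (if i = k then 0 else x i)" for i
    have x'S: "x' i = x i" if "i \<in> S" for i using that insert(2) by (auto simp: x'_def)
    have "\<exists>i\<in>insert k S. x' i \<noteq> 0" using x x'S by auto
    from insert.prems[OF this] show ?thesis
      using insert(1,2) by (simp add: x'S) (simp add: x'_def)
  qed
  obtain y where y: "\<And>i. i \<in> S \<Longrightarrow> (\<Sum>j\<in>S. A i j * y j) = b i"
    using insert.IH[OF sub] by metis
  obtain w where w: "\<And>i. i \<in> S \<Longrightarrow> (\<Sum>j\<in>S. A i j * w j) = A i k"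
    using insert.IH[OF sub, of "\<lambda>i. A i k"] by metis
  \<comment> \<open>the vector whose image vanishes on S\<close>
  define z where "z i = (if i = k then 1 else - w i)" for i
  have zS: "(\<Sum>j\<in>S. A i j * z j) = - (\<Sum>j\<in>S. A i j * w j)" for i
    unfolding sum_negf[symmetric] using insert(2) by (intro sum.cong) (auto simp: z_def)
  have Az: "(\<Sum>j\<in>insert k S. A i j * z j) = A i k - (\<Sum>j\<in>S. A i j * w j)" for i
    using insert(1,2) zS[of i] by (simp add: z_def)
  define s where "s = A k k - (\<Sum>j\<in>S. A k j * w j)"
  have "0 < (\<Sum>i\<in>insert k S. z i * (\<Sum>j\<in>insert k S. A i j * z j))"
    by (rule insert.prems) (auto simp: z_def)
  also have "\<dots> = s"
    unfolding Az using insert(1,2) by (simp add: w s_def z_def)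
  finally have s: "0 < s" .
  define t where "t = (b k - (\<Sum>j\<in>S. A k j * y j)) / s"
  define u where "u i = (if i = k then t else y i - t * w i)" for i
  have uS: "(\<Sum>j\<in>S. A i j * u j) = (\<Sum>j\<in>S. A i j * y j) - t * (\<Sum>j\<in>S. A i j * w j)" for i
    unfolding sum_distrib_left sum_subtractf[symmetric]
    using insert(2) by (intro sum.cong) (auto simp: u_def algebra_simps)
  have "(\<Sum>j\<in>insert k S. A i j * u j) = b i" if "i \<in> insert k S" for i
  proof -
    have e: "(\<Sum>j\<in>insert k S. A i j * u j) = A i k * t + (\<Sum>j\<in>S. A i j * y j) - t * (\<Sum>j\<in>S. A i j * w j)"
      using insert(1,2) uS[of i] by (simp add: u_def)
    show ?thesis
    proof (cases "i = k")
      case True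
      have "A k k * t + (\<Sum>j\<in>S. A k j * y j) - t * (\<Sum>j\<in>S. A k j * w j) = t * s + (\<Sum>j\<in>S. A k j * y j)"
        by (simp add: s_def algebra_simps)
      also have "\<dots> = b k" using s by (simp add: t_def)
      finally show ?thesis using e True by simp
    next
      case False
      then show ?thesis using e that y w by simp
    qed
  qed
  then show ?case by blast
qed

text \<open>The columns of the inverse solve the system for unit vectors. That the right inverse is also a left inverse follows from injectivity of a matrix with a positive quadratic form.\<close>

lemma positive_definite_inverse:
  fixes A :: "'i \<Rightarrow> 'i \<Rightarrow> real"
  assumes fin: "finite S" and pos: "\<And>x. \<exists>i\<in>S. x i \<noteq> 0 \<Longrightarrow> 0 < (\<Sum>i\<in>S. x i * (\<Sum>j\<in>S. A i j * x j))"
  shows "\<exists>B. inverse_on S A B"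
proof -
  have "\<exists>y. \<forall>i\<in>S. (\<Sum>j\<in>S. A i j * y j) = (if i = k then 1 else 0)" for k
    by (rule positive_definite_solvable[OF assms])
  then obtain Y where Y: "\<And>k i. i \<in> S \<Longrightarrow> (\<Sum>j\<in>S. A i j * Y k j) = (if i = k then 1 else 0)"
    by metis
  define B where "B i j = Y j i" for i j
  have AB: "(\<Sum>k\<in>S. A i k * B k j) = (if i = j then 1 else 0)" if "i \<in> S" for i j
    using Y that by (simp add: B_def)
  have "(\<Sum>k\<in>S. B i k * A k j) = (if i = j then 1 else 0)" if i: "i \<in> S" and j: "j \<in> S" for i j
  proof (rule ccontr)
    assume ne: "\<not> ?thesis"
    define x where "x i = (\<Sum>k\<in>S. B i k * A k j) - (if i = j then 1 else 0)" for i
    have Ax: "(\<Sum>i\<in>S. A l i * x i) = 0" if l: "l \<in> S" for l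
    proof -
      have "(\<Sum>i\<in>S. A l i * (\<Sum>k\<in>S. B i k * A k j)) = (\<Sum>i\<in>S. \<Sum>k\<in>S. A l i * B i k * A k j)"
        by (simp add: sum_distrib_left mult.assoc)
      also have "\<dots> = (\<Sum>k\<in>S. \<Sum>i\<in>S. A l i * B i k * A k j)" by (rule sum.swap)
      also have "\<dots> = (\<Sum>k\<in>S. (if l = k then 1 else 0) * A k j)"
        by (rule sum.cong[OF refl], subst AB[OF l, symmetric]) (simp add: sum_distrib_right)
      also have "\<dots> = (\<Sum>k\<in>S. if l = k then A k j else 0)" by (rule sum.cong) auto
      also have "\<dots> = A l j" using l fin by simp
      finally have 1: "(\<Sum>i\<in>S. A l i * (\<Sum>k\<in>S. B i k * A k j)) = A l j" .
      have "(\<Sum>i\<in>S. A l i * (if i = j then 1 else 0)) = (\<Sum>i\<in>S. if i = j then A l i else 0)"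
        by (rule sum.cong) auto
      then have 2: "(\<Sum>i\<in>S. A l i * (if i = j then 1 else 0)) = A l j" using j fin by simp
      show ?thesis unfolding x_def right_diff_distrib sum_subtractf 1 2 by simp
    qed
    have "x i \<noteq> 0" using ne by (simp add: x_def)
    then have "\<exists>i\<in>S. x i \<noteq> 0" using i by blast
    from pos[OF this] show False using Ax by simp
  qed
  then show ?thesis using AB unfolding inverse_on_def by blast
qed

lemma spectral_norm_le:
  assumes "\<And>x. L2_set x S \<le> 1 \<Longrightarrow> L2_set (\<lambda>i. \<Sum>j\<in>S. A i j * x j) S \<le> c"
  shows "0 \<le> spectral_norm S A" "spectral_norm S A \<le> c"
proof -
  have 0: "(\<lambda>_. 0) \<in> {x. L2_set x S \<le> 1}" by (simp add: L2_set_def)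
  have bdd: "bdd_above ((\<lambda>x. L2_set (\<lambda>i. \<Sum>j\<in>S. A i j * x j) S) ` {x. L2_set x S \<le> 1})"
    using assms by (intro bdd_aboveI2) auto
  have "0 \<le> L2_set (\<lambda>i. \<Sum>j\<in>S. A i j * 0) S" by (rule L2_set_nonneg)
  also have "\<dots> \<le> spectral_norm S A"
    unfolding spectral_norm_def by (rule cSUP_upper[OF 0 bdd])
  finally show "0 \<le> spectral_norm S A" .
  show "spectral_norm S A \<le> c"
    unfolding spectral_norm_def using 0 assms by (intro cSUP_least) auto
qed

text \<open>The entries bound the norm of the matrix; for the inverse, test the quadratic form with the solution y of A y = x and use the Cauchy-Schwarz inequality.\<close>

lemma cond_number_le:
  assumes fin: "finite S" and b: "\<And>i j. i \<in> S \<Longrightarrow> j \<in> S \<Longrightarrow> \<bar>A i j\<bar> \<le> b" and b0: "0 \<le> b"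
    and \<mu>: "0 < \<mu>" and low: "\<And>x. \<mu> * (\<Sum>i\<in>S. (x i)\<^sup>2) \<le> (\<Sum>i\<in>S. x i * (\<Sum>j\<in>S. A i j * x j))"
  shows "cond_number S A \<le> ereal ((real (card S))\<^sup>2 * b / \<mu>)"
proof -
  let ?n = "real (card S)"
  have "\<exists>B. inverse_on S A B"
  proof (rule positive_definite_inverse[OF fin])
    fix x :: "'a \<Rightarrow> real" assume "\<exists>i\<in>S. x i \<noteq> 0"
    then obtain k where k: "k \<in> S" "x k \<noteq> 0" by blast
    have "(x k)\<^sup>2 \<le> (\<Sum>i\<in>S. (x i)\<^sup>2)"
      by (rule member_le_sum[where f = "\<lambda>i. (x i)\<^sup>2"]) (use k fin in auto)
    moreover have "0 < (x k)\<^sup>2" using k by simp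
    ultimately have "0 < (\<Sum>i\<in>S. (x i)\<^sup>2)" by linarith
    then have "0 < \<mu> * (\<Sum>i\<in>S. (x i)\<^sup>2)" using \<mu> by simp
    then show "0 < (\<Sum>i\<in>S. x i * (\<Sum>j\<in>S. A i j * x j))" using low[of x] by linarith
  qed
  then have B: "inverse_on S A (SOME B. inverse_on S A B)" (is "inverse_on S A ?B") by (rule someI_ex)
  have coord: "\<bar>x j\<bar> \<le> L2_set x S" if "j \<in> S" for x :: "'a \<Rightarrow> real" and j
    using member_le_L2_set[OF fin that, of "\<lambda>i. \<bar>x i\<bar>"] by (simp add: L2_set_def)
  have "L2_set (\<lambda>i. \<Sum>j\<in>S. A i j * x j) S \<le> ?n\<^sup>2 * b" if x: "L2_set x S \<le> 1" for x
  proof -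
    have "\<bar>\<Sum>j\<in>S. A i j * x j\<bar> \<le> ?n * b" if i: "i \<in> S" for i
    proof -
      have "\<bar>\<Sum>j\<in>S. A i j * x j\<bar> \<le> (\<Sum>j\<in>S. \<bar>A i j\<bar> * \<bar>x j\<bar>)"
        by (rule order.trans[OF sum_abs]) (simp add: abs_mult)
      also have "\<dots> \<le> (\<Sum>j\<in>S. b * 1)"
        using b[OF i] coord[of _ x] x b0 by (intro sum_mono mult_mono) (auto intro: order.trans)
      finally show ?thesis by simp
    qed
    then have "(\<Sum>i\<in>S. \<bar>\<Sum>j\<in>S. A i j * x j\<bar>) \<le> (\<Sum>i\<in>S. ?n * b)" by (rule sum_mono)
    then show "L2_set (\<lambda>i. \<Sum>j\<in>S. A i j * x j) S \<le> ?n\<^sup>2 * b"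
      using L2_set_le_sum_abs[of "\<lambda>i. \<Sum>j\<in>S. A i j * x j" S] by (simp add: power2_eq_square mult.assoc)
  qed
  note normA = spectral_norm_le[OF this]
  have "L2_set (\<lambda>i. \<Sum>j\<in>S. ?B i j * x j) S \<le> 1 / \<mu>" if x: "L2_set x S \<le> 1" for x
  proof -
    define y where "y i = (\<Sum>j\<in>S. ?B i j * x j)" for i
    have Ay: "(\<Sum>j\<in>S. A i j * y j) = x i" if i: "i \<in> S" for i
    proof -
      have "(\<Sum>j\<in>S. A i j * y j) = (\<Sum>j\<in>S. \<Sum>k\<in>S. A i j * ?B j k * x k)"
        by (simp add: y_def sum_distrib_left mult.assoc)
      also have "\<dots> = (\<Sum>k\<in>S. (\<Sum>j\<in>S. A i j * ?B j k) * x k)"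
        by (subst sum.swap) (simp add: sum_distrib_right)
      also have "\<dots> = (\<Sum>k\<in>S. if i = k then x k else 0)"
        using B i unfolding inverse_on_def by (intro sum.cong) auto
      finally show ?thesis using i fin by simp
    qed
    let ?Y = "L2_set y S"
    have "\<mu> * ?Y\<^sup>2 \<le> (\<Sum>i\<in>S. y i * (\<Sum>j\<in>S. A i j * y j))"
      using low[of y] by (simp add: L2_set_def sum_nonneg)
    also have "\<dots> = (\<Sum>i\<in>S. y i * x i)" using Ay by simp
    also have "\<dots> \<le> (\<Sum>i\<in>S. \<bar>y i\<bar> * \<bar>x i\<bar>)" by (intro sum_mono) (simp add: abs_mult[symmetric])
    also have "\<dots> \<le> ?Y * L2_set x S" by (rule L2_set_mult_ineq)
    also have "\<dots> \<le> ?Y * 1" using x by (intro mult_left_mono L2_set_nonneg)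
    finally have "?Y * (\<mu> * ?Y) \<le> ?Y * 1" by (simp add: power2_eq_square mult.left_commute)
    then have "\<mu> * ?Y \<le> 1"
      using L2_set_nonneg[of y S] by (cases "?Y = 0") (auto simp: mult_le_cancel_left)
    then show "L2_set (\<lambda>i. \<Sum>j\<in>S. ?B i j * x j) S \<le> 1 / \<mu>"
      unfolding y_def[symmetric] using \<mu> by (simp add: field_simps)
  qed
  note normB = spectral_norm_le[OF this]
  have "spectral_norm S A * spectral_norm S ?B \<le> (?n\<^sup>2 * b) * (1 / \<mu>)"
    using normA normB b0 by (intro mult_mono) auto
  then show ?thesis
    using \<open>\<exists>B. inverse_on S A B\<close> by (simp add: cond_number_def)
qed

section \<open>The mass matrix\<close>

lemma shape_measurable [measurable]: "shape q T y \<in> borel_measurable borel"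
  by (intro borel_measurable_continuous_onI continuous_on_shape)

lemma poly_ext_measurable [measurable]: "poly_ext q T v \<in> borel_measurable borel"
  unfolding poly_ext_def by measurable

text \<open>In reference coordinates a nonzero nodal polynomial is a nonzero tensor-product polynomial, and affine maps preserve null sets.\<close>

lemma poly_ext_AE_nonzero:
  assumes q: "q \<ge> 1" and inv: "invertible (jac T)" and nz: "\<exists>\<sigma>\<in>local_dofs q T. v \<sigma> \<noteq> 0"
  shows "AE y in lborel. poly_ext q T v y \<noteq> 0"
proof -
  let ?a = "\<lambda>k. v (smallest_face T (cell_map T (\<chi> i. k i)), cell_map T (\<chi> i. k i))"
  let ?h = "\<lambda>\<xi>::real^'a. \<Sum>k\<in>PiE UNIV (\<lambda>_. grid q). ?a k * (\<Prod>i\<in>UNIV. lag q (k i) (\<xi> $ i))"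
  have h: "poly_ext q T v (cell_map T \<xi>) = ?h \<xi>" for \<xi>
    unfolding poly_ext_eq_sum_nodes sum_nodes[OF inv] shape_eq_prod_lag by (simp add: ref_coord_cell_map[OF inv])
  obtain \<sigma> where \<sigma>: "\<sigma> \<in> local_dofs q T" "v \<sigma> \<noteq> 0" using nz by blast
  let ?k = "\<lambda>i. ref_coord T (snd \<sigma>) $ i"
  have "?k \<in> PiE UNIV (\<lambda>_. grid q)" using \<sigma>(1) nodes_iff[OF inv] by (auto simp: local_dofs_iff)
  moreover have "?a ?k = v \<sigma>"
  proof -
    have "cell_map T (\<chi> i. ?k i) = snd \<sigma>" by (simp add: cell_map_ref_coord[OF inv])
    then have "(smallest_face T (cell_map T (\<chi> i. ?k i)), cell_map T (\<chi> i. ?k i)) = \<sigma>"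
      using \<sigma>(1) by (simp add: local_dofs_iff prod_eq_iff)
    then show ?thesis by simp
  qed
  ultimately have "\<exists>k\<in>PiE UNIV (\<lambda>_. grid q). ?a k \<noteq> 0" using \<sigma>(2) by metis
  from tensor_AE_nonzero_vec[OF q this] have AE: "AE \<xi> in lborel. ?h \<xi> \<noteq> 0" .
  let ?Z = "{\<xi>. poly_ext q T v (cell_map T \<xi>) = 0}"
  have "cell_map T \<in> borel_measurable borel"
    by (intro borel_measurable_continuous_onI continuous_on_cell_map)
  then have "?Z \<in> sets lborel" by measurable
  then have "?Z \<in> null_sets lborel" using AE by (subst AE_iff_null_sets) (simp_all add: h)
  then have "negligible ?Z"
    by (simp add: negligible_iff_null_sets null_sets_completionI)
  moreover have "cell_map T differentiable_on ?Z"
    unfolding cell_map_def by (intro derivative_intros differentiable_on_add linear_imp_differentiable_on) auto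
  ultimately have "negligible (cell_map T ` ?Z)"
    by (intro negligible_differentiable_image_negligible) auto
  moreover have "cell_map T ` ?Z = {y. poly_ext q T v y = 0}"
    by (auto intro!: image_eqI[of _ _ "ref_coord T _"] simp: cell_map_ref_coord[OF inv])
  ultimately have "{y. poly_ext q T v y = 0} \<in> null_sets lebesgue" by (simp add: negligible_iff_null_sets)
  moreover have "{y. poly_ext q T v y = 0} \<in> sets lborel" by measurable
  ultimately have "{y. poly_ext q T v y = 0} \<in> null_sets lborel" by (simp add: null_sets_completion_iff)
  from AE_not_in[OF this] show ?thesis by simp
qed

lemma closed_cell_emeasure: "emeasure lborel (closed_cell T) < \<infinity>"
  by (rule emeasure_compact_finite[OF compact_closed_cell])

lemma open_cell_finite: "emeasure lborel (open_cell T) < \<infinity>"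
proof -
  have "closed_cell T \<in> sets lborel" using compact_closed_cell[of T] by (simp add: borel_compact)
  from emeasure_mono[OF open_cell_subset this] show ?thesis using closed_cell_emeasure[of T] by (rule le_less_trans)
qed

lemma open_cell_measure_pos:
  assumes "invertible (jac T)"
  shows "0 < measure lborel (open_cell T)"
proof (rule ccontr)
  assume "\<not> ?thesis"
  then have "measure lborel (open_cell T) = 0" by (simp add: zero_less_measure_iff)
  then have "emeasure lborel (open_cell T) = 0"
    using open_cell_finite[of T] by (auto simp: measure_def enn2real_eq_0_iff)
  moreover have "open_cell T \<in> sets lborel" using open_open_cell[OF assms] by simp
  ultimately have "open_cell T \<in> null_sets lborel" by blast
  then have "negligible (open_cell T)" by (simp add: negligible_iff_null_sets null_sets_completionI)
  then show False using open_not_negligible[OF open_open_cell[OF assms]] center_in_open_cell by blast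
qed

lemma cell_lower_bound:
  assumes q: "q \<ge> 1" and inv: "invertible (jac T)" and \<eta>: "0 < \<eta>"
  shows "\<exists>c>0. \<forall>v B. B \<in> sets lborel \<and> B \<subseteq> open_cell T \<and> \<eta> \<le> measure lborel B \<longrightarrow>
    c * (\<Sum>\<sigma>\<in>local_dofs q T. (v \<sigma>)\<^sup>2) \<le> (\<integral>y\<in>B. (poly_ext q T v y)\<^sup>2 \<partial>lborel)"
proof -
  have "\<exists>b. \<forall>\<sigma>\<in>local_dofs q T. \<forall>y\<in>closed_cell T. \<bar>shape q T (snd \<sigma>) y\<bar> \<le> b"
  proof -
    have "\<exists>b. \<forall>y\<in>closed_cell T. \<bar>shape q T w y\<bar> \<le> b" for w
      using compact_imp_bounded[OF compact_continuous_image[OF continuous_on_shape[of _ q T w] compact_closed_cell[of T]]]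
      unfolding bounded_iff by auto
    then obtain b where b: "\<And>w y. y \<in> closed_cell T \<Longrightarrow> \<bar>shape q T w y\<bar> \<le> b w" by metis
    have "\<bar>shape q T (snd \<sigma>) y\<bar> \<le> (\<Sum>\<sigma>\<in>local_dofs q T. \<bar>b (snd \<sigma>)\<bar>)"
      if "\<sigma> \<in> local_dofs q T" "y \<in> closed_cell T" for \<sigma> y
    proof -
      have "\<bar>shape q T (snd \<sigma>) y\<bar> \<le> \<bar>b (snd \<sigma>)\<bar>" using b[OF that(2), of "snd \<sigma>"] by linarith
      also have "\<dots> \<le> (\<Sum>\<sigma>\<in>local_dofs q T. \<bar>b (snd \<sigma>)\<bar>)" using that by (intro member_le_sum[where f="\<lambda>\<sigma>. \<bar>b (snd \<sigma>)\<bar>"]) auto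
      finally show ?thesis .
    qed
    then show ?thesis by blast
  qed
  then obtain b where b: "\<And>\<sigma> y. \<sigma> \<in> local_dofs q T \<Longrightarrow> y \<in> closed_cell T \<Longrightarrow> \<bar>shape q T (snd \<sigma>) y\<bar> \<le> b" by blast
  have "\<exists>c>0. \<forall>v B. B \<in> sets lborel \<and> B \<subseteq> open_cell T \<and> \<eta> \<le> measure lborel B \<longrightarrow>
    c * (\<Sum>\<sigma>\<in>local_dofs q T. (v \<sigma>)\<^sup>2) \<le> (\<integral>y\<in>B. (\<Sum>\<sigma>\<in>local_dofs q T. v \<sigma> * shape q T (snd \<sigma>) y)\<^sup>2 \<partial>lborel)"
  proof (rule quadratic_lower_bound[where b = b])
    show "open_cell T \<in> sets lborel" using open_open_cell[OF inv] by simp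
    show "\<bar>shape q T (snd \<sigma>) y\<bar> \<le> b" if "\<sigma> \<in> local_dofs q T" "y \<in> open_cell T" for \<sigma> y
      using b[OF that(1)] that(2) open_cell_subset by blast
    show "AE y in lborel. y \<in> open_cell T \<longrightarrow> (\<Sum>\<sigma>\<in>local_dofs q T. x \<sigma> * shape q T (snd \<sigma>) y) \<noteq> 0"
      if "\<exists>\<sigma>\<in>local_dofs q T. x \<sigma> \<noteq> 0" for x
      using poly_ext_AE_nonzero[OF q inv that] unfolding poly_ext_def by (rule AE_mp) (simp add: AE_I2)
  qed (use \<eta> open_cell_finite in auto)
  then show ?thesis unfolding poly_ext_def .
qed

text \<open>As the mesh is finite, a single constant serves all cells and all cut locations.\<close>

lemma (in forest) mesh_lower_bound:
  assumes q: "q \<ge> 1" and \<eta>: "0 < \<eta>"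
  obtains c where "0 < c" "\<And>T v B. T \<in> \<T> \<Longrightarrow> B \<in> sets lborel \<Longrightarrow> B \<subseteq> open_cell T \<Longrightarrow>
      \<eta> * measure lborel (open_cell T) \<le> measure lborel B \<Longrightarrow>
    c * (\<Sum>\<sigma>\<in>local_dofs q T. (v \<sigma>)\<^sup>2) \<le> (\<integral>y\<in>B. (poly_ext q T v y)\<^sup>2 \<partial>lborel)"
proof -
  have "\<exists>c>0. \<forall>v B. B \<in> sets lborel \<and> B \<subseteq> open_cell T \<and> \<eta> * measure lborel (open_cell T) \<le> measure lborel B \<longrightarrow>
    c * (\<Sum>\<sigma>\<in>local_dofs q T. (v \<sigma>)\<^sup>2) \<le> (\<integral>y\<in>B. (poly_ext q T v y)\<^sup>2 \<partial>lborel)" if "T \<in> \<T>" for T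
    using \<eta> open_cell_measure_pos[OF mesh_invertible[OF that]]
    by (intro cell_lower_bound[OF q mesh_invertible[OF that]]) simp
  then obtain c where c: "\<And>T. T \<in> \<T> \<Longrightarrow> 0 < c T" "\<And>T v B. T \<in> \<T> \<Longrightarrow> B \<in> sets lborel \<Longrightarrow> B \<subseteq> open_cell T \<Longrightarrow>
      \<eta> * measure lborel (open_cell T) \<le> measure lborel B \<Longrightarrow>
    c T * (\<Sum>\<sigma>\<in>local_dofs q T. (v \<sigma>)\<^sup>2) \<le> (\<integral>y\<in>B. (poly_ext q T v y)\<^sup>2 \<partial>lborel)"
    by metis
  \<comment> \<open>the 1 makes the minimum exist for the empty mesh, too\<close>
  define m where "m = Min (insert 1 (c ` \<T>))"
  have "0 < m" unfolding m_def using c(1) finite_mesh by (subst Min_gr_iff) auto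
  moreover have "m \<le> c T" if "T \<in> \<T>" for T unfolding m_def using that finite_mesh by (intro Min_le) auto
  then have "m * (\<Sum>\<sigma>\<in>local_dofs q T. (v \<sigma>)\<^sup>2) \<le> c T * (\<Sum>\<sigma>\<in>local_dofs q T. (v \<sigma>)\<^sup>2)" if "T \<in> \<T>" for T v
    using that by (intro mult_right_mono) (auto intro: sum_nonneg)
  ultimately show ?thesis using that c(2) by (meson order.trans)
qed

context aggregated
begin

abbreviation "mesh_region \<equiv> \<Union>T\<in>\<T>. closed_cell T"

lemma region: "mesh_region \<in> sets lborel" "emeasure lborel mesh_region < \<infinity>"
proof -
  have "compact mesh_region" by (intro compact_UN finite_mesh compact_closed_cell)
  then show "mesh_region \<in> sets lborel" "emeasure lborel mesh_region < \<infinity>"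
    by (simp add: borel_compact, rule emeasure_compact_finite)
qed

lemma fe_fun_measurable [measurable]: "fe_fun q \<A> v \<in> borel_measurable borel"
proof -
  have [measurable]: "open_cell T \<in> sets borel" if "T \<in> \<A>" for T
    using open_open_cell[OF mesh_invertible] that sub by auto
  show ?thesis unfolding fe_fun_def by measurable
qed

lemma V_ag_bounded:
  assumes "v \<in> V_ag q \<A> \<W> K"
  obtains b where "0 \<le> b" "\<And>x. \<bar>fe_fun q \<A> v x\<bar> \<le> b"
proof -
  let ?s = "\<Sum>\<sigma>\<in>S. \<bar>v \<sigma>\<bar>"
  have "\<bar>v \<sigma>\<bar> \<le> \<Lambda> ^ 3 * ?s" for \<sigma>
    using finite_S by (intro V_ag_bound[OF assms]) (auto intro: member_le_sum[where f="\<lambda>\<sigma>. \<bar>v \<sigma>\<bar>"] sum_nonneg)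
  then have "\<bar>fe_fun q \<A> v x\<bar> \<le> \<Lambda> * (\<Lambda> ^ 3 * ?s)" for x
    using L1 by (intro fe_fun_bound) (auto intro!: mult_nonneg_nonneg sum_nonneg)
  then show ?thesis using L1 by (intro that[of "\<Lambda> * (\<Lambda> ^ 3 * ?s)"]) (auto intro!: mult_nonneg_nonneg sum_nonneg)
qed

lemma fe_fun_off_region: "x \<notin> mesh_region \<Longrightarrow> fe_fun q \<A> v x = 0"
  using open_cell_subset sub by (intro fe_fun_outside) blast

lemma integrable_product:
  assumes \<Omega>: "\<Omega> \<in> sets lborel" and v: "v \<in> V_ag q \<A> \<W> K" and w: "w \<in> V_ag q \<A> \<W> K"
  shows "integrable lborel (\<lambda>x. indicator \<Omega> x *\<^sub>R (fe_fun q \<A> v x * fe_fun q \<A> w x))"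
proof -
  obtain b where b: "0 \<le> b" "\<And>x. \<bar>fe_fun q \<A> v x\<bar> \<le> b" by (rule V_ag_bounded[OF v]) (rule that)
  obtain c where c: "0 \<le> c" "\<And>x. \<bar>fe_fun q \<A> w x\<bar> \<le> c" by (rule V_ag_bounded[OF w]) (rule that)
  show ?thesis
  proof (rule integrableI_bounded_set[OF region(1) _ region(2), where B = "b * c"])
    show "(\<lambda>x. indicator \<Omega> x *\<^sub>R (fe_fun q \<A> v x * fe_fun q \<A> w x)) \<in> borel_measurable lborel"
      using \<Omega> by measurable
    have "norm (indicator \<Omega> x *\<^sub>R (fe_fun q \<A> v x * fe_fun q \<A> w x)) \<le> b * c" for x
    proof -
      have "\<bar>fe_fun q \<A> v x\<bar> * \<bar>fe_fun q \<A> w x\<bar> \<le> b * c" using b c by (intro mult_mono) auto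
      then show ?thesis using b(1) c(1) by (auto simp: indicator_def abs_mult)
    qed
    then show "AE x in lborel. x \<in> mesh_region \<longrightarrow> norm (indicator \<Omega> x *\<^sub>R (fe_fun q \<A> v x * fe_fun q \<A> w x)) \<le> b * c"
      by simp
    show "AE x in lborel. x \<notin> mesh_region \<longrightarrow> indicator \<Omega> x *\<^sub>R (fe_fun q \<A> v x * fe_fun q \<A> w x) = 0"
    proof (intro AE_I2 impI)
      fix x assume x: "x \<notin> mesh_region"
      show "indicator \<Omega> x *\<^sub>R (fe_fun q \<A> v x * fe_fun q \<A> w x) = 0"
        by (simp only: fe_fun_off_region[OF x]) simp
    qed
  qed
qed

lemma mass_matrix_eq:
  "mass_matrix q \<Omega> \<A> \<W> K \<sigma> \<sigma>' = (\<integral>x\<in>\<Omega>. fe_fun q \<A> (basis \<sigma>) x * fe_fun q \<A> (basis \<sigma>') x \<partial>lborel)"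
  unfolding mass_matrix_def ag_shape_eq ..

lemma mass_matrix_entry_le:
  assumes "\<Omega> \<in> sets lborel"
  shows "\<bar>mass_matrix q \<Omega> \<A> \<W> K \<sigma> \<sigma>'\<bar> \<le> \<Lambda> ^ 8 * measure lborel mesh_region"
proof -
  have bd: "\<bar>fe_fun q \<A> (basis \<sigma>) x\<bar> \<le> \<Lambda> ^ 4" for \<sigma> x
  proof -
    have "\<bar>basis \<sigma> \<tau>\<bar> \<le> \<Lambda> ^ 3 * 1" for \<tau>
      by (rule V_ag_bound[OF basis(1)]) (auto simp: basis(2))
    then have "\<bar>fe_fun q \<A> (basis \<sigma>) x\<bar> \<le> \<Lambda> * (\<Lambda> ^ 3)"
      using L1 by (intro fe_fun_bound) auto
    then show ?thesis by (simp add: power_numeral_reduce)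
  qed
  have "\<bar>mass_matrix q \<Omega> \<A> \<W> K \<sigma> \<sigma>'\<bar>
      \<le> (\<integral>x. \<Lambda> ^ 8 * indicator mesh_region x \<partial>lborel)"
    unfolding mass_matrix_eq set_lebesgue_integral_def real_norm_def[symmetric]
  proof (rule order.trans[OF integral_norm_bound integral_mono])
    show "integrable lborel (\<lambda>x. norm (indicator \<Omega> x *\<^sub>R (fe_fun q \<A> (basis \<sigma>) x * fe_fun q \<A> (basis \<sigma>') x)))"
      by (intro integrable_norm integrable_product assms basis)
    show "integrable lborel (\<lambda>x. \<Lambda> ^ 8 * indicator mesh_region x)"
      using region by (intro integrable_mult_right integrable_real_indicator) auto
    fix x
    show "norm (indicator \<Omega> x *\<^sub>R (fe_fun q \<A> (basis \<sigma>) x * fe_fun q \<A> (basis \<sigma>') x)) \<le> \<Lambda> ^ 8 * indicator mesh_region x"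
    proof (cases "x \<in> mesh_region")
      case True
      have "\<bar>fe_fun q \<A> (basis \<sigma>) x\<bar> * \<bar>fe_fun q \<A> (basis \<sigma>') x\<bar> \<le> \<Lambda> ^ 4 * \<Lambda> ^ 4"
        using bd L1 by (intro mult_mono) auto
      also have "\<dots> = \<Lambda> ^ 8" by (simp flip: power_add)
      finally have "\<bar>fe_fun q \<A> (basis \<sigma>) x\<bar> * \<bar>fe_fun q \<A> (basis \<sigma>') x\<bar> \<le> \<Lambda> ^ 8" .
      moreover have "0 \<le> \<Lambda> ^ 8" using L1 by simp
      ultimately show ?thesis using True by (simp add: indicator_def abs_mult)
    next
      case False
      then show ?thesis by (simp only: fe_fun_off_region[OF False]) simp
    qed
  qed
  also have "\<dots> = \<Lambda> ^ 8 * measure lborel mesh_region" using region by simp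
  finally show ?thesis .
qed

lemma mass_matrix_form:
  assumes "\<Omega> \<in> sets lborel"
  shows "(\<Sum>i\<in>S. x i * (\<Sum>j\<in>S. mass_matrix q \<Omega> \<A> \<W> K i j * x j))
      = (\<integral>y\<in>\<Omega>. (fe_fun q \<A> (\<lambda>\<sigma>. \<Sum>i\<in>S. x i * basis i \<sigma>) y)\<^sup>2 \<partial>lborel)"
proof -
  let ?f = "\<lambda>i. fe_fun q \<A> (basis i)"
  have int: "integrable lborel (\<lambda>y. indicator \<Omega> y *\<^sub>R (?f i y * ?f j y))" for i j
    by (intro integrable_product assms basis)
  have "(\<integral>y\<in>\<Omega>. (fe_fun q \<A> (\<lambda>\<sigma>. \<Sum>i\<in>S. x i * basis i \<sigma>) y)\<^sup>2 \<partial>lborel)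
      = (\<integral>y. (\<Sum>i\<in>S. \<Sum>j\<in>S. x i * x j * (indicator \<Omega> y *\<^sub>R (?f i y * ?f j y))) \<partial>lborel)"
    unfolding set_lebesgue_integral_def fe_fun_lincomb power2_eq_square sum_product
    by (rule arg_cong[where f = "integral\<^sup>L lborel"])
       (simp add: fun_eq_iff sum_distrib_left ac_simps)
  also have "\<dots> = (\<Sum>i\<in>S. \<integral>y. (\<Sum>j\<in>S. x i * x j * (indicator \<Omega> y *\<^sub>R (?f i y * ?f j y))) \<partial>lborel)"
    by (rule Bochner_Integration.integral_sum) (intro Bochner_Integration.integrable_sum integrable_mult_right int)
  also have "\<dots> = (\<Sum>i\<in>S. \<Sum>j\<in>S. \<integral>y. x i * x j * (indicator \<Omega> y *\<^sub>R (?f i y * ?f j y)) \<partial>lborel)"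
    by (intro sum.cong refl Bochner_Integration.integral_sum integrable_mult_right int)
  also have "\<dots> = (\<Sum>i\<in>S. \<Sum>j\<in>S. x i * x j * (\<integral>y\<in>\<Omega>. ?f i y * ?f j y \<partial>lborel))"
    unfolding set_lebesgue_integral_def by (simp only: integral_mult_right_zero)
  finally show ?thesis by (simp add: mass_matrix_eq sum_distrib_left ac_simps)
qed

text \<open>The integral over the cut part of a well-posed cell controls the nodal values on this cell, and
  these control the well-posed free values. Ill-posed cells are simply dropped.\<close>

lemma well_free_lower_bound:
  assumes \<Omega>: "\<Omega> \<in> sets lborel" and v: "v \<in> V_ag q \<A> \<W> K" and c: "0 < c"
    and low: "\<And>T. T \<in> \<W> \<Longrightarrow> c * (\<Sum>\<sigma>\<in>local_dofs q T. (v \<sigma>)\<^sup>2) \<le> (\<integral>y\<in>open_cell T \<inter> \<Omega>. (poly_ext q T v y)\<^sup>2 \<partial>lborel)"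
  shows "c * (\<Sum>\<sigma>\<in>S. (v \<sigma>)\<^sup>2) \<le> real (card S) * \<Lambda>\<^sup>2 * (\<integral>y\<in>\<Omega>. (fe_fun q \<A> v y)\<^sup>2 \<partial>lborel)"
proof -
  let ?J = "\<integral>y\<in>\<Omega>. (fe_fun q \<A> v y)\<^sup>2 \<partial>lborel"
  have each: "c * (v \<sigma>)\<^sup>2 \<le> \<Lambda>\<^sup>2 * ?J" if \<sigma>: "\<sigma> \<in> S" for \<sigma>
  proof -
    obtain T where T: "T \<in> \<W>" "v \<sigma> = poly_ext q T v (snd \<sigma>)" by (rule well_free_value[OF v \<sigma>])
    have mesh: "T \<in> \<T>" and act: "T \<in> \<A>" using T well_sub sub by auto
    let ?s = "\<Sum>\<tau>\<in>local_dofs q T. (v \<tau>)\<^sup>2"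
    have s0: "0 \<le> ?s" by (intro sum_nonneg) simp
    have "\<bar>v \<sigma>\<bar> \<le> \<Lambda> * sqrt ?s"
      unfolding T(2)
    proof (rule poly_ext_abs_le[OF mesh])
      show "snd \<sigma> \<in> (\<Union>T\<in>\<T>. closed_cell T)"
        using \<sigma> by (intro dof_pos) (simp add: well_free_dofs_def free_dofs_def)
      fix \<tau> assume "\<tau> \<in> local_dofs q T"
      then have "(v \<tau>)\<^sup>2 \<le> ?s" by (intro member_le_sum[where f = "\<lambda>\<tau>. (v \<tau>)\<^sup>2"]) auto
      then show "\<bar>v \<tau>\<bar> \<le> sqrt ?s" by (simp add: real_le_rsqrt)
    qed (use s0 in simp)
    then have "\<bar>v \<sigma>\<bar>\<^sup>2 \<le> (\<Lambda> * sqrt ?s)\<^sup>2" by (intro power_mono) auto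
    then have 1: "(v \<sigma>)\<^sup>2 \<le> \<Lambda>\<^sup>2 * ?s" using s0 by (simp add: power_mult_distrib)
    have "c * ?s \<le> (\<integral>y\<in>open_cell T \<inter> \<Omega>. (poly_ext q T v y)\<^sup>2 \<partial>lborel)" by (rule low[OF T(1)])
    also have "\<dots> = (\<integral>y\<in>open_cell T \<inter> \<Omega>. fe_fun q \<A> v y * fe_fun q \<A> v y \<partial>lborel)"
      unfolding set_lebesgue_integral_def
      by (rule Bochner_Integration.integral_cong) (auto simp: indicator_def fe_fun_open_cell[OF act] power2_eq_square)
    also have "\<dots> \<le> (\<integral>y\<in>\<Omega>. fe_fun q \<A> v y * fe_fun q \<A> v y \<partial>lborel)"
      unfolding set_lebesgue_integral_def
    proof (rule integral_mono)
      have "open_cell T \<inter> \<Omega> \<in> sets lborel" using open_open_cell[OF mesh_invertible[OF mesh]] \<Omega> by auto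
      then show "integrable lborel (\<lambda>y. indicator (open_cell T \<inter> \<Omega>) y *\<^sub>R (fe_fun q \<A> v y * fe_fun q \<A> v y))"
        by (rule integrable_product[OF _ v v])
      show "integrable lborel (\<lambda>y. indicator \<Omega> y *\<^sub>R (fe_fun q \<A> v y * fe_fun q \<A> v y))"
        by (rule integrable_product[OF \<Omega> v v])
    qed (auto simp: indicator_def)
    finally have "c * ?s \<le> ?J" by (simp add: power2_eq_square)
    then have "\<Lambda>\<^sup>2 * (c * ?s) \<le> \<Lambda>\<^sup>2 * ?J" by (intro mult_left_mono) auto
    moreover have "c * (v \<sigma>)\<^sup>2 \<le> c * (\<Lambda>\<^sup>2 * ?s)" using 1 c by (intro mult_left_mono) auto
    ultimately show ?thesis by (simp add: mult.left_commute)
  qed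
  have "c * (\<Sum>\<sigma>\<in>S. (v \<sigma>)\<^sup>2) = (\<Sum>\<sigma>\<in>S. c * (v \<sigma>)\<^sup>2)" by (simp add: sum_distrib_left)
  also have "\<dots> \<le> (\<Sum>\<sigma>\<in>S. \<Lambda>\<^sup>2 * ?J)" by (rule sum_mono[OF each])
  finally show ?thesis by (simp add: mult.assoc)
qed

end

section \<open>The bound on the condition number\<close>

theorem corollaryB6:
  fixes q :: nat and \<eta>\<^sub>0 :: real
    and art :: "(real ^ 'd::finite) set" and \<T> :: "'d cell set" and idx :: "'d cell \<Rightarrow> nat"
  assumes "CARD('d) \<in> {2, 3}"
    and "q \<ge> 1"
    and "0 < \<eta>\<^sub>0" and "\<eta>\<^sub>0 \<le> 1"
    and "forest_mesh art \<T>"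
    and "inj_on idx \<T>"
  shows "\<exists>C::real. C > 0 \<and> (\<forall>\<Omega> R assigned.
    let \<W> = well_posed \<eta>\<^sub>0 \<Omega> \<T>; \<I> = ill_posed \<eta>\<^sub>0 \<Omega> \<T>; \<A> = active \<eta>\<^sub>0 \<Omega> \<T>;
        K = (\<lambda>\<sigma>. R (assigned \<sigma>))
    in polygonal_domain \<Omega> \<and> \<Omega> \<subseteq> art \<and>
       (\<forall>T\<in>\<T>. connected (open_cell T \<inter> \<Omega>)) \<and>
       root_cell_map idx \<Omega> \<W> \<I> R \<and>
       (\<forall>\<sigma>\<in>ill_free_dofs q \<A> \<W>. assigned \<sigma> \<in> \<I> \<and> snd \<sigma> \<in> closed_cell (assigned \<sigma>))
     \<longrightarrow> cond_number (well_free_dofs q \<A> \<W>) (mass_matrix q \<Omega> \<A> \<W> K) \<le> ereal C)"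
proof -
  obtain \<C> where C: "coarse_mesh art \<C>" "refinement_of \<C> \<T>" "balanced \<T>"
    using assms(5) unfolding forest_mesh_def by blast
  interpret forest art \<C> \<T> using C by unfold_locales
  obtain \<Lambda> where \<Lambda>: "\<Lambda> \<ge> 1"
    "\<And>T z. T \<in> \<T> \<Longrightarrow> z \<in> (\<Union>T\<in>\<T>. closed_cell T) \<Longrightarrow> (\<Sum>\<sigma>\<in>local_dofs q T. \<bar>shape q T (snd \<sigma>) z\<bar>) \<le> \<Lambda>"
    by (rule lebesgue_constant[of q]) (rule that)
  obtain c where c: "0 < c" "\<And>T v B. T \<in> \<T> \<Longrightarrow> B \<in> sets lborel \<Longrightarrow> B \<subseteq> open_cell T \<Longrightarrow>
      \<eta>\<^sub>0 * measure lborel (open_cell T) \<le> measure lborel B \<Longrightarrow>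
    c * (\<Sum>\<sigma>\<in>local_dofs q T. (v \<sigma>)\<^sup>2) \<le> (\<integral>y\<in>B. (poly_ext q T v y)\<^sup>2 \<partial>lborel)"
    by (rule mesh_lower_bound[OF assms(2,3)]) (rule that)
  \<comment> \<open>all constants depend on the mesh only; the summand 1 keeps N positive if there are no degrees of freedom\<close>
  define N where "N = real (card (dofs q \<T>)) + 1"
  define b where "b = \<Lambda> ^ 8 * measure lborel (\<Union>T\<in>\<T>. closed_cell T)"
  define \<mu> where "\<mu> = c / (N * \<Lambda>\<^sup>2)"
  have N: "0 < N" by (simp add: N_def add_nonneg_pos)
  have b: "0 \<le> b" using \<Lambda>(1) by (simp add: b_def)
  have \<mu>: "0 < \<mu>" using c(1) N \<Lambda>(1) by (simp add: \<mu>_def)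
  show ?thesis
  proof (intro exI[of _ "N\<^sup>2 * b / \<mu> + 1"] conjI allI)
    have "0 \<le> N\<^sup>2 * b / \<mu>" using b \<mu> by simp
    then show "0 < N\<^sup>2 * b / \<mu> + 1" by simp
    fix \<Omega> and R :: "'d cell \<Rightarrow> 'd cell" and assigned :: "'d dof \<Rightarrow> 'd cell"
    define \<W> where "\<W> = well_posed \<eta>\<^sub>0 \<Omega> \<T>"
    define \<I> where "\<I> = ill_posed \<eta>\<^sub>0 \<Omega> \<T>"
    define \<A> where "\<A> = active \<eta>\<^sub>0 \<Omega> \<T>"
    define K where "K = (\<lambda>\<sigma>. R (assigned \<sigma>))"
    have "cond_number (well_free_dofs q \<A> \<W>) (mass_matrix q \<Omega> \<A> \<W> K) \<le> ereal (N\<^sup>2 * b / \<mu> + 1)"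
      if dom: "polygonal_domain \<Omega>" and root: "root_cell_map idx \<Omega> \<W> \<I> R"
        and ass: "\<forall>\<sigma>\<in>ill_free_dofs q \<A> \<W>. assigned \<sigma> \<in> \<I> \<and> snd \<sigma> \<in> closed_cell (assigned \<sigma>)"
    proof -
      have sub: "\<W> \<subseteq> \<A>" "\<A> \<subseteq> \<T>"
        by (auto simp: \<W>_def \<A>_def active_def well_posed_def ill_posed_def)
      have W: "finite \<W>" "inj_on idx \<W>"
        using sub finite_mesh assms(6) by (meson finite_subset inj_on_subset order.trans)+
      interpret aggregated art \<C> \<T> q \<A> \<W> K \<Lambda>
      proof unfold_locales
        fix \<sigma> assume "\<sigma> \<in> ill_free_dofs q \<A> \<W>"
        then show "K \<sigma> \<in> \<W>" using root_cell_map_well[OF root W] ass by (simp add: K_def)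
      qed (use assms(2) sub \<Lambda> in auto)
      have \<Omega>: "\<Omega> \<in> sets lborel" using dom by (simp add: polygonal_domain_def)
      have card: "real (card S) \<le> N"
      proof -
        have "S \<subseteq> dofs q \<T>" using sub by (auto simp: well_free_dofs_def free_dofs_def dofs_def)
        moreover have "finite (dofs q \<T>)" using finite_mesh by (simp add: dofs_def)
        ultimately have "card S \<le> card (dofs q \<T>)" by (intro card_mono)
        then show ?thesis by (simp add: N_def)
      qed
      have low: "\<mu> * (\<Sum>i\<in>S. (x i)\<^sup>2) \<le> (\<Sum>i\<in>S. x i * (\<Sum>j\<in>S. mass_matrix q \<Omega> \<A> \<W> K i j * x j))" for x
      proof -
        define v where "v = (\<lambda>\<sigma>. \<Sum>i\<in>S. x i * basis i \<sigma>)"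
        have v: "v \<in> V_ag q \<A> \<W> K" unfolding v_def by (rule V_ag_lincomb[OF finite_S basis(1)])
        have vS: "v \<sigma> = x \<sigma>" if "\<sigma> \<in> S" for \<sigma>
        proof -
          have "v \<sigma> = (\<Sum>i\<in>S. if \<sigma> = i then x i else 0)"
            unfolding v_def using basis(2)[OF that] by (intro sum.cong) auto
          then show ?thesis using that finite_S by simp
        qed
        let ?J = "\<integral>y\<in>\<Omega>. (fe_fun q \<A> v y)\<^sup>2 \<partial>lborel"
        have J0: "0 \<le> ?J" unfolding set_lebesgue_integral_def by (rule Bochner_Integration.integral_nonneg) simp
        have "c * (\<Sum>\<sigma>\<in>S. (v \<sigma>)\<^sup>2) \<le> real (card S) * \<Lambda>\<^sup>2 * ?J"
        proof (rule well_free_lower_bound[OF \<Omega> v c(1)])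
          fix T assume T: "T \<in> \<W>"
          then have mesh: "T \<in> \<T>" using sub well_sub by blast
          have "\<eta>\<^sub>0 \<le> measure lborel (open_cell T \<inter> \<Omega>) / measure lborel (open_cell T)"
            using T by (simp add: \<W>_def well_posed_def vol_frac_def)
          then have "\<eta>\<^sub>0 * measure lborel (open_cell T) \<le> measure lborel (open_cell T \<inter> \<Omega>)"
            using open_cell_measure_pos[OF mesh_invertible[OF mesh]] by (simp add: pos_le_divide_eq)
          moreover have "open_cell T \<inter> \<Omega> \<in> sets lborel"
            using open_open_cell[OF mesh_invertible[OF mesh]] \<Omega> by auto
          ultimately show "c * (\<Sum>\<sigma>\<in>local_dofs q T. (v \<sigma>)\<^sup>2) \<le> (\<integral>y\<in>open_cell T \<inter> \<Omega>. (poly_ext q T v y)\<^sup>2 \<partial>lborel)"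
            by (intro c(2)[OF mesh]) auto
        qed
        also have "\<dots> \<le> N * \<Lambda>\<^sup>2 * ?J" using card J0 by (intro mult_right_mono) auto
        finally have "\<mu> * (\<Sum>\<sigma>\<in>S. (v \<sigma>)\<^sup>2) \<le> ?J"
          using N \<Lambda>(1) by (simp add: \<mu>_def divide_le_eq mult.commute)
        then show ?thesis
          unfolding mass_matrix_form[OF \<Omega>] v_def[symmetric] using vS by simp
      qed
      have "cond_number S (mass_matrix q \<Omega> \<A> \<W> K) \<le> ereal ((real (card S))\<^sup>2 * b / \<mu>)"
        by (rule cond_number_le[OF finite_S _ b \<mu> low]) (simp add: b_def mass_matrix_entry_le[OF \<Omega>])
      moreover have "(real (card S))\<^sup>2 * b / \<mu> \<le> N\<^sup>2 * b / \<mu>"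
        using card b \<mu> by (intro divide_right_mono mult_right_mono power_mono) auto
      then have "ereal ((real (card S))\<^sup>2 * b / \<mu>) \<le> ereal (N\<^sup>2 * b / \<mu> + 1)" by simp
      ultimately show ?thesis by (rule order.trans)
    qed
    then show "let \<W> = well_posed \<eta>\<^sub>0 \<Omega> \<T>; \<I> = ill_posed \<eta>\<^sub>0 \<Omega> \<T>; \<A> = active \<eta>\<^sub>0 \<Omega> \<T>;
        K = (\<lambda>\<sigma>. R (assigned \<sigma>))
    in polygonal_domain \<Omega> \<and> \<Omega> \<subseteq> art \<and>
       (\<forall>T\<in>\<T>. connected (open_cell T \<inter> \<Omega>)) \<and>
       root_cell_map idx \<Omega> \<W> \<I> R \<and>
       (\<forall>\<sigma>\<in>ill_free_dofs q \<A> \<W>. assigned \<sigma> \<in> \<I> \<and> snd \<sigma> \<in> closed_cell (assigned \<sigma>))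
     \<longrightarrow> cond_number (well_free_dofs q \<A> \<W>) (mass_matrix q \<Omega> \<A> \<W> K) \<le> ereal (N\<^sup>2 * b / \<mu> + 1)"
      unfolding Let_def \<W>_def \<I>_def \<A>_def K_def by blast
  qed
qed

end
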